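(* Let $T$ be large and let $N$ satisfy $\log N=(\log T\,\log_2 T)^{1/2}\,\tau$, where $\tau=\tau(T)>0$ satisfies $\tau=(\log_2 T)^{O(1)}$. Let $A,\tau'\in\mathbb{R}$ be such that \[\tau=\int_A^\infty \frac{e^{-u}}{u}\,du,\qquad \tau'=\int_A^\infty\frac{e^{-u}}{u^2}\,du.\] Let $f$ be any completely multiplicative function with $|f(n)|=1$ for every positive integer $n$. Then \[\max_{1\le t\le T}\Big|\sum_{n\le N}f(n)n^{it}\Big|\ge \sqrt{N}\exp\bigg((1+o(1))\,A(\tau+\tau')\sqrt{\frac{\log T}{\log_2 T}}\bigg),\] where $o(1)$ denotes a quantity tending to $0$ as $T\to\infty$.
   Context: $\log_2 T=\log\log T$. A function $f:\mathbb{N}\to\mathbb{C}$ is completely multiplicative if $f(mn)=f(m)f(n)$ for all positive integers $m,n$. *)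

theory Defs
  imports "HOL-Analysis.Analysis"
begin

(* The value at 0 is irrelevant: the domain is the positive integers. *)
definition completely_multiplicative :: "(nat \<Rightarrow> complex) \<Rightarrow> bool" where
  "completely_multiplicative f \<longleftrightarrow> (\<forall>m n. m > 0 \<longrightarrow> n > 0 \<longrightarrow> f (m * n) = f m * f n)"

definition twisted_sum :: "(nat \<Rightarrow> complex) \<Rightarrow> real \<Rightarrow> real \<Rightarrow> complex" where
  "twisted_sum f N t =
     (\<Sum>n | 1 \<le> n \<and> real n \<le> N. f n * of_nat n powr (\<i> * complex_of_real t))"

(* Written as a supremum because Max is only meaningful on finite sets; the lemma
   below shows that for T \<ge> 1 it is attained, i.e. it is the maximum. *)
definition max_twisted_sum :: "(nat \<Rightarrow> complex) \<Rightarrow> real \<Rightarrow> real \<Rightarrow> real" where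
  "max_twisted_sum f N T = (SUP t\<in>{1..T}. norm (twisted_sum f N t))"

lemma max_twisted_sum_attained:
  assumes "T \<ge> 1"
  shows "\<exists>t\<in>{1..T}. norm (twisted_sum f N t) = max_twisted_sum f N T \<and>
           (\<forall>s\<in>{1..T}. norm (twisted_sum f N s) \<le> norm (twisted_sum f N t))"
proof -
  have "continuous_on {1..T} (\<lambda>t. norm (twisted_sum f N t))"
    unfolding twisted_sum_def by (intro continuous_intros) auto
  then obtain t where t: "t \<in> {1..T}"
      "\<forall>s\<in>{1..T}. norm (twisted_sum f N s) \<le> norm (twisted_sum f N t)"
    using continuous_attains_sup[of "{1..T}" "\<lambda>t. norm (twisted_sum f N t)"] assms by auto
  then have "max_twisted_sum f N T = norm (twisted_sum f N t)"
    unfolding max_twisted_sum_def by (intro cSup_eq_maximum) auto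
  with t show ?thesis by auto
qed

end

theory Submission
  imports Defs "HOL-Probability.Probability" "HOL-Real_Asymp.Real_Asymp"
    "HOL-Computational_Algebra.Primes"
begin

text \<open>
  The resonance method. Write \<open>x = ln T\<close>, \<open>l = ln x\<close>, \<open>L = sqrt (x * l)\<close>. The resonator is
  \<open>R t = (\<Sum>m. r m * f m * m powr (\<i> t))\<close>, where \<open>m\<close> runs over the squarefree products, of size at most
  \<open>T powr d\<close>, of primes \<open>p\<close> with \<open>l < ln p \<le> B * l\<close>, and \<open>r p\<close> is close to \<open>L / (sqrt p * ln p)\<close>.
  The second moment of \<open>R\<close> times the sum over \<open>n \<le> N\<close> is compared with that of \<open>R\<close>,
  averaging over a Gaussian centred at \<open>T / 2\<close>, for which the off-diagonal terms are negligible.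
  On the diagonal \<open>f\<close> drops out. With \<open>n = c * u\<close>, \<open>c\<close> coprime to the support of the resonator, the
  ratio of the moments is bounded below by the number of \<open>c\<close> times the square of a truncated
  multiplicative sum over \<open>u\<close>; Cauchy's inequality, and Markov's inequality for a random subset of
  the primes, take care of the truncation. The sum over \<open>u\<close> is evaluated by tilting with
  \<open>u powr - (1 / 2 + A / l)\<close>, the saddle point for sums up to \<open>N\<close>, and Chebyshev's inequality.
  The prime sums that remain need only Mertens' first theorem, and the exponent appears as
  \<open>A * (\<tau> + \<tau>') = exp (- A)\<close>. The second moment, rather than the first, allows \<open>N\<close> to exceed
  every product of resonator primes, as happens when \<open>\<tau>\<close> is large.
\<close>

section \<open>Mertens' first theorem\<close>

text \<open>One parameter \<open>lam\<close> has to meet two length constraints. Under the squared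
  resonator weights the mean of \<open>ln m\<close> is about \<open>lam ^ 2 / l\<close> and must
  stay below \<open>ln T\<close>; under the tilted weights the mean of \<open>ln u\<close> is about
  \<open>lam * \<tau>\<close> and must stay below \<open>ln N = L * \<tau>\<close>. Both allow
  \<open>lam\<close> to come close to \<open>L\<close>, and this is how \<tau> determines
  \<open>A\<close>. What remains besides \<open>sqrt N\<close> is \<open>A / l\<close> times the
  mean of \<open>ln u\<close> plus the logarithm of the tilted Euler product. Prime by prime these
  two add up to values of an exact derivative, whence the closed form of the exponent.

  The obstacle is uniformity. The gain \<open>exp (- A) * sqrt (x / l)\<close> may fall below
  \<open>sqrt (x / l)\<close> by a power of \<open>l\<close>, so every loss is kept explicit in the
  Mertens constant \<open>D\<close> and charged against this gain, using a lower bound for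
  \<open>exp (- A)\<close> in terms of \<tau>.\<close>

definition theta :: "nat \<Rightarrow> real" where
  "theta n = (\<Sum>p | prime p \<and> p \<le> n. ln (real p))"

lemma finite_primes_le [simp]: "finite {p::nat. prime p \<and> p \<le> n}"
  by (rule finite_subset[of _ "{..n}"]) auto

text \<open>The entries at \<open>m\<close> and \<open>m + 1\<close> of row \<open>2 * m + 1\<close>
  coincide, so twice this entry is at most the row sum \<open>2 * 4 ^ m\<close>.\<close>

lemma choose_mid_le: "(2 * m + 1) choose m \<le> (4::nat) ^ m"
proof -
  have "2 * ((2 * m + 1) choose m) = (\<Sum>k\<in>{m, Suc m}. (2 * m + 1) choose k)"
    using binomial_symmetric[of m "2 * m + 1"] by simp
  also have "\<dots> \<le> (\<Sum>k\<le>2 * m + 1. (2 * m + 1) choose k)"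
    by (intro sum_mono2) auto
  also have "\<dots> = 2 ^ (2 * m + 1)"
    by (rule choose_row_sum)
  also have "\<dots> = 2 * 4 ^ m"
    by (simp add: power_mult)
  finally show ?thesis by simp
qed

lemma prod_primes_dvd:
  assumes "finite S" "\<And>p. p \<in> S \<Longrightarrow> prime (p::nat)" "\<And>p. p \<in> S \<Longrightarrow> p dvd k"
  shows "\<Prod>S dvd k"
  using assms
proof (induction S rule: finite_induct)
  case (insert p S)
  have "coprime p (\<Prod>S)"
    using insert by (intro prod_coprime_right primes_coprime) auto
  thus ?case using insert by (simp add: divides_mult)
qed simp

text \<open>Chebyshev's upper bound by Erdos's induction: for \<open>n = 2 * m + 1\<close> every
  prime in \<open>(m + 1, n]\<close> divides \<open>n choose m\<close>, which is at most
  \<open>4 ^ m\<close>, and the primes up to \<open>m + 1\<close> are left to the induction. An even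
  \<open>n > 2\<close> adds no prime.\<close>

lemma theta_le: "theta n \<le> real n * ln 4"
proof (induction n rule: less_induct)
  case (less n)
  consider "n = 0" | "n = 1" | "n = 2" | "even n" "n > 2" | "odd n" "n > 2" by linarith
  then show ?case
  proof cases
    assume "n = 0"
    then show ?thesis unfolding theta_def by simp
  next
    assume "n = 1"
    then have "{p. prime p \<and> p \<le> n} = {}" by (auto dest: prime_gt_1_nat)
    then show ?thesis unfolding theta_def by (simp only: sum.empty) simp
  next
    assume "n = 2"
    then have "{p. prime p \<and> p \<le> n} = {2}"
      by (auto dest: prime_ge_2_nat intro: antisym)
    then have "theta n = ln 2" by (simp add: theta_def)
    also have "\<dots> \<le> 2 * ln 4" using ln_realpow[of 2 2] by simp
    finally show ?thesis using \<open>n = 2\<close> by simp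
  next
    assume n: "even n" "n > 2"
    then have "{p. prime p \<and> p \<le> n} = {p. prime p \<and> p \<le> n - 1}"
      using prime_odd_nat[of n] by (auto simp: le_less)
    then have "theta n = theta (n - 1)" by (simp add: theta_def)
    also have "\<dots> \<le> real (n - 1) * ln 4" using n by (intro less) auto
    also have "\<dots> \<le> real n * ln 4" by (intro mult_right_mono) auto
    finally show ?thesis .
  next
    assume "odd n" "n > 2"
    then obtain m where m: "n = 2 * m + 1" "m \<ge> 1" by (elim oddE) auto
    let ?S = "{p. prime p \<and> m + 1 < p \<and> p \<le> n}"
    have fin: "finite ?S" by (rule finite_subset[of _ "{..n}"]) auto
    have "\<Prod>?S dvd (n choose m)"
    proof (rule prod_primes_dvd[OF fin])
      fix p assume "p \<in> ?S"
      then have p: "prime p" "m + 1 < p" "p \<le> n" by auto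
      have "fact m * fact (n - m) * (n choose m) = (fact n :: nat)"
        using m by (intro binomial_fact_lemma) auto
      moreover have "p dvd (fact n :: nat)" "\<not> p dvd (fact m :: nat)" "\<not> p dvd (fact (n - m) :: nat)"
        using p(2,3) m unfolding prime_dvd_fact_iff[OF p(1)] by auto
      ultimately show "p dvd (n choose m)" using p(1) by (metis prime_dvd_mult_iff)
    qed auto
    then have "\<Prod>?S \<le> n choose m" using m by (intro dvd_imp_le) auto
    also have "\<dots> \<le> 4 ^ m" using choose_mid_le[of m] m by simp
    finally have le: "\<Prod>?S \<le> 4 ^ m" .
    have pos: "\<Prod>?S > 0" by (rule prod_pos) (auto dest: prime_gt_0_nat)
    have "(\<Sum>p\<in>?S. ln (real p)) = ln (\<Prod>p\<in>?S. real p)"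
      by (rule ln_prod[symmetric, OF fin]) (auto dest: prime_gt_0_nat)
    also have "\<dots> = ln (real (\<Prod>?S))" by simp
    also have "\<dots> \<le> ln (real (4 ^ m))"
      using pos le by (subst ln_le_cancel_iff) (auto simp del: of_nat_prod of_nat_power)
    also have "\<dots> = real m * ln 4" by (simp add: ln_realpow)
    finally have 1: "(\<Sum>p\<in>?S. ln (real p)) \<le> real m * ln 4" .
    have "{p. prime p \<and> p \<le> n} = {p. prime p \<and> p \<le> m + 1} \<union> ?S" using m by auto
    then have "theta n = theta (m + 1) + (\<Sum>p\<in>?S. ln (real p))"
      unfolding theta_def using fin by (simp, subst sum.union_disjoint) auto
    also have "\<dots> \<le> real (m + 1) * ln 4 + real m * ln 4"
      using less[of "m + 1"] m 1 by simp
    also have "\<dots> = real n * ln 4" using m by (simp add: algebra_simps)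
    finally show ?thesis .
  qed
qed

text \<open>The exponents range up to a common \<open>n\<close> rather than up to \<open>m\<close>,
  so that one index set serves all \<open>m \<le> n\<close> when sums are interchanged.\<close>

lemma multiplicity_eq_card:
  assumes "prime (p::nat)" "0 < m" "m \<le> n"
  shows "multiplicity p m = card {i\<in>{1..n}. p ^ i dvd m}"
proof -
  have "{i\<in>{1..n}. p ^ i dvd m} = {1..multiplicity p m}"
  proof -
    have "i \<le> n" if "p ^ i dvd m" for i
    proof -
      have "i < 2 ^ i" by simp
      also have "2 ^ i \<le> p ^ i" using assms(1) by (intro power_mono prime_ge_2_nat) auto
      also have "\<dots> \<le> m" using that assms by (auto intro: dvd_imp_le)
      finally show ?thesis using assms by simp
    qed
    moreover have "p ^ i dvd m \<longleftrightarrow> i \<le> multiplicity p m" for i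
      using assms by (intro power_dvd_iff_le_multiplicity) (auto simp: prime_gt_1_nat)
    ultimately show ?thesis by auto
  qed
  thus ?thesis by simp
qed

lemma card_multiples:
  assumes "d > 0"
  shows "card {m\<in>{1..n}. d dvd m} = n div d"
proof -
  have "{m\<in>{1..n}. d dvd m} = (\<lambda>k. d * k) ` {1..n div d}"
    using assms by (auto simp: less_eq_div_iff_mult_less_eq mult.commute elim!: dvdE)
  moreover have "inj_on (\<lambda>k. d * k) {1..n div d}" using assms by (auto simp: inj_on_def)
  ultimately show ?thesis by (simp add: card_image)
qed

lemma ln_eq_sum_multiplicity:
  assumes "0 < m" "m \<le> n"
  shows "ln (real m) = (\<Sum>p | prime p \<and> p \<le> n. real (multiplicity p m) * ln (real p))"
proof -
  have "real m = (\<Prod>p\<in>prime_factors m. real p ^ multiplicity p m)"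
    using arg_cong[OF prime_factorization_nat[OF assms(1)], of real] by simp
  then have "ln (real m) = ln (\<Prod>p\<in>prime_factors m. real p ^ multiplicity p m)"
    by (rule arg_cong)
  also have "\<dots> = (\<Sum>p\<in>prime_factors m. ln (real p ^ multiplicity p m))"
    by (rule ln_prod) (auto dest: in_prime_factors_imp_prime prime_gt_0_nat)
  also have "\<dots> = (\<Sum>p\<in>prime_factors m. real (multiplicity p m) * ln (real p))"
    by (simp add: ln_realpow)
  also have "\<dots> = (\<Sum>p | prime p \<and> p \<le> n. real (multiplicity p m) * ln (real p))"
    using assms
    by (intro sum.mono_neutral_left)
       (auto simp: in_prime_factors_iff not_dvd_imp_multiplicity_0 intro: order_trans[OF dvd_imp_le])
  finally show ?thesis .
qed

text \<open>Legendre's formula, by counting the pairs of \<open>m \<le> n\<close> and a prime power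
  dividing \<open>m\<close> in both orders.\<close>

lemma ln_fact_eq:
  "ln (fact n :: real) = (\<Sum>p | prime p \<and> p \<le> n. ln (real p) * (\<Sum>i\<in>{1..n}. real (n div p ^ i)))"
proof -
  have "ln (fact n :: real) = (\<Sum>m\<in>{1..n}. ln (real m))"
    unfolding fact_prod of_nat_prod by (subst ln_prod) auto
  also have "\<dots> = (\<Sum>m\<in>{1..n}. \<Sum>p | prime p \<and> p \<le> n. real (multiplicity p m) * ln (real p))"
    by (intro sum.cong refl ln_eq_sum_multiplicity) auto
  also have "\<dots> = (\<Sum>p | prime p \<and> p \<le> n. \<Sum>m\<in>{1..n}. real (multiplicity p m) * ln (real p))"
    by (rule sum.swap)
  also have "\<dots> = (\<Sum>p | prime p \<and> p \<le> n. ln (real p) * (\<Sum>i\<in>{1..n}. real (n div p ^ i)))"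
  proof (intro sum.cong refl)
    fix p assume p: "p \<in> {p. prime p \<and> p \<le> n}"
    have "(\<Sum>m\<in>{1..n}. multiplicity p m) = (\<Sum>m\<in>{1..n}. \<Sum>i\<in>{1..n}. if p ^ i dvd m then 1 else 0)"
    proof (intro sum.cong refl)
      fix m assume "m \<in> {1..n}"
      then show "multiplicity p m = (\<Sum>i\<in>{1..n}. if p ^ i dvd m then 1 else 0)"
        using p multiplicity_eq_card[of p m n] by (simp add: sum.If_cases Int_def)
    qed
    also have "\<dots> = (\<Sum>i\<in>{1..n}. \<Sum>m\<in>{1..n}. if p ^ i dvd m then 1 else 0)"
      by (rule sum.swap)
    also have "\<dots> = (\<Sum>i\<in>{1..n}. n div p ^ i)"
      using p by (intro sum.cong refl, subst card_multiples[symmetric])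
        (auto simp: sum.If_cases Int_def prime_gt_0_nat)
    finally have "real (\<Sum>m\<in>{1..n}. multiplicity p m) = real (\<Sum>i\<in>{1..n}. n div p ^ i)" by simp
    then show "(\<Sum>m\<in>{1..n}. real (multiplicity p m) * ln (real p)) =
        ln (real p) * (\<Sum>i\<in>{1..n}. real (n div p ^ i))"
      by (simp add: sum_distrib_right[symmetric] mult.commute flip: sum_distrib_left)
  qed
  finally show ?thesis .
qed

lemma ln_fact_upper: "ln (fact n :: real) \<le> real n * ln (real n)"
proof (cases "n = 0")
  case False
  have "ln (fact n :: real) \<le> ln (real n ^ n)"
    using False fact_le_power[where 'a = real, of n] by (subst ln_le_cancel_iff) auto
  then show ?thesis using False by (simp add: ln_realpow)
qed simp

lemma ln_fact_lower: "ln (fact n :: real) \<ge> real n * ln (real n) - real n"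
proof (induction n)
  case (Suc n)
  show ?case
  proof (cases "n = 0")
    case False
    have "ln (1 + 1 / real n) \<le> 1 / real n" using False by (intro ln_add_one_self_le_self) auto
    moreover have "1 + 1 / real n = real (Suc n) / real n" using False by (simp add: field_simps)
    ultimately have "ln (real (Suc n)) - ln (real n) \<le> 1 / real n"
      using False ln_div[of "real (Suc n)" "real n"] by simp
    then have "real n * (ln (real (Suc n)) - ln (real n)) \<le> 1"
      using False by (simp add: field_simps)
    moreover have "ln (fact (Suc n) :: real) = ln (real (Suc n)) + ln (fact n)"
      by (simp only: fact_Suc of_nat_mult[symmetric] of_nat_fact) (subst ln_mult, auto)
    ultimately show ?thesis using Suc by (simp add: algebra_simps)
  qed simp
qed simp

text \<open>The terms are the differences between \<open>ln p / (p - 1)\<close> and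
  \<open>ln p / p\<close>, which is what the higher prime powers in Legendre's formula cost.\<close>

lemma summable_ln_over: "summable (\<lambda>m. ln (real m) / (real m * (real m - 1)))"
proof (rule summable_comparison_test_bigo)
  show "summable (\<lambda>m. norm (real m powr - (3/2)))"
    by (simp add: summable_real_powr_iff)
  show "(\<lambda>m. ln (real m) / (real m * (real m - 1))) \<in> O(\<lambda>m. real m powr - (3/2))"
    by real_asymp
qed

text \<open>Divide Legendre's formula for \<open>ln (fact n)\<close>, which is
  \<open>n * ln n\<close> up to an error \<open>n\<close>, by \<open>n\<close>. For the upper bound
  keep only \<open>i = 1\<close>; the fractional parts cost at most \<open>theta n\<close>, hence a
  constant. For the lower bound replace each inner sum by the geometric series
  \<open>n / (p - 1)\<close>.\<close>

lemma mertens_nat: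
  "\<exists>C::real. \<forall>n\<ge>1. \<bar>(\<Sum>p | prime p \<and> p \<le> n. ln (real p) / real p) - ln (real n)\<bar> \<le> C"
proof -
  define D where "D = (\<Sum>m. ln (real m) / (real m * (real m - 1)))"
  have "\<bar>(\<Sum>p | prime p \<and> p \<le> n. ln (real p) / real p) - ln (real n)\<bar> \<le> max (ln 4) (1 + D)"
    if n: "n \<ge> 1" for n
  proof -
    let ?P = "{p. prime p \<and> p \<le> n}"
    let ?s = "\<Sum>p\<in>?P. ln (real p) / real p"
    have lnp: "ln (real p) \<ge> 0" "real p > 1" if "p \<in> ?P" for p
      using that prime_gt_1_nat[of p] by auto
    have "real n * ?s - theta n = (\<Sum>p\<in>?P. ln (real p) * (real n / real p - 1))"
      by (simp add: theta_def sum_distrib_left sum_subtractf algebra_simps)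
    also have "\<dots> \<le> (\<Sum>p\<in>?P. ln (real p) * (\<Sum>i\<in>{1..n}. real (n div p ^ i)))"
    proof (intro sum_mono mult_left_mono)
      fix p assume p: "p \<in> ?P"
      have "real n / real p - 1 \<le> real (n div p)"
        using floor_divide_of_nat_eq[of n p, where 'a = real] real_of_int_floor_gt_diff_one[of "real n / real p"] by simp
      also have "\<dots> = (\<Sum>i\<in>{1}. real (n div p ^ i))" by simp
      also have "\<dots> \<le> (\<Sum>i\<in>{1..n}. real (n div p ^ i))"
        using n by (intro sum_mono2) auto
      finally show "real n / real p - 1 \<le> (\<Sum>i\<in>{1..n}. real (n div p ^ i))" .
    qed (use lnp in auto)
    also have "\<dots> \<le> real n * ln (real n)" using ln_fact_upper[of n] by (simp add: ln_fact_eq)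
    finally have "real n * (?s - ln (real n)) \<le> real n * ln 4"
      using theta_le[of n] by (simp add: algebra_simps)
    then have upper: "?s - ln (real n) \<le> ln 4" using n by (subst (asm) mult_le_cancel_left) auto

    have "real n * ln (real n) - real n \<le> (\<Sum>p\<in>?P. ln (real p) * (\<Sum>i\<in>{1..n}. real (n div p ^ i)))"
      using ln_fact_lower[of n] by (simp add: ln_fact_eq)
    also have "\<dots> \<le> (\<Sum>p\<in>?P. ln (real p) * (real n / (real p - 1)))"
    proof (intro sum_mono mult_left_mono)
      fix p assume p: "p \<in> ?P"
      have "(\<Sum>i\<in>{1..n}. real (n div p ^ i)) \<le> (\<Sum>i\<in>{1..n}. real n * (1 / real p) ^ i)"
        using of_nat_div_le_of_nat[of n, where 'a = real] by (intro sum_mono) (auto simp: power_divide simp flip: of_nat_power)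
      also have "\<dots> = real n * (\<Sum>i\<in>{1..n}. (1 / real p) ^ i)" by (simp add: sum_distrib_left)
      also have "(\<Sum>i\<in>{1..n}. (1 / real p) ^ i) \<le> 1 / (real p - 1)"
      proof -
        have "(\<Sum>i\<in>{1..n}. (1 / real p) ^ i) = ((1 / real p) - (1 / real p) ^ Suc n) / (1 - 1 / real p)"
          using lnp(2)[OF p] n by (subst sum_gp) auto
        also have "\<dots> \<le> (1 / real p) / (1 - 1 / real p)"
          using lnp(2)[OF p] by (intro divide_right_mono) auto
        also have "\<dots> = 1 / (real p - 1)" using lnp(2)[OF p] by (simp add: field_simps)
        finally show ?thesis .
      qed
      finally show "(\<Sum>i\<in>{1..n}. real (n div p ^ i)) \<le> real n / (real p - 1)"
        by (simp add: mult_left_mono)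
    qed (use lnp in auto)
    also have "\<dots> = real n * (\<Sum>p\<in>?P. ln (real p) / (real p - 1))"
      by (simp add: sum_distrib_left algebra_simps)
    finally have "real n * (ln (real n) - 1) \<le> real n * (\<Sum>p\<in>?P. ln (real p) / (real p - 1))"
      by (simp add: algebra_simps)
    then have "ln (real n) - 1 \<le> (\<Sum>p\<in>?P. ln (real p) / (real p - 1))"
      using n by (subst (asm) mult_le_cancel_left) auto
    also have "\<dots> = ?s + (\<Sum>p\<in>?P. ln (real p) / (real p * (real p - 1)))"
      unfolding sum.distrib[symmetric]
    proof (intro sum.cong refl)
      fix p assume "p \<in> ?P"
      with lnp(2)[OF this] show "ln (real p) / (real p - 1) = ln (real p) / real p + ln (real p) / (real p * (real p - 1))"
        by (simp add: divide_simps) (simp add: algebra_simps)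
    qed
    also have "(\<Sum>p\<in>?P. ln (real p) / (real p * (real p - 1))) \<le> D"
      unfolding D_def
    proof (rule sum_le_suminf[OF summable_ln_over])
      fix m :: nat
      show "0 \<le> ln (real m) / (real m * (real m - 1))" by (cases "m = 0") auto
    qed simp
    finally have "?s - ln (real n) \<ge> - (1 + D)" by simp
    with upper show ?thesis by linarith
  qed
  then show ?thesis by blast
qed

lemma mertens:
  "\<exists>C>0. \<forall>x\<ge>1. \<bar>(\<Sum>p | prime p \<and> real p \<le> x. ln (real p) / real p) - ln x\<bar> \<le> C"
proof -
  obtain C where C: "\<And>n. n \<ge> 1 \<Longrightarrow> \<bar>(\<Sum>p | prime p \<and> p \<le> n. ln (real p) / real p) - ln (real n)\<bar> \<le> C"
    using mertens_nat by blast
  have "\<bar>(\<Sum>p | prime p \<and> real p \<le> x. ln (real p) / real p) - ln x\<bar> \<le> \<bar>C\<bar> + 1" if x: "x \<ge> 1" for x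
  proof -
    define n where "n = nat \<lfloor>x\<rfloor>"
    have n: "n \<ge> 1" "real n \<le> x" "x \<le> real n + 1" using x unfolding n_def by linarith+
    have "real p \<le> x \<longleftrightarrow> p \<le> n" for p unfolding n_def using x by linarith
    then have "(\<Sum>p | prime p \<and> real p \<le> x. ln (real p) / real p) = (\<Sum>p | prime p \<and> p \<le> n. ln (real p) / real p)"
      by simp
    moreover have "ln (real n) \<le> ln x" using n by simp
    moreover have "ln x \<le> ln (real n) + 1"
    proof -
      have "x \<le> real n * exp 1"
      proof -
        have "x \<le> real n * 2" using n by linarith
        also have "\<dots> \<le> real n * exp 1" using exp_ge_add_one_self[of 1] by (intro mult_left_mono) auto
        finally show ?thesis .
      qed
      then have "ln x \<le> ln (real n * exp 1)" using n x by (subst ln_le_cancel_iff) auto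
      then show ?thesis using n by (simp add: ln_mult)
    qed
    ultimately show ?thesis using C[OF n(1)] by linarith
  qed
  then show ?thesis by (intro exI[of _ "\<bar>C\<bar> + 1"]) auto
qed

section \<open>Sums over primes\<close>

text \<open>Partial summation against a mass distribution that stays within \<open>D\<close> of
  Lebesgue measure. Writing \<open>f (y i) - f b\<close> as an integral of \<open>- f'\<close> turns
  the sum into an integral of \<open>- f'\<close> times the distribution function. As
  \<open>f\<close> decreases, replacing that function by \<open>v - a\<close> costs at most
  \<open>D * (f a - f b)\<close>, and the boundary term costs \<open>D * f b\<close> more.\<close>

lemma abel_summation_bound:
  fixes w y :: "'a \<Rightarrow> real" and F f f' :: "real \<Rightarrow> real"
  assumes I: "finite I" and ab: "a \<le> b" and w: "\<And>i. i \<in> I \<Longrightarrow> w i \<ge> 0"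
    and y: "\<And>i. i \<in> I \<Longrightarrow> a \<le> y i \<and> y i \<le> b"
    and F: "\<And>v. a \<le> v \<Longrightarrow> v \<le> b \<Longrightarrow> (F has_real_derivative f v) (at v)"
    and f: "\<And>v. a \<le> v \<Longrightarrow> v \<le> b \<Longrightarrow> (f has_real_derivative f' v) (at v)"
    and f': "\<And>v. a \<le> v \<Longrightarrow> v \<le> b \<Longrightarrow> f' v \<le> 0" and fb: "f b \<ge> 0"
    and mass: "\<And>v. a \<le> v \<Longrightarrow> v \<le> b \<Longrightarrow> \<bar>(\<Sum>i | i \<in> I \<and> y i \<le> v. w i) - (v - a)\<bar> \<le> D"
  shows "\<bar>(\<Sum>i\<in>I. w i * f (y i)) - (F b - F a)\<bar> \<le> D * f a"
proof -
  define M where "M v = (\<Sum>i | i \<in> I \<and> y i \<le> v. w i)" for v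
  have Mb: "M b = (\<Sum>i\<in>I. w i)" unfolding M_def using y by (intro sum.cong) auto
  have i1: "((\<lambda>v. if v \<in> {y i..b} then - f' v else 0) has_integral (f (y i) - f b)) {a..b}" if "i \<in> I" for i
  proof -
    have "((\<lambda>v. - f' v) has_integral (- f b - (- f (y i)))) {y i..b}"
    proof (rule fundamental_theorem_of_calculus)
      fix v assume "v \<in> {y i..b}"
      then have "((\<lambda>v. - f v) has_real_derivative (- f' v)) (at v)"
        using y[OF that] by (intro DERIV_minus f) auto
      then show "((\<lambda>v. - f v) has_vector_derivative (- f' v)) (at v within {y i..b})"
        by (simp add: has_real_derivative_iff_has_vector_derivative has_vector_derivative_at_within)
    qed (use y[OF that] in auto)
    moreover have "{y i..b} \<subseteq> {a..b}" using y[OF that] by auto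
    ultimately show ?thesis by (subst has_integral_restrict) auto
  qed
  have "((\<lambda>v. \<Sum>i\<in>I. w i * (if v \<in> {y i..b} then - f' v else 0)) has_integral (\<Sum>i\<in>I. w i * (f (y i) - f b))) {a..b}"
    by (intro has_integral_sum I has_integral_mult_right i1)
  moreover have "(\<Sum>i\<in>I. w i * (if v \<in> {y i..b} then - f' v else 0)) = - f' v * M v" if "v \<in> {a..b}" for v
  proof -
    have "(\<Sum>i\<in>I. w i * (if v \<in> {y i..b} then - f' v else 0)) = (\<Sum>i\<in>I. if y i \<le> v then - f' v * w i else 0)"
      using that by (intro sum.cong) auto
    also have "\<dots> = - f' v * M v" unfolding M_def sum_distrib_left using I by (simp add: sum.If_cases Int_def)
    finally show ?thesis .
  qed
  ultimately have iM: "((\<lambda>v. - f' v * M v) has_integral (\<Sum>i\<in>I. w i * (f (y i) - f b))) {a..b}"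
    by (rule has_integral_eq[rotated])
  \<comment> \<open>The comparison integrals for \<open>E = D\<close> and \<open>E = - D\<close>,
    evaluated exactly through the antiderivative \<open>- f v * (v - a + E) + F v\<close>.\<close>
  have iE: "((\<lambda>v. - f' v * (v - a + E)) has_integral (- f b * (b - a + E) + F b - (- f a * (a - a + E) + F a))) {a..b}" for E
  proof (rule fundamental_theorem_of_calculus[OF ab])
    fix v assume "v \<in> {a..b}"
    then have "((\<lambda>v. - f v * (v - a + E) + F v) has_real_derivative (- f' v * (v - a + E))) (at v)"
      by (auto intro!: derivative_eq_intros F f)
    then show "((\<lambda>v. - f v * (v - a + E) + F v) has_vector_derivative (- f' v * (v - a + E))) (at v within {a..b})"
      by (simp add: has_real_derivative_iff_has_vector_derivative has_vector_derivative_at_within)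
  qed
  have S: "(\<Sum>i\<in>I. w i * (f (y i) - f b)) = (\<Sum>i\<in>I. w i * f (y i)) - f b * M b"
    by (simp add: Mb right_diff_distrib sum_subtractf sum_distrib_left mult.commute)
  have M: "v - a + (- D) \<le> M v" "M v \<le> v - a + D" if "a \<le> v" "v \<le> b" for v
    using mass[OF that] unfolding M_def by linarith+
  have "(\<Sum>i\<in>I. w i * (f (y i) - f b)) \<le> - f b * (b - a + D) + F b - (- f a * (a - a + D) + F a)"
    by (rule has_integral_le[OF iM iE]) (use M f' in \<open>auto intro!: mult_left_mono_neg\<close>)
  moreover have "f b * M b \<le> f b * (b - a + D)" using M[of b] ab fb by (intro mult_left_mono) auto
  moreover have "- f b * (b - a + (- D)) + F b - (- f a * (a - a + (- D)) + F a) \<le> (\<Sum>i\<in>I. w i * (f (y i) - f b))"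
    by (rule has_integral_le[OF iE iM]) (use M f' in \<open>auto intro!: mult_left_mono_neg\<close>)
  moreover have "f b * (b - a + (- D)) \<le> f b * M b" using M[of b] ab fb by (intro mult_left_mono) auto
  ultimately show ?thesis unfolding S by (simp add: mult.commute abs_le_iff)
qed

text \<open>Windows are measured in \<open>ln p\<close>, since Mertens' theorem gives a window the
  mass of its length; being half-open, adjacent windows are disjoint.\<close>

definition log_primes :: "real \<Rightarrow> real \<Rightarrow> nat set" where
  "log_primes a b = {p. prime p \<and> a < ln (real p) \<and> ln (real p) \<le> b}"

lemma log_primesD:
  assumes "p \<in> log_primes a b"
  shows "prime p" "a < ln (real p)" "ln (real p) \<le> b" "real p > 1"
  using assms prime_gt_1_nat[of p] by (auto simp: log_primes_def)

lemma finite_log_primes [simp]: "finite (log_primes a b)"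
proof (rule finite_subset)
  show "log_primes a b \<subseteq> {p. prime p \<and> p \<le> nat \<lfloor>exp b\<rfloor>}"
  proof
    fix p assume p: "p \<in> log_primes a b"
    from log_primesD[OF p] have "real p \<le> exp b" by (metis exp_le_cancel_iff exp_ln less_trans zero_less_one)
    then show "p \<in> {p. prime p \<and> p \<le> nat \<lfloor>exp b\<rfloor>}" using log_primesD[OF p] by (simp add: le_nat_floor)
  qed
qed simp

lemma mertens_window:
  obtains D where "D > 0"
    "\<And>a b. 0 \<le> a \<Longrightarrow> a \<le> b \<Longrightarrow> \<bar>(\<Sum>p\<in>log_primes a b. ln (real p) / real p) - (b - a)\<bar> \<le> D"
proof -
  obtain C where C: "C > 0" "\<And>x. x \<ge> 1 \<Longrightarrow> \<bar>(\<Sum>p | prime p \<and> real p \<le> x. ln (real p) / real p) - ln x\<bar> \<le> C"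
    using mertens by blast
  have "\<bar>(\<Sum>p\<in>log_primes a b. ln (real p) / real p) - (b - a)\<bar> \<le> 2 * C" if ab: "0 \<le> a" "a \<le> b" for a b
  proof -
    let ?S = "\<lambda>x. {p::nat. prime p \<and> real p \<le> exp x}"
    have fin: "finite (?S x)" for x
      by (rule finite_subset[of _ "{..nat \<lfloor>exp x\<rfloor>}"]) (auto simp: le_nat_floor)
    have iff: "real p \<le> exp x \<longleftrightarrow> ln (real p) \<le> x" if "prime p" for p x
      using prime_gt_0_nat[OF that] ln_le_cancel_iff[of "real p" "exp x"] by simp
    have "?S b = ?S a \<union> log_primes a b" "?S a \<inter> log_primes a b = {}"
      using ab by (auto simp: log_primes_def iff)
    then have "(\<Sum>p\<in>?S b. ln (real p) / real p) = (\<Sum>p\<in>?S a. ln (real p) / real p) + (\<Sum>p\<in>log_primes a b. ln (real p) / real p)"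
      using fin by (simp add: sum.union_disjoint)
    moreover have "\<bar>(\<Sum>p\<in>?S a. ln (real p) / real p) - a\<bar> \<le> C" "\<bar>(\<Sum>p\<in>?S b. ln (real p) / real p) - b\<bar> \<le> C"
      using C(2)[of "exp a"] C(2)[of "exp b"] ab by auto
    ultimately show ?thesis by linarith
  qed
  with C(1) show ?thesis by (intro that[of "2 * C"]) auto
qed

text \<open>Fixing one error constant for all windows keeps the later bounds explicit in
  \<open>D\<close> and uniform in every other parameter.\<close>

locale mertens_const =
  fixes D :: real
  assumes D: "D > 0"
    and window: "\<And>a b. 0 \<le> a \<Longrightarrow> a \<le> b \<Longrightarrow> \<bar>(\<Sum>p\<in>log_primes a b. ln (real p) / real p) - (b - a)\<bar> \<le> D"
begin

lemma window_scaled: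
  assumes "\<beta> > 0" "0 \<le> a" "a \<le> b" "\<beta> * a \<le> v" "v \<le> \<beta> * b"
  shows "\<bar>(\<Sum>p | p \<in> log_primes a b \<and> \<beta> * ln (real p) \<le> v. \<beta> * (ln (real p) / real p)) - (v - \<beta> * a)\<bar> \<le> \<beta> * D"
proof -
  have "{p. p \<in> log_primes a b \<and> \<beta> * ln (real p) \<le> v} = log_primes a (v / \<beta>)"
  proof -
    have "v / \<beta> \<le> b" using assms by (simp add: pos_divide_le_eq mult.commute)
    moreover have "\<beta> * ln (real p) \<le> v \<longleftrightarrow> ln (real p) \<le> v / \<beta>" for p
      using assms by (simp add: pos_le_divide_eq mult.commute)
    ultimately show ?thesis by (auto simp: log_primes_def)
  qed
  then have "(\<Sum>p | p \<in> log_primes a b \<and> \<beta> * ln (real p) \<le> v. \<beta> * (ln (real p) / real p)) - (v - \<beta> * a) =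
      \<beta> * ((\<Sum>p\<in>log_primes a (v / \<beta>). ln (real p) / real p) - (v / \<beta> - a))"
    using assms by (simp add: sum_distrib_left right_diff_distrib)
  moreover have "\<bar>(\<Sum>p\<in>log_primes a (v / \<beta>). ln (real p) / real p) - (v / \<beta> - a)\<bar> \<le> D"
    using assms by (intro window) (auto simp: pos_le_divide_eq mult.commute)
  ultimately show ?thesis using assms by (simp add: abs_mult mult_left_mono)
qed

text \<open>Abel summation in the variable \<open>v = \<beta> * ln p\<close>. With
  \<open>\<beta> = A / l\<close> the window \<open>(l, B * l]\<close> of the resonator becomes
  \<open>(A, B * A]\<close>, the range of the exponential integral; with \<open>\<beta> = 1\<close>
  the variable is \<open>ln p\<close> itself.\<close>

lemma prime_sum_approx:
  assumes "\<beta> > 0" "0 \<le> a" "a \<le> b"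
    and F: "\<And>v. \<beta> * a \<le> v \<Longrightarrow> v \<le> \<beta> * b \<Longrightarrow> (F has_real_derivative f v) (at v)"
    and f: "\<And>v. \<beta> * a \<le> v \<Longrightarrow> v \<le> \<beta> * b \<Longrightarrow> (f has_real_derivative f' v) (at v)"
    and f': "\<And>v. \<beta> * a \<le> v \<Longrightarrow> v \<le> \<beta> * b \<Longrightarrow> f' v \<le> 0" and fb: "f (\<beta> * b) \<ge> 0"
  shows "\<bar>(\<Sum>p\<in>log_primes a b. \<beta> * (ln (real p) / real p) * f (\<beta> * ln (real p))) -
      (F (\<beta> * b) - F (\<beta> * a))\<bar> \<le> \<beta> * D * f (\<beta> * a)"
proof (rule abel_summation_bound[OF finite_log_primes _ _ _ F f f' fb])
  show "0 \<le> \<beta> * (ln (real p) / real p)" if "p \<in> log_primes a b" for p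
    using log_primesD[OF that] assms by auto
  show "\<beta> * a \<le> \<beta> * ln (real p) \<and> \<beta> * ln (real p) \<le> \<beta> * b" if "p \<in> log_primes a b" for p
    using log_primesD[OF that] assms by auto
  show "\<beta> * a \<le> \<beta> * b" using assms by auto
qed (assumption+, rule window_scaled[OF assms(1-3)])

end

section \<open>Exponential integrals and the relations between \<open>A\<close>, \<tau> and
  \<tau>'\<close>

lemma exp_over_square_sum_has_integral:
  fixes A :: real
  assumes "A > 0"
  shows "((\<lambda>u. exp (- u) / u + exp (- u) / u\<^sup>2) has_integral exp (- A) / A) {A..}"
proof (rule has_integral_to_inf)
  have FTC: "((\<lambda>u. exp (- u) / u + exp (- u) / u\<^sup>2) has_integral (- (exp (- y) / y) - (- (exp (- A) / A)))) {A..y}" if "A \<le> y" for y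
  proof (rule fundamental_theorem_of_calculus[OF that])
    fix x assume "x \<in> {A..y}"
    then have "x > 0" using assms by auto
    then have "((\<lambda>u. - (exp (- u) / u)) has_real_derivative (exp (- x) / x + exp (- x) / x\<^sup>2)) (at x)"
      by (auto intro!: derivative_eq_intros simp: field_simps power2_eq_square)
    then show "((\<lambda>u. - (exp (- u) / u)) has_vector_derivative (exp (- x) / x + exp (- x) / x\<^sup>2)) (at x within {A..y})"
      by (simp add: has_real_derivative_iff_has_vector_derivative has_vector_derivative_at_within)
  qed
  show "(\<lambda>u. exp (- u) / u + exp (- u) / u\<^sup>2) integrable_on {A..y}" for y
    using FTC[of y] by (cases "A \<le> y") (auto simp: integrable_on_def)
  have "eventually (\<lambda>y. integral {A..y} (\<lambda>u. exp (- u) / u + exp (- u) / u\<^sup>2) = exp (- A) / A - exp (- y) / y) at_top"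
    using eventually_ge_at_top[of A] by eventually_elim (use FTC in \<open>auto dest: integral_unique\<close>)
  moreover have "((\<lambda>y. exp (- A) / A - exp (- y) / y) \<longlongrightarrow> exp (- A) / A) at_top"
    by real_asymp
  ultimately show "((\<lambda>y. integral {A..y} (\<lambda>u. exp (- u) / u + exp (- u) / u\<^sup>2)) \<longlongrightarrow> exp (- A) / A) at_top"
    by (simp add: filterlim_cong)
  show "0 \<le> exp (- y) / y + exp (- y) / y\<^sup>2" if "A \<le> y" for y using that assms by auto
qed

text \<open>For \<open>A \<le> 0\<close> the range would contain \<open>(0, 1]\<close>, where the
  integrand is at least \<open>exp (- 1) / u\<close>; its integral over \<open>[\<delta>, 1]\<close>
  is unbounded as \<delta> tends to 0.\<close>

lemma exp_over_integral_pos: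
  fixes A \<tau> :: real
  assumes "((\<lambda>u. exp (- u) / u) has_integral \<tau>) {A..}"
  shows "A > 0"
proof (rule ccontr)
  assume "\<not> A > 0"
  let ?g = "\<lambda>u::real. exp (- u) / u"
  have int: "?g integrable_on {0..1}"
    by (rule integrable_on_subinterval[of _ "{A..}"]) (use assms \<open>\<not> A > 0\<close> in \<open>auto simp: integrable_on_def\<close>)
  have bd: "exp (- 1) * (- ln \<delta>) \<le> integral {0..1} ?g" if \<delta>: "0 < \<delta>" "\<delta> \<le> 1" for \<delta> :: real
  proof -
    have "((\<lambda>u. exp (- 1) * (1 / u)) has_integral (exp (- 1) * (ln 1 - ln \<delta>))) {\<delta>..1}"
      using \<delta> by (intro has_integral_mult_right fundamental_theorem_of_calculus)
        (auto intro!: derivative_eq_intros has_vector_derivative_at_within simp flip: has_real_derivative_iff_has_vector_derivative)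
    then have "exp (- 1) * (- ln \<delta>) = integral {\<delta>..1} (\<lambda>u. exp (- 1) * (1 / u))"
      by (simp add: integral_unique)
    also have "\<dots> \<le> integral {\<delta>..1} ?g"
    proof (rule integral_le)
      show "(\<lambda>u. exp (- 1) * (1 / u)) integrable_on {\<delta>..1}"
        using \<delta> by (intro integrable_continuous_real continuous_intros) auto
      show "?g integrable_on {\<delta>..1}"
        by (rule integrable_on_subinterval[OF int]) (use \<delta> in auto)
      show "exp (- 1) * (1 / u) \<le> ?g u" if "u \<in> {\<delta>..1}" for u
        using that \<delta> by (auto intro!: divide_right_mono)
    qed
    also have "\<dots> \<le> integral {0..1} ?g"
      using \<delta> by (intro integral_subset_le int integrable_on_subinterval[OF int]) auto
    finally show ?thesis .
  qed
  define I where "I = integral {0..1} ?g"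
  have "I \<ge> 0" using bd[of 1] by (simp add: I_def)
  \<comment> \<open>This \<delta> has \<open>- ln \<delta> = exp 1 * (I + 1)\<close>, so the bound
    reads \<open>I + 1 \<le> I\<close>.\<close>
  have "exp (- 1) * (- ln (exp (- (exp 1 * (I + 1))))) \<le> I"
    unfolding I_def[symmetric] using bd[of "exp (- (exp 1 * (I + 1)))"] \<open>I \<ge> 0\<close> by (simp add: I_def)
  then have "exp (- 1) * exp 1 * (I + 1) \<le> I" by simp
  then show False by (simp flip: exp_add)
qed

context
  fixes A \<tau> \<tau>' :: real
  assumes \<tau>: "((\<lambda>u. exp (- u) / u) has_integral \<tau>) {A..}"
    and \<tau>': "((\<lambda>u. exp (- u) / u\<^sup>2) has_integral \<tau>') {A..}"
begin

lemma A_tau_sum: "A * (\<tau> + \<tau>') = exp (- A)"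
proof -
  have A: "A > 0" by (rule exp_over_integral_pos[OF \<tau>])
  have "\<tau> + \<tau>' = exp (- A) / A"
    by (rule has_integral_unique[OF has_integral_add[OF \<tau> \<tau>'] exp_over_square_sum_has_integral[OF A]])
  with A show ?thesis by simp
qed

lemma A_tau_le: "A * \<tau> \<le> exp (- A)"
proof -
  have A: "A > 0" by (rule exp_over_integral_pos[OF \<tau>])
  have "\<tau>' \<ge> 0" by (rule has_integral_nonneg[OF \<tau>']) simp
  with A show ?thesis unfolding A_tau_sum[symmetric] by (simp add: distrib_left)
qed

lemma integral_exp_over_le_tau:
  assumes "A \<le> b"
  shows "integral {A..b} (\<lambda>u. exp (- u) / u) \<le> \<tau>"
proof -
  have A: "A > 0" by (rule exp_over_integral_pos[OF \<tau>])
  have "integral {A..b} (\<lambda>u. exp (- u) / u) \<le> integral {A..} (\<lambda>u. exp (- u) / u)"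
    using A \<tau> by (intro integral_subset_le) (auto intro!: integrable_continuous_real continuous_intros)
  then show ?thesis using \<tau> by (simp add: integral_unique)
qed

text \<open>Only the stretch from \<open>A\<close> to \<open>A + 1\<close> of the integral is kept,
  and \<open>3\<close> bounds \<open>exp 1\<close>. It serves to express an error
  \<open>exp (- A) / l\<close> in the mean of \<open>ln u\<close> as a small multiple of
  \<tau>.\<close>

lemma tau_ge: "exp (- A) \<le> 3 * (A + 1) * \<tau>"
proof -
  have A: "A > 0" by (rule exp_over_integral_pos[OF \<tau>])
  have "integral {A..A + 1} (\<lambda>u. exp (- (A + 1)) / (A + 1)) \<le> integral {A..A + 1} (\<lambda>u. exp (- u) / u)"
    using A by (intro integral_le) (auto intro!: integrable_continuous_real continuous_intros frac_le)
  also have "\<dots> \<le> \<tau>" by (rule integral_exp_over_le_tau) simp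
  finally have "exp (- A) * exp (- 1) \<le> (A + 1) * \<tau>"
    using A by (simp add: field_simps flip: exp_add)
  moreover have "exp (- A) / 3 \<le> exp (- A) * exp (- 1)"
  proof -
    have "(1 :: real) / 3 \<le> exp (- 1)" using exp_le by (simp add: exp_minus field_simps)
    then show ?thesis using mult_left_mono[of "1 / 3" "exp (- 1)" "exp (- A)"] by simp
  qed
  ultimately have "exp (- A) / 3 \<le> (A + 1) * \<tau>" by linarith
  then show ?thesis by (simp add: algebra_simps)
qed

text \<open>If \<open>A \<ge> 1\<close> then \<open>\<tau> \<le> A * \<tau> \<le> exp (- A)\<close>;
  otherwise \<open>exp (- A)\<close> is at least \<open>exp (- 1)\<close>. A lower bound on \<tau>
  thus becomes a lower bound on the gain and an upper bound on \<open>A\<close>.\<close>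

lemma exp_A_ge:
  assumes "\<tau> \<ge> c" "c \<le> 1"
  shows "exp (- A) \<ge> c / 3"
proof -
  have A: "A > 0" by (rule exp_over_integral_pos[OF \<tau>])
  have t0: "\<tau> \<ge> 0"
    by (rule has_integral_nonneg[OF \<tau>]) (use A in auto)
  show ?thesis
  proof (cases "A \<ge> 1")
    case True
    have "\<tau> \<le> A * \<tau>" using True t0 mult_right_mono[of 1 A \<tau>] by simp
    then have "\<tau> \<le> exp (- A)" using A_tau_le by simp
    with assms(1) t0 show ?thesis by simp
  next
    case False
    then have "exp (- 1) \<le> exp (- A)" by simp
    moreover have "(1 :: real) / 3 \<le> exp (- 1)" using exp_le by (simp add: exp_minus field_simps)
    ultimately show ?thesis using assms(2) by linarith
  qed
qed

end

lemma ln_one_plus_ge: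
  assumes "(h::real) \<ge> 0"
  shows "ln (1 + h) \<ge> h / (1 + h)"
proof -
  have "ln (1 / (1 + h)) \<le> 1 / (1 + h) - 1" using assms by (intro ln_le_minus_one) auto
  moreover have "1 / (1 + h) - 1 = - (h / (1 + h))" using assms by (simp add: field_simps)
  moreover have "ln (1 / (1 + h)) = - ln (1 + h)" using assms by (simp add: ln_div)
  ultimately show ?thesis by simp
qed

section \<open>Prime sums over the support of the resonator, and the cofactors\<close>

context mertens_const
begin

text \<open>Up to the factor \<open>lam ^ 2\<close> this sum bounds the mean of \<open>ln m\<close>
  under the squared resonator weights; the main term is the integral of \<open>1 / v ^ 2\<close>
  from \<open>l\<close> on.\<close>

lemma prime_sum_inverse_log:
  assumes "l > 0" "B \<ge> 1"
  shows "(\<Sum>p\<in>log_primes l (B * l). 1 / (real p * ln (real p))) \<le> 1 / l + D / l\<^sup>2"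
proof -
  have "\<bar>(\<Sum>p\<in>log_primes l (B * l). 1 * (ln (real p) / real p) * (1 / (1 * ln (real p))\<^sup>2)) -
      (- 1 / (1 * (B * l)) - - 1 / (1 * l))\<bar> \<le> 1 * D * (1 / (1 * l)\<^sup>2)"
  proof (rule prime_sum_approx[where F = "\<lambda>v. - 1 / v" and f = "\<lambda>v. 1 / v\<^sup>2" and f' = "\<lambda>v. - 2 / v ^ 3"])
    fix v assume "1 * l \<le> v"
    then have v: "v > 0" using assms by auto
    then show "((\<lambda>v. - 1 / v) has_real_derivative 1 / v\<^sup>2) (at v)"
      and "((\<lambda>v. 1 / v\<^sup>2) has_real_derivative - 2 / v ^ 3) (at v)"
      by (auto intro!: derivative_eq_intros simp: power2_eq_square power3_eq_cube field_simps)
    from v show "- 2 / v ^ 3 \<le> 0" by auto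
  qed (use assms in auto)
  moreover have "(\<Sum>p\<in>log_primes l (B * l). 1 * (ln (real p) / real p) * (1 / (1 * ln (real p))\<^sup>2)) =
      (\<Sum>p\<in>log_primes l (B * l). 1 / (real p * ln (real p)))"
    by (intro sum.cong refl) (simp add: power2_eq_square)
  moreover have "- 1 / (1 * (B * l)) - - 1 / (1 * l) \<le> 1 / l" "1 * D * (1 / (1 * l)\<^sup>2) = D / l\<^sup>2"
    using assms by (auto simp: power_divide)
  ultimately show ?thesis by linarith
qed

lemma prime_sum_log:
  assumes "l > 0" "B \<ge> 1"
  shows "(\<Sum>p\<in>log_primes l (B * l). ln (real p) / real p) \<le> B * l + D"
  using window[of l "B * l"] assms by (simp add: abs_le_iff)

text \<open>In the variable \<open>v = A / l * ln p\<close> the sum approximates the integral of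
  \<open>exp (- v) / v\<close> from \<open>A\<close> to \<open>B * A\<close>, which is part of
  \<tau>. It controls the mean of \<open>ln u\<close>.\<close>

lemma prime_sum_exp_over_log:
  assumes l: "l > 0" and B: "B \<ge> 1"
    and \<tau>: "((\<lambda>u. exp (- u) / u) has_integral \<tau>) {A..}"
    and \<tau>': "((\<lambda>u. exp (- u) / u\<^sup>2) has_integral \<tau>') {A..}"
  shows "(\<Sum>p\<in>log_primes l (B * l). exp (- (A / l * ln (real p))) / real p) \<le> \<tau> + D * exp (- A) / l"
proof -
  have A: "A > 0" by (rule exp_over_integral_pos[OF \<tau>])
  define \<beta> where "\<beta> = A / l"
  \<comment> \<open>Starting at \<open>A / 2\<close> makes \<open>v = A\<close> an interior point,
    so that \<open>F\<close> has a two-sided derivative there.\<close>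
  define F where "F v = integral {A / 2..v} (\<lambda>u. exp (- u) / u)" for v
  have \<beta>: "\<beta> > 0" "\<beta> * l = A" using A l by (auto simp: \<beta>_def)
  have AB: "A \<le> B * A" using A B by simp
  have cont: "continuous_on {A / 2..b} (\<lambda>u. exp (- u) / u)" for b
    using A by (intro continuous_intros) auto
  have "\<bar>(\<Sum>p\<in>log_primes l (B * l). \<beta> * (ln (real p) / real p) * (exp (- (\<beta> * ln (real p))) / (\<beta> * ln (real p)))) -
      (F (\<beta> * (B * l)) - F (\<beta> * l))\<bar> \<le> \<beta> * D * (exp (- (\<beta> * l)) / (\<beta> * l))"
  proof (rule prime_sum_approx[where f' = "\<lambda>v. - (exp (- v) / v) - exp (- v) / v\<^sup>2"])
    fix v assume "\<beta> * l \<le> v"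
    then have v: "v > 0" "A / 2 < v" using \<beta> A by auto
    have "(F has_real_derivative exp (- v) / v) (at v within {A / 2..v + 1})"
      unfolding F_def using v by (intro integral_has_real_derivative cont) auto
    then show "(F has_real_derivative exp (- v) / v) (at v)"
      using v by (simp add: at_within_Icc_at)
    show "((\<lambda>v. exp (- v) / v) has_real_derivative - (exp (- v) / v) - exp (- v) / v\<^sup>2) (at v)"
      using v by (auto intro!: derivative_eq_intros simp: power2_eq_square field_simps)
    have "exp (- v) / v \<ge> 0" "exp (- v) / v\<^sup>2 \<ge> 0" using v by auto
    then show "- (exp (- v) / v) - exp (- v) / v\<^sup>2 \<le> 0" by linarith
  qed (use assms \<beta> in auto)
  moreover have "\<beta> * (ln (real p) / real p) * (exp (- (\<beta> * ln (real p))) / (\<beta> * ln (real p))) =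
      exp (- (A / l * ln (real p))) / real p" if "p \<in> log_primes l (B * l)" for p
  proof -
    have "ln (real p) > 0" using log_primesD[OF that] l by linarith
    then show ?thesis using A l by (simp add: \<beta>_def)
  qed
  ultimately have *: "\<bar>(\<Sum>p\<in>log_primes l (B * l). exp (- (A / l * ln (real p))) / real p) -
      (F (\<beta> * (B * l)) - F (\<beta> * l))\<bar> \<le> \<beta> * D * (exp (- (\<beta> * l)) / (\<beta> * l))"
    by simp
  have "F (B * A) = F A + integral {A..B * A} (\<lambda>u. exp (- u) / u)"
    unfolding F_def using A AB
    by (intro Henstock_Kurzweil_Integration.integral_combine[symmetric] integrable_continuous_real cont) auto
  then have "F (\<beta> * (B * l)) - F (\<beta> * l) \<le> \<tau>"
    using integral_exp_over_le_tau[OF \<tau> \<tau>' AB] \<beta>(2) by (simp add: mult.left_commute mult.commute)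
  moreover have "\<beta> * D * (exp (- (\<beta> * l)) / (\<beta> * l)) = D * exp (- A) / l"
    using \<beta> l A by (simp add: \<beta>_def)
  ultimately show ?thesis using * by linarith
qed

text \<open>With \<open>\<beta> = A / l\<close>, the factor \<open>1 + \<beta> * ln p\<close> makes
  the function to be integrated the derivative of \<open>- exp (- \<beta> * v) / v\<close>. Hence
  the main term \<open>exp (- A) / l\<close> from the lower end \<open>v = l\<close>; the upper end
  \<open>B * l\<close> costs at most the fraction \<open>1 / B\<close>.\<close>

lemma prime_sum_gain:
  assumes l: "l > 0" and B: "B \<ge> 1" and A: "A > 0"
  shows "(\<Sum>p\<in>log_primes l (B * l). (1 + A / l * ln (real p)) * exp (- (A / l * ln (real p))) / (real p * ln (real p)))
    \<ge> exp (- A) / l * (1 - 1 / B - D * (A + 1) / l)"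
proof -
  define \<beta> where "\<beta> = A / l"
  have \<beta>: "\<beta> > 0" "\<beta> * l = A" using A l by (auto simp: \<beta>_def)
  have approx: "\<bar>(\<Sum>p\<in>log_primes l (B * l). 1 * (ln (real p) / real p) *
        (exp (- \<beta> * (1 * ln (real p))) * (\<beta> / (1 * ln (real p)) + 1 / (1 * ln (real p))\<^sup>2))) -
      (- exp (- \<beta> * (1 * (B * l))) / (1 * (B * l)) - - exp (- \<beta> * (1 * l)) / (1 * l))\<bar>
      \<le> 1 * D * (exp (- \<beta> * (1 * l)) * (\<beta> / (1 * l) + 1 / (1 * l)\<^sup>2))"
  proof (rule prime_sum_approx[where F = "\<lambda>v. - exp (- \<beta> * v) / v" and f = "\<lambda>v. exp (- \<beta> * v) * (\<beta> / v + 1 / v\<^sup>2)"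
        and f' = "\<lambda>v. - \<beta> * exp (- \<beta> * v) * (\<beta> / v + 1 / v\<^sup>2) + exp (- \<beta> * v) * (- (\<beta> / v\<^sup>2) - 2 / v ^ 3)"])
    fix v assume "1 * l \<le> v"
    then have v: "v > 0" using l by auto
    then show "((\<lambda>v. - exp (- \<beta> * v) / v) has_real_derivative exp (- \<beta> * v) * (\<beta> / v + 1 / v\<^sup>2)) (at v)"
      by (auto intro!: derivative_eq_intros simp: power2_eq_square field_simps)
    from v show "((\<lambda>v. exp (- \<beta> * v) * (\<beta> / v + 1 / v\<^sup>2)) has_real_derivative
        - \<beta> * exp (- \<beta> * v) * (\<beta> / v + 1 / v\<^sup>2) + exp (- \<beta> * v) * (- (\<beta> / v\<^sup>2) - 2 / v ^ 3)) (at v)"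
      by (auto intro!: derivative_eq_intros simp: power2_eq_square power3_eq_cube field_simps)
    have "- \<beta> * exp (- \<beta> * v) * (\<beta> / v + 1 / v\<^sup>2) \<le> 0"
      using v \<beta> by (intro mult_nonpos_nonneg) (auto intro!: mult_nonpos_nonneg add_nonneg_nonneg)
    moreover have "exp (- \<beta> * v) * (- (\<beta> / v\<^sup>2) - 2 / v ^ 3) \<le> 0"
    proof (rule mult_nonneg_nonpos)
      have "\<beta> / v\<^sup>2 \<ge> 0" "2 / v ^ 3 \<ge> 0" using v \<beta> by auto
      then show "- (\<beta> / v\<^sup>2) - 2 / v ^ 3 \<le> 0" by linarith
    qed simp
    ultimately show "- \<beta> * exp (- \<beta> * v) * (\<beta> / v + 1 / v\<^sup>2) + exp (- \<beta> * v) * (- (\<beta> / v\<^sup>2) - 2 / v ^ 3) \<le> 0"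
      by (rule add_nonpos_nonpos)
  qed (use assms \<beta> in \<open>auto intro!: add_nonneg_nonneg\<close>)
  have eq: "1 * (ln (real p) / real p) *
        (exp (- \<beta> * (1 * ln (real p))) * (\<beta> / (1 * ln (real p)) + 1 / (1 * ln (real p))\<^sup>2)) =
      (1 + A / l * ln (real p)) * exp (- (A / l * ln (real p))) / (real p * ln (real p))"
    if "p \<in> log_primes l (B * l)" for p
  proof -
    have "ln (real p) > 0" "real p > 0" using log_primesD[OF that] l by linarith+
    then have "(ln (real p) / real p) * (\<beta> / ln (real p) + 1 / (ln (real p))\<^sup>2) = (1 + \<beta> * ln (real p)) / (real p * ln (real p))"
      by (simp add: field_simps power2_eq_square)
    then have "exp (- (\<beta> * ln (real p))) * ((ln (real p) / real p) * (\<beta> / ln (real p) + 1 / (ln (real p))\<^sup>2)) =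
      exp (- (\<beta> * ln (real p))) * ((1 + \<beta> * ln (real p)) / (real p * ln (real p)))" by (rule arg_cong)
    then show ?thesis by (simp add: \<beta>_def mult_ac)
  qed
  have *: "\<bar>(\<Sum>p\<in>log_primes l (B * l). (1 + A / l * ln (real p)) * exp (- (A / l * ln (real p))) / (real p * ln (real p))) -
      (- exp (- \<beta> * (1 * (B * l))) / (1 * (B * l)) - - exp (- \<beta> * (1 * l)) / (1 * l))\<bar>
      \<le> 1 * D * (exp (- \<beta> * (1 * l)) * (\<beta> / (1 * l) + 1 / (1 * l)\<^sup>2))"
  proof -
    have "(\<Sum>p\<in>log_primes l (B * l). 1 * (ln (real p) / real p) *
        (exp (- \<beta> * (1 * ln (real p))) * (\<beta> / (1 * ln (real p)) + 1 / (1 * ln (real p))\<^sup>2))) =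
      (\<Sum>p\<in>log_primes l (B * l). (1 + A / l * ln (real p)) * exp (- (A / l * ln (real p))) / (real p * ln (real p)))"
      by (rule sum.cong[OF refl]) (rule eq)
    with approx show ?thesis by (simp only:)
  qed
  have "\<beta> * (B * l) = B * A" using \<beta>(2) by (metis mult.left_commute)
  moreover have "A \<le> B * A" using A B by simp
  ultimately have "A \<le> \<beta> * (B * l)" by linarith
  then have "exp (- \<beta> * (B * l)) \<le> exp (- A)" by (subst exp_le_cancel_iff) simp
  then have "exp (- \<beta> * (B * l)) / (B * l) \<le> exp (- A) / (B * l)" using B l by (intro divide_right_mono) auto
  moreover have e1: "exp (- \<beta> * l) = exp (- A)" using \<beta> by simp
  moreover have "D * (exp (- A) * (\<beta> / l + 1 / l\<^sup>2)) = exp (- A) / l * (D * (A + 1) / l)"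
    using l by (simp add: \<beta>_def field_simps power2_eq_square)
  moreover have "exp (- A) / (B * l) = exp (- A) / l * (1 / B)" by simp
  moreover have "exp (- A) / l * (1 - 1 / B - D * (A + 1) / l) = exp (- A) / l - exp (- A) / l * (1 / B) - exp (- A) / l * (D * (A + 1) / l)"
    by (simp add: algebra_simps)
  ultimately show ?thesis using * unfolding mult_1 e1 minus_divide_left[symmetric] by linarith
qed

text \<open>If \<open>W\<close> is large, the cofactors are the primes in \<open>(W / exp (D + 1), W]\<close>, which exceed the
  support of the resonator; otherwise \<open>1\<close> alone loses only a factor \<open>exp (D + 1 + b)\<close>.\<close>
lemma cofactor_set:
  assumes W: "W \<ge> 1" and a: "0 \<le> a" "a \<le> b"
  obtains C where "finite C" "C \<noteq> {}" "\<And>c. c \<in> C \<Longrightarrow> c > 0" "\<And>c p. c \<in> C \<Longrightarrow> p \<in> log_primes a b \<Longrightarrow> \<not> p dvd c"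
    "\<And>c. c \<in> C \<Longrightarrow> real c \<le> W" "W \<le> real (card C) * (exp (D + 1) * (exp b + ln W))"
proof (cases "W \<ge> exp (D + 1) * exp b")
  case True
  \<comment> \<open>A window of length \<open>D + 1\<close> has Mertens mass at least 1 in spite of
    the error \<open>D\<close>; each of its primes carries mass at most
    \<open>ln W * exp (D + 1) / W\<close>, so there are many of them.\<close>
  define C where "C = log_primes (ln W - (D + 1)) (ln W)"
  have lnW: "ln W \<ge> D + 1 + b"
    using True W ln_le_cancel_iff[of "exp (D + 1) * exp b" W] by (simp add: ln_mult)
  have le: "\<bar>(\<Sum>p\<in>C. ln (real p) / real p) - (ln W - (ln W - (D + 1)))\<bar> \<le> D"
    unfolding C_def using lnW D a by (intro window) auto
  have "1 \<le> (\<Sum>p\<in>C. ln (real p) / real p)" using le by linarith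
  also have "\<dots> \<le> (\<Sum>p\<in>C. ln W / (W / exp (D + 1)))"
  proof (intro sum_mono frac_le)
    fix p assume "p \<in> C"
    note p = log_primesD[OF this[unfolded C_def]]
    show "0 \<le> ln W" using W by simp
    show "ln (real p) \<le> ln W" using p by simp
    show "0 < W / exp (D + 1)" using W by simp
    have "exp (ln W - (D + 1)) \<le> exp (ln (real p))" using p by (subst exp_le_cancel_iff) simp
    then show "W / exp (D + 1) \<le> real p" using p W by (simp add: exp_diff)
  qed
  also have "\<dots> = real (card C) * (exp (D + 1) * ln W) / W" by simp
  finally have "W \<le> real (card C) * (exp (D + 1) * ln W)" using W by (simp add: le_divide_eq)
  also have "\<dots> \<le> real (card C) * (exp (D + 1) * (exp b + ln W))"
    by (intro mult_left_mono) auto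
  finally have card: "W \<le> real (card C) * (exp (D + 1) * (exp b + ln W))" .
  show ?thesis
  proof (rule that[of C])
    show "finite C" unfolding C_def by simp
    show "C \<noteq> {}" using card W by auto
    show "W \<le> real (card C) * (exp (D + 1) * (exp b + ln W))" by (rule card)
  next
    fix c assume "c \<in> C"
    note c = log_primesD[OF this[unfolded C_def]]
    show "c > 0" using c by simp
    have "exp (ln (real c)) \<le> exp (ln W)" using c(3) by (subst exp_le_cancel_iff) simp
    then show "real c \<le> W" using c W by simp
    fix p assume "p \<in> log_primes a b"
    note p = log_primesD[OF this]
    have "ln (real p) < ln (real c)" using p c lnW by linarith
    then have "p \<noteq> c" by auto
    then show "\<not> p dvd c" using p c primes_dvd_imp_eq by blast
  qed
next
  case False
  show ?thesis
  proof (rule that[of "{1}"])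
    have "W \<le> exp (D + 1) * exp b" using False by simp
    also have "\<dots> \<le> exp (D + 1) * (exp b + ln W)" using W by (intro mult_left_mono) auto
    finally show "W \<le> real (card {1::nat}) * (exp (D + 1) * (exp b + ln W))" by simp
    show "\<And>c p. c \<in> {1} \<Longrightarrow> p \<in> log_primes a b \<Longrightarrow> \<not> p dvd c"
      using log_primesD(4) by fastforce
  qed (use W in auto)
qed

end

section \<open>Random subsets and the diagonal terms\<close>

lemma sum_Pow_insert:
  assumes "finite P" "p \<notin> P"
  shows "(\<Sum>U\<in>Pow (insert p P). F U) = (\<Sum>U\<in>Pow P. F U + F (insert p U))"
proof -
  have "(\<Sum>U\<in>Pow (insert p P). F U) = (\<Sum>U\<in>Pow P. F U) + (\<Sum>U\<in>insert p ` Pow P. F U)"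
    unfolding Pow_insert using assms by (intro sum.union_disjoint) auto
  also have "(\<Sum>U\<in>insert p ` Pow P. F U) = (\<Sum>U\<in>Pow P. F (insert p U))"
    using assms by (intro sum.reindex_cong[of "insert p"]) (auto simp: inj_on_def)
  finally show ?thesis by (simp add: sum.distrib)
qed

lemma sum_prod_Pow:
  fixes h :: "'a \<Rightarrow> 'b :: comm_semiring_1"
  assumes "finite P"
  shows "(\<Sum>U\<in>Pow P. prod h U) = (\<Prod>p\<in>P. 1 + h p)"
  using prod_add[OF assms, of h "\<lambda>_. 1"] by (simp add: add.commute)

text \<open>Divided by their total, the weights \<open>prod h U\<close> are the law of a random
  subset that contains each \<open>p\<close> independently with probability
  \<open>h p / (1 + h p)\<close>; the right-hand sum is the mean of \<open>sum x U\<close>.\<close>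

lemma subset_first_moment:
  fixes h x :: "'a \<Rightarrow> real"
  assumes "finite P" "\<And>p. p \<in> P \<Longrightarrow> h p \<ge> 0"
  shows "(\<Sum>U\<in>Pow P. prod h U * sum x U) = (\<Prod>p\<in>P. 1 + h p) * (\<Sum>p\<in>P. h p / (1 + h p) * x p)"
  using assms
proof (induction P rule: finite_induct)
  case (insert p P)
  have "1 + h p \<noteq> 0" using insert.prems[of p] by auto
  have "(\<Sum>U\<in>Pow (insert p P). prod h U * sum x U) =
      (\<Sum>U\<in>Pow P. (1 + h p) * (prod h U * sum x U) + h p * x p * prod h U)"
    unfolding sum_Pow_insert[OF insert.hyps]
  proof (intro sum.cong refl)
    fix U assume "U \<in> Pow P"
    then have "finite U" "p \<notin> U" using insert.hyps finite_subset by auto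
    then show "prod h U * sum x U + prod h (insert p U) * sum x (insert p U) =
      (1 + h p) * (prod h U * sum x U) + h p * x p * prod h U"
      by (simp add: algebra_simps)
  qed
  also have "\<dots> = (1 + h p) * (\<Sum>U\<in>Pow P. prod h U * sum x U) + h p * x p * (\<Sum>U\<in>Pow P. prod h U)"
    by (simp add: sum.distrib sum_distrib_left)
  also have "(\<Sum>U\<in>Pow P. prod h U) = (\<Prod>p\<in>P. 1 + h p)"
    by (rule sum_prod_Pow[OF insert.hyps(1)])
  also have "(\<Sum>U\<in>Pow P. prod h U * sum x U) = (\<Prod>p\<in>P. 1 + h p) * (\<Sum>p\<in>P. h p / (1 + h p) * x p)"
    by (rule insert.IH) (use insert.prems in auto)
  finally show ?case using insert.hyps \<open>1 + h p \<noteq> 0\<close> by (simp add: field_simps)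
qed simp

text \<open>Independence makes the variances of the single elements add up, and
  \<open>h / (1 + h)\<^sup>2\<close> is \<open>q * (1 - q)\<close> for the probability
  \<open>q = h / (1 + h)\<close>. In the induction the cross term vanishes because
  \<open>q + q * h = h\<close>.\<close>

lemma subset_variance:
  fixes h x :: "'a \<Rightarrow> real"
  assumes "finite P" "\<And>p. p \<in> P \<Longrightarrow> h p \<ge> 0"
  shows "(\<Sum>U\<in>Pow P. prod h U * (sum x U - (\<Sum>p\<in>P. h p / (1 + h p) * x p))\<^sup>2) =
    (\<Prod>p\<in>P. 1 + h p) * (\<Sum>p\<in>P. h p / (1 + h p)\<^sup>2 * (x p)\<^sup>2)"
  using assms
proof (induction P rule: finite_induct)
  case (insert p P)
  define m where "m = (\<Sum>p\<in>P. h p / (1 + h p) * x p)"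
  define q where "q = h p / (1 + h p)"
  have h1: "1 + h p > 0" using insert.prems[of p] by auto
  have hp: "h p = q * (1 + h p)" using h1 by (simp add: q_def)
  have m: "(\<Sum>p\<in>insert p P. h p / (1 + h p) * x p) = m + q * x p"
    using insert.hyps by (simp add: m_def q_def)
  have fm: "(\<Sum>U\<in>Pow P. prod h U * (sum x U - m)) = 0"
    using subset_first_moment[OF insert.hyps(1), of h x] sum_prod_Pow[OF insert.hyps(1), of h] insert.prems
    by (simp add: right_diff_distrib sum_subtractf m_def flip: sum_distrib_right)
  have "(\<Sum>U\<in>Pow (insert p P). prod h U * (sum x U - (m + q * x p))\<^sup>2) =
      (\<Sum>U\<in>Pow P. (1 + h p) * (prod h U * (sum x U - m)\<^sup>2) + (h p / (1 + h p) * (x p)\<^sup>2) * prod h U)"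
    unfolding sum_Pow_insert[OF insert.hyps]
  proof (intro sum.cong refl)
    fix U assume "U \<in> Pow P"
    then have U: "finite U" "p \<notin> U" using insert.hyps finite_subset by auto
    have "(s - (m + q * x p))\<^sup>2 + h p * (x p + s - (m + q * x p))\<^sup>2 =
        (1 + h p) * (s - m)\<^sup>2 + h p / (1 + h p) * (x p)\<^sup>2" for s
    proof -
      have q: "q + q * h p = h p" using hp by (simp add: algebra_simps)
      have "(s - (m + q * x p))\<^sup>2 + h p * (x p + s - (m + q * x p))\<^sup>2 =
        (1 + h p) * (s - m)\<^sup>2 + 2 * (s - m) * x p * (h p - (q + q * h p))
        + (x p)\<^sup>2 * (q * (q + q * h p) + h p - 2 * h p * q)"
        by (simp add: power2_eq_square algebra_simps)
      also have "\<dots> = (1 + h p) * (s - m)\<^sup>2 + (x p)\<^sup>2 * (h p - h p * q)"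
        unfolding q by (simp add: algebra_simps)
      also have "h p - h p * q = h p / (1 + h p)" using h1 by (simp add: q_def field_simps)
      finally show ?thesis by (simp add: mult.commute)
    qed
    from this[of "sum x U"] have "prod h U * ((sum x U - (m + q * x p))\<^sup>2 + h p * (x p + sum x U - (m + q * x p))\<^sup>2) =
        prod h U * ((1 + h p) * (sum x U - m)\<^sup>2 + h p / (1 + h p) * (x p)\<^sup>2)" by (rule arg_cong)
    with U show "prod h U * (sum x U - (m + q * x p))\<^sup>2 + prod h (insert p U) * (sum x (insert p U) - (m + q * x p))\<^sup>2 =
      (1 + h p) * (prod h U * (sum x U - m)\<^sup>2) + (h p / (1 + h p) * (x p)\<^sup>2) * prod h U"
      by (simp add: algebra_simps)
  qed
  also have "\<dots> = (1 + h p) * (\<Sum>U\<in>Pow P. prod h U * (sum x U - m)\<^sup>2) + (h p / (1 + h p) * (x p)\<^sup>2) * (\<Sum>U\<in>Pow P. prod h U)"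
    by (simp only: sum.distrib sum_distrib_left)
  also have "(\<Sum>U\<in>Pow P. prod h U) = (\<Prod>p\<in>P. 1 + h p)"
    by (rule sum_prod_Pow[OF insert.hyps(1)])
  also have "(\<Sum>U\<in>Pow P. prod h U * (sum x U - m)\<^sup>2) = (\<Prod>p\<in>P. 1 + h p) * (\<Sum>p\<in>P. h p / (1 + h p)\<^sup>2 * (x p)\<^sup>2)"
    unfolding m_def by (rule insert.IH) (use insert.prems in auto)
  finally have fin: "(\<Sum>U\<in>Pow (insert p P). prod h U * (sum x U - (m + q * x p))\<^sup>2) =
      (1 + h p) * ((\<Prod>p\<in>P. 1 + h p) * (\<Sum>p\<in>P. h p / (1 + h p)\<^sup>2 * (x p)\<^sup>2)) +
      h p / (1 + h p) * (x p)\<^sup>2 * (\<Prod>p\<in>P. 1 + h p)" .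
  obtain w where w: "h p / (1 + h p)\<^sup>2 = w" "h p / (1 + h p) = (1 + h p) * w"
    using h1 by (simp add: power2_eq_square)
  show ?case unfolding m fin
    by (simp only: w sum.insert[OF insert.hyps] prod.insert[OF insert.hyps]) (simp add: algebra_simps)
qed simp

lemma subset_chebyshev:
  fixes h x :: "'a \<Rightarrow> real"
  assumes P: "finite P" and h: "\<And>p. p \<in> P \<Longrightarrow> h p \<ge> 0"
    and V: "4 * (\<Sum>p\<in>P. h p * (x p)\<^sup>2) \<le> \<rho>\<^sup>2" and \<rho>: "\<rho> > 0"
  defines "\<mu> \<equiv> (\<Sum>p\<in>P. h p / (1 + h p) * x p)"
  shows "(\<Sum>U | U \<subseteq> P \<and> \<bar>sum x U - \<mu>\<bar> \<le> \<rho>. prod h U) \<ge> 3 / 4 * (\<Prod>p\<in>P. 1 + h p)"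
proof -
  let ?H = "\<Prod>p\<in>P. 1 + h p"
  have H: "?H \<ge> 0" using h by (intro prod_nonneg) (simp add: add_nonneg_nonneg)
  let ?A = "{U. U \<subseteq> P \<and> \<bar>sum x U - \<mu>\<bar> \<le> \<rho>}" and ?B = "{U. U \<subseteq> P \<and> \<bar>sum x U - \<mu>\<bar> > \<rho>}"
  have fin: "finite ?A" "finite ?B" using P by (auto intro: finite_subset[of _ "Pow P"])
  have nn: "prod h U \<ge> 0" if "U \<subseteq> P" for U using that h by (intro prod_nonneg) auto
  have "\<rho>\<^sup>2 * (\<Sum>U\<in>?B. prod h U) = (\<Sum>U\<in>?B. prod h U * \<rho>\<^sup>2)"
    by (simp add: sum_distrib_left mult.commute)
  also have "\<dots> \<le> (\<Sum>U\<in>?B. prod h U * (sum x U - \<mu>)\<^sup>2)"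
  proof (intro sum_mono mult_left_mono)
    fix U assume "U \<in> ?B"
    then have "\<bar>\<rho>\<bar> \<le> \<bar>sum x U - \<mu>\<bar>" using \<rho> by auto
    then show "\<rho>\<^sup>2 \<le> (sum x U - \<mu>)\<^sup>2" by (simp only: abs_le_square_iff)
  qed (use nn in auto)
  also have "\<dots> \<le> (\<Sum>U\<in>Pow P. prod h U * (sum x U - \<mu>)\<^sup>2)"
    using P nn by (intro sum_mono2) auto
  also have "\<dots> = ?H * (\<Sum>p\<in>P. h p / (1 + h p)\<^sup>2 * (x p)\<^sup>2)"
    unfolding \<mu>_def by (rule subset_variance[OF P h])
  also have "\<dots> \<le> ?H * (\<Sum>p\<in>P. h p * (x p)\<^sup>2)"
  proof (intro mult_left_mono sum_mono mult_right_mono H)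
    fix p assume "p \<in> P"
    then have "h p \<ge> 0" by (rule h)
    moreover then have "(1 + h p)\<^sup>2 \<ge> 1" by (simp add: one_le_power)
    ultimately show "h p / (1 + h p)\<^sup>2 \<le> h p" using mult_left_mono[of 1 "(1 + h p)\<^sup>2" "h p"] by (simp add: divide_le_eq)
  qed auto
  also have "\<dots> \<le> ?H * (\<rho>\<^sup>2 / 4)" using V by (intro mult_left_mono H) auto
  finally have "\<rho>\<^sup>2 * (\<Sum>U\<in>?B. prod h U) \<le> \<rho>\<^sup>2 * (?H / 4)" by (simp add: mult.commute)
  then have "(\<Sum>U\<in>?B. prod h U) \<le> ?H / 4" using \<rho> by (subst (asm) mult_le_cancel_left) auto
  moreover have "(\<Sum>U\<in>Pow P. prod h U) = (\<Sum>U\<in>?A. prod h U) + (\<Sum>U\<in>?B. prod h U)"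
    using fin by (subst sum.union_disjoint[symmetric]) (auto intro: sum.cong)
  ultimately show ?thesis using sum_prod_Pow[OF P, of h] by linarith
qed

lemma subset_markov:
  fixes h x :: "'a \<Rightarrow> real"
  assumes P: "finite P" and h: "\<And>p. p \<in> P \<Longrightarrow> h p \<ge> 0" and x: "\<And>p. p \<in> P \<Longrightarrow> x p \<ge> 0"
    and E: "(\<Sum>p\<in>P. h p * x p) \<le> d * \<Lambda>" and \<Lambda>: "\<Lambda> > 0"
  shows "(\<Sum>U | U \<subseteq> P \<and> sum x U \<le> \<Lambda>. prod h U) \<ge> (1 - d) * (\<Prod>p\<in>P. 1 + h p)"
proof -
  let ?H = "\<Prod>p\<in>P. 1 + h p"
  have H: "?H \<ge> 0" using h by (intro prod_nonneg) (simp add: add_nonneg_nonneg)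
  let ?A = "{U. U \<subseteq> P \<and> sum x U \<le> \<Lambda>}" and ?B = "{U. U \<subseteq> P \<and> sum x U > \<Lambda>}"
  have fin: "finite ?A" "finite ?B" using P by (auto intro: finite_subset[of _ "Pow P"])
  have nn: "prod h U \<ge> 0" "sum x U \<ge> 0" if "U \<subseteq> P" for U
    using that h x by (auto intro!: prod_nonneg sum_nonneg)
  have "\<Lambda> * (\<Sum>U\<in>?B. prod h U) = (\<Sum>U\<in>?B. prod h U * \<Lambda>)"
    by (simp add: sum_distrib_left mult.commute)
  also have "\<dots> \<le> (\<Sum>U\<in>?B. prod h U * sum x U)"
    using nn by (intro sum_mono mult_left_mono) auto
  also have "\<dots> \<le> (\<Sum>U\<in>Pow P. prod h U * sum x U)"
    using P nn by (intro sum_mono2) auto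
  also have "\<dots> = ?H * (\<Sum>p\<in>P. h p / (1 + h p) * x p)"
    by (rule subset_first_moment[OF P h])
  also have "\<dots> \<le> ?H * (\<Sum>p\<in>P. h p * x p)"
  proof (intro mult_left_mono sum_mono mult_right_mono H x)
    fix p assume "p \<in> P"
    then have "h p \<ge> 0" by (rule h)
    then show "h p / (1 + h p) \<le> h p" using mult_left_mono[of 1 "1 + h p" "h p"] by (simp add: divide_le_eq)
  qed auto
  also have "\<dots> \<le> ?H * (d * \<Lambda>)" using E by (intro mult_left_mono H) auto
  finally have "\<Lambda> * (\<Sum>U\<in>?B. prod h U) \<le> \<Lambda> * (d * ?H)" by (simp add: algebra_simps)
  then have "(\<Sum>U\<in>?B. prod h U) \<le> d * ?H" using \<Lambda> by (subst (asm) mult_le_cancel_left) auto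
  moreover have "(\<Sum>U\<in>Pow P. prod h U) = (\<Sum>U\<in>?A. prod h U) + (\<Sum>U\<in>?B. prod h U)"
    using fin by (subst sum.union_disjoint[symmetric]) (auto intro: sum.cong)
  ultimately show ?thesis using sum_prod_Pow[OF P, of h] by (simp add: algebra_simps)
qed

text \<open>The inner sum is the coefficient \<open>b V\<close> of a product of the primes in
  \<open>V\<close>, with \<open>S\<close> taken from the resonator and \<open>V - S\<close> from the
  sum to be bounded. Cauchy's inequality against \<open>prod r V\<close>, whose squares sum to
  \<open>Z\<close>, reduces the claim to a lower bound for the sum of \<open>prod r V * b V\<close>.
  There \<open>U = V - S\<close> and \<open>S\<close> decouple except for disjointness, and Markov's
  inequality on \<open>P - U\<close> recovers \<open>1 - d\<close> of the untruncated product.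
  Removing the primes of \<open>U\<close> from that product produces the denominators
  \<open>1 + (r p)\<^sup>2\<close>.\<close>

lemma resonance_ratio:
  fixes r x :: "'a \<Rightarrow> real" and d \<Lambda> \<Xi> :: real
  assumes P: "finite P" and r: "\<And>p. p \<in> P \<Longrightarrow> r p \<ge> 0" and x: "\<And>p. p \<in> P \<Longrightarrow> x p \<ge> 0"
    and E: "(\<Sum>p\<in>P. (r p)\<^sup>2 * x p) \<le> d * \<Lambda>" and \<Lambda>: "\<Lambda> > 0" and d: "d \<le> 1"
  shows "(\<Sum>V\<in>Pow P. (\<Sum>S | S \<subseteq> V \<and> sum x S \<le> \<Lambda> \<and> sum x (V - S) \<le> \<Xi>. prod r S)\<^sup>2) \<ge>
    (1 - d)\<^sup>2 * (\<Sum>U | U \<subseteq> P \<and> sum x U \<le> \<Xi>. \<Prod>p\<in>U. r p / (1 + (r p)\<^sup>2))\<^sup>2 *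
    (\<Sum>S | S \<subseteq> P \<and> sum x S \<le> \<Lambda>. (prod r S)\<^sup>2)"
proof -
  define b where "b V = (\<Sum>S | S \<subseteq> V \<and> sum x S \<le> \<Lambda> \<and> sum x (V - S) \<le> \<Xi>. prod r S)" for V
  define G where "G = (\<Sum>U | U \<subseteq> P \<and> sum x U \<le> \<Xi>. \<Prod>p\<in>U. r p / (1 + (r p)\<^sup>2))"
  define Z where "Z = (\<Prod>p\<in>P. 1 + (r p)\<^sup>2)"
  have Zpos: "Z > 0" unfolding Z_def by (intro prod_pos) (simp add: add_pos_nonneg)
  have finS: "finite V" if "V \<subseteq> P" for V using that P finite_subset by auto
  have rn: "prod r U \<ge> 0" if "U \<subseteq> P" for U using that r by (intro prod_nonneg) auto
  have G0: "G \<ge> 0" unfolding G_def using r by (intro sum_nonneg prod_nonneg) auto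
  have sq: "(prod r S)\<^sup>2 = (\<Prod>p\<in>S. (r p)\<^sup>2)" for S by (simp add: prod_power_distrib)
  have ZZ: "(\<Sum>V\<in>Pow P. (prod r V)\<^sup>2) = Z"
    unfolding sq Z_def by (rule sum_prod_Pow[OF P])
  \<comment> \<open>The two ways to index disjoint pairs: by \<open>(V, S)\<close> with
    \<open>S\<close> inside \<open>V\<close>, and by \<open>(U, S)\<close> with
    \<open>U = V - S\<close>.\<close>
  let ?A = "Sigma (Pow P) (\<lambda>V. {S. S \<subseteq> V \<and> sum x S \<le> \<Lambda> \<and> sum x (V - S) \<le> \<Xi>})"
  let ?B = "Sigma {U. U \<subseteq> P \<and> sum x U \<le> \<Xi>} (\<lambda>U. {S. S \<subseteq> P - U \<and> sum x S \<le> \<Lambda>})"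
  have "(1 - d) * Z * G = (\<Sum>U | U \<subseteq> P \<and> sum x U \<le> \<Xi>. prod r U * ((1 - d) * (\<Prod>p\<in>P - U. 1 + (r p)\<^sup>2)))"
    unfolding G_def sum_distrib_left
  proof (intro sum.cong refl)
    fix U assume "U \<in> {U. U \<subseteq> P \<and> sum x U \<le> \<Xi>}"
    then have U: "U \<subseteq> P" by auto
    have "(\<Prod>p\<in>U. 1 + (r p)\<^sup>2) > 0" by (intro prod_pos) (simp add: add_pos_nonneg)
    then have "(\<Prod>p\<in>P - U. 1 + (r p)\<^sup>2) = Z / (\<Prod>p\<in>U. 1 + (r p)\<^sup>2)"
      unfolding Z_def using prod.subset_diff[OF U P, of "\<lambda>p. 1 + (r p)\<^sup>2"] by (simp add: field_simps)
    then show "(1 - d) * Z * (\<Prod>p\<in>U. r p / (1 + (r p)\<^sup>2)) = prod r U * ((1 - d) * (\<Prod>p\<in>P - U. 1 + (r p)\<^sup>2))"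
      by (simp add: prod_dividef mult_ac)
  qed
  also have "\<dots> \<le> (\<Sum>U | U \<subseteq> P \<and> sum x U \<le> \<Xi>. prod r U * (\<Sum>S | S \<subseteq> P - U \<and> sum x S \<le> \<Lambda>. (prod r S)\<^sup>2))"
  proof (intro sum_mono mult_left_mono)
    fix U assume "U \<in> {U. U \<subseteq> P \<and> sum x U \<le> \<Xi>}"
    then have U: "U \<subseteq> P" by auto
    show "prod r U \<ge> 0" using rn[OF U] .
    have "(\<Sum>p\<in>P - U. (r p)\<^sup>2 * x p) \<le> (\<Sum>p\<in>P. (r p)\<^sup>2 * x p)"
      using P x by (intro sum_mono2) auto
    with E show "(1 - d) * (\<Prod>p\<in>P - U. 1 + (r p)\<^sup>2) \<le> (\<Sum>S | S \<subseteq> P - U \<and> sum x S \<le> \<Lambda>. (prod r S)\<^sup>2)"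
      unfolding sq using P x \<Lambda> by (intro subset_markov) auto
  qed
  also have "\<dots> = (\<Sum>(U, S)\<in>?B. prod r U * (prod r S)\<^sup>2)"
    unfolding sum_distrib_left using P by (intro sum.Sigma) auto
  also have "\<dots> = (\<Sum>(V, S)\<in>?A. prod r V * prod r S)"
  proof (rule sum.reindex_bij_witness[of _ "\<lambda>(V, S). (V - S, S)" "\<lambda>(U, S). (U \<union> S, S)"])
    fix a assume a: "a \<in> ?B"
    obtain U S where us: "a = (U, S)" by force
    have us': "U \<subseteq> P" "S \<subseteq> P - U" "sum x U \<le> \<Xi>" "sum x S \<le> \<Lambda>" using a us by auto
    have e: "U \<union> S - S = U" using us' by auto
    show "(case case a of (U, S) \<Rightarrow> (U \<union> S, S) of (V, S) \<Rightarrow> (V - S, S)) = a"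
      using us e by simp
    show "(case a of (U, S) \<Rightarrow> (U \<union> S, S)) \<in> ?A" using us us' e by auto
    have "prod r (U \<union> S) = prod r U * prod r S"
      using us' finite_subset[OF us'(1) P] finite_subset[OF us'(2)] P by (intro prod.union_disjoint) auto
    then show "(case case a of (U, S) \<Rightarrow> (U \<union> S, S) of (V, S) \<Rightarrow> prod r V * prod r S) =
         (case a of (U, S) \<Rightarrow> prod r U * (prod r S)\<^sup>2)"
      using us by (simp add: power2_eq_square)
  qed (auto)
  also have "\<dots> = (\<Sum>V\<in>Pow P. prod r V * b V)"
    unfolding b_def sum_distrib_left using P finS by (intro sum.Sigma[symmetric]) auto
  finally have le: "(1 - d) * Z * G \<le> (\<Sum>V\<in>Pow P. prod r V * b V)" .
  have "((1 - d) * Z * G)\<^sup>2 \<le> (\<Sum>V\<in>Pow P. prod r V * b V)\<^sup>2"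
    using d Zpos G0 by (intro power_mono le) auto
  also have "\<dots> \<le> (\<Sum>V\<in>Pow P. (prod r V)\<^sup>2) * (\<Sum>V\<in>Pow P. (b V)\<^sup>2)"
    by (rule Cauchy_Schwarz_ineq_sum)
  finally have "Z * ((1 - d)\<^sup>2 * G\<^sup>2 * Z) \<le> Z * (\<Sum>V\<in>Pow P. (b V)\<^sup>2)"
    unfolding ZZ by (simp add: power2_eq_square algebra_simps)
  then have "(1 - d)\<^sup>2 * G\<^sup>2 * Z \<le> (\<Sum>V\<in>Pow P. (b V)\<^sup>2)"
    using Zpos by (subst (asm) mult_le_cancel_left) auto
  moreover have "(\<Sum>S | S \<subseteq> P \<and> sum x S \<le> \<Lambda>. (prod r S)\<^sup>2) \<le> Z"
    unfolding ZZ[symmetric] using P by (intro sum_mono2) auto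
  then have "(1 - d)\<^sup>2 * G\<^sup>2 * (\<Sum>S | S \<subseteq> P \<and> sum x S \<le> \<Lambda>. (prod r S)\<^sup>2) \<le> (1 - d)\<^sup>2 * G\<^sup>2 * Z"
    by (intro mult_left_mono) auto
  ultimately show ?thesis unfolding b_def G_def by linarith
qed

text \<open>Exponential tilting, Rankin's trick used for a lower bound. Subsets with
  \<open>sum x U\<close> within \<rho> of the tilted mean carry three quarters of the tilted mass by
  Chebyshev, and on them undoing the tilt gains at least
  \<open>exp (s * (\<mu> - \<rho>))\<close>.\<close>

lemma truncated_product_lower:
  fixes g x :: "'a \<Rightarrow> real" and s \<rho> :: real
  assumes P: "finite P" and g: "\<And>p. p \<in> P \<Longrightarrow> g p \<ge> 0" and s: "s \<ge> 0" and \<rho>: "\<rho> > 0"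
  defines "h \<equiv> \<lambda>p. g p * exp (- s * x p)"
  assumes V: "4 * (\<Sum>p\<in>P. h p * (x p)\<^sup>2) \<le> \<rho>\<^sup>2"
  defines "\<mu> \<equiv> (\<Sum>p\<in>P. h p / (1 + h p) * x p)"
  shows "(\<Sum>U | U \<subseteq> P \<and> sum x U \<le> \<mu> + \<rho>. prod g U) \<ge> 3 / 4 * exp (s * (\<mu> - \<rho>)) * (\<Prod>p\<in>P. 1 + h p)"
proof -
  have h: "h p \<ge> 0" if "p \<in> P" for p using g[OF that] by (simp add: h_def)
  have "exp (s * (\<mu> - \<rho>)) * (3 / 4 * (\<Prod>p\<in>P. 1 + h p)) \<le>
      exp (s * (\<mu> - \<rho>)) * (\<Sum>U | U \<subseteq> P \<and> \<bar>sum x U - \<mu>\<bar> \<le> \<rho>. prod h U)"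
    unfolding \<mu>_def by (intro mult_left_mono subset_chebyshev P h V \<rho>) auto
  also have "\<dots> \<le> (\<Sum>U | U \<subseteq> P \<and> \<bar>sum x U - \<mu>\<bar> \<le> \<rho>. prod g U)"
    unfolding sum_distrib_left
  proof (intro sum_mono)
    fix U assume U: "U \<in> {U. U \<subseteq> P \<and> \<bar>sum x U - \<mu>\<bar> \<le> \<rho>}"
    have fU: "finite U" using U P finite_subset by auto
    have "prod h U = prod g U * exp (- s * sum x U)"
      by (simp add: h_def prod.distrib sum_distrib_left exp_sum[OF fU] flip: sum_negf)
    moreover have "exp (s * (\<mu> - \<rho>)) * exp (- s * sum x U) \<le> 1"
    proof -
      have "s * (\<mu> - \<rho>) \<le> s * sum x U" using U s by (intro mult_left_mono) auto
      then show ?thesis by (simp flip: exp_add)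
    qed
    moreover have "prod g U \<ge> 0" using U g by (intro prod_nonneg) auto
    ultimately show "exp (s * (\<mu> - \<rho>)) * prod h U \<le> prod g U"
      using mult_left_mono[of "exp (s * (\<mu> - \<rho>)) * exp (- s * sum x U)" 1 "prod g U"]
      by (simp add: mult_ac)
  qed
  also have "\<dots> \<le> (\<Sum>U | U \<subseteq> P \<and> sum x U \<le> \<mu> + \<rho>. prod g U)"
    using P g by (intro sum_mono2) (auto intro!: prod_nonneg)
  finally show ?thesis by (simp add: mult_ac)
qed

section \<open>Gaussian averages of Dirichlet polynomials\<close>

abbreviation \<gamma> :: "real measure" where "\<gamma> \<equiv> std_normal_distribution"

lemma integrable_gauss_bounded:
  fixes F :: "real \<Rightarrow> 'b :: {banach, second_countable_topology}"
  assumes "F \<in> borel_measurable borel" "\<And>x. norm (F x) \<le> B"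
  shows "integrable \<gamma> F"
proof -
  interpret real_distribution \<gamma> by (rule real_dist_normal_dist)
  show ?thesis using assms by (intro integrable_const_bound[of _ B]) auto
qed

lemma gauss_integral_cis:
  "(\<integral>x. cis (w * (t0 + \<sigma> * x)) \<partial>\<gamma>) = cis (w * t0) * complex_of_real (exp (- (w * \<sigma>)\<^sup>2 / 2))"
proof -
  have "cis (w * (t0 + \<sigma> * x)) = cis (w * t0) * iexp (w * \<sigma> * x)" for x
    by (simp add: cis_conv_exp exp_add[symmetric] algebra_simps)
  then have "(\<integral>x. cis (w * (t0 + \<sigma> * x)) \<partial>\<gamma>) = cis (w * t0) * char \<gamma> (w * \<sigma>)"
    unfolding char_def by simp
  then show ?thesis by (simp add: char_std_normal_distribution)
qed

lemma gauss_tail: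
  assumes "a > 0"
  shows "measure \<gamma> {x. \<bar>x\<bar> > a} \<le> 2 * exp (- a\<^sup>2 / 4)"
proof -
  interpret real_distribution \<gamma> by (rule real_dist_normal_dist)
  let ?A = "{x::real. \<bar>x\<bar> > a}"
  have A: "?A \<in> sets borel" by measurable
  \<comment> \<open>Half of the Gaussian exponent goes into the density of variance 2, which still
    integrates to 1; the other half is bounded by its value at \<open>a\<close>.\<close>
  have dens: "std_normal_density x = sqrt 2 * exp (- x\<^sup>2 / 4) * normal_density 0 (sqrt 2) x" for x :: real
  proof -
    have "exp (- x\<^sup>2 / 2) = exp (- x\<^sup>2 / 4) * exp (- x\<^sup>2 / 4)" by (simp flip: exp_add)
    then show ?thesis by (simp add: normal_density_def real_sqrt_mult field_simps)
  qed
  have "measure \<gamma> ?A = (\<integral>x. indicator ?A x \<partial>\<gamma>)" using A by simp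
  also have "\<dots> = (\<integral>x. std_normal_density x * indicator ?A x \<partial>lborel)"
    using A by (subst integral_density) (auto simp: normal_density_nonneg)
  also have "\<dots> \<le> (\<integral>x. 2 * exp (- a\<^sup>2 / 4) * normal_density 0 (sqrt 2) x \<partial>lborel)"
  proof (rule integral_mono)
    show "integrable lborel (\<lambda>x. std_normal_density x * indicator ?A x)"
      using A by (intro integrable_real_mult_indicator) auto
    show "integrable lborel (\<lambda>x. 2 * exp (- a\<^sup>2 / 4) * normal_density 0 (sqrt 2) x)"
      by (intro integrable_mult_right integrable_normal_density) auto
    fix x :: real
    show "std_normal_density x * indicator ?A x \<le> 2 * exp (- a\<^sup>2 / 4) * normal_density 0 (sqrt 2) x"
    proof (cases "x \<in> ?A")
      case True
      then have "a\<^sup>2 \<le> x\<^sup>2" using assms abs_le_square_iff[of a x] by auto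
      then have "sqrt 2 * exp (- x\<^sup>2 / 4) \<le> 2 * exp (- a\<^sup>2 / 4)"
        by (intro mult_mono) (auto intro: real_le_lsqrt)
      then show ?thesis using True unfolding dens[of x]
        by (simp add: mult_right_mono normal_density_nonneg)
    qed auto
  qed
  also have "\<dots> = 2 * exp (- a\<^sup>2 / 4)" by simp
  finally show ?thesis .
qed

lemma sum_squared_le_card:
  fixes c :: "'a \<Rightarrow> real"
  assumes "finite I"
  shows "(\<Sum>i\<in>I. c i)\<^sup>2 \<le> real (card I) * (\<Sum>i\<in>I. (c i)\<^sup>2)"
  using Cauchy_Schwarz_ineq_sum[of "\<lambda>_. 1" c I] by simp

text \<open>In the expanded square the pair \<open>(i, j)\<close> is weighted by the Gaussian
  characteristic function at \<open>(\<omega> i - \<omega> j) * \<sigma>\<close>, which is 1 on the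
  diagonal and at most \<open>exp (- (\<delta> * \<sigma>)\<^sup>2 / 2)\<close> off it. Cauchy's
  inequality bounds the off-diagonal coefficients, at the price of the factor
  \<open>card I\<close>.\<close>

lemma gauss_mean_square:
  fixes a :: "'a \<Rightarrow> complex" and \<omega> :: "'a \<Rightarrow> real"
  assumes I: "finite I" and sep: "\<And>i j. i \<in> I \<Longrightarrow> j \<in> I \<Longrightarrow> i \<noteq> j \<Longrightarrow> \<bar>\<omega> i - \<omega> j\<bar> \<ge> \<delta>" and \<delta>: "\<delta> \<ge> 0"
  defines "F \<equiv> \<lambda>t. \<Sum>i\<in>I. a i * cis (\<omega> i * t)"
  shows "integrable \<gamma> (\<lambda>x. (norm (F (t0 + \<sigma> * x)))\<^sup>2)"
    and "\<bar>(\<integral>x. (norm (F (t0 + \<sigma> * x)))\<^sup>2 \<partial>\<gamma>) - (\<Sum>i\<in>I. (norm (a i))\<^sup>2)\<bar>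
      \<le> real (card I) * exp (- (\<delta> * \<sigma>)\<^sup>2 / 2) * (\<Sum>i\<in>I. (norm (a i))\<^sup>2)"
proof -
  let ?c = "exp (- (\<delta> * \<sigma>)\<^sup>2 / 2)"
  have Fle: "norm (F t) \<le> (\<Sum>i\<in>I. norm (a i))" for t
    unfolding F_def by (rule sum_norm_le) (simp add: norm_mult)
  have contF: "continuous_on UNIV F" unfolding F_def by (intro continuous_intros)
  have cF: "continuous_on UNIV (\<lambda>x. F (t0 + \<sigma> * x))"
    by (rule continuous_on_compose2[OF contF]) (auto intro!: continuous_intros)
  show int: "integrable \<gamma> (\<lambda>x. (norm (F (t0 + \<sigma> * x)))\<^sup>2)"
    by (rule integrable_gauss_bounded[of _ "(\<Sum>i\<in>I. norm (a i))\<^sup>2"])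
       (auto intro!: borel_measurable_continuous_onI continuous_intros cF power_mono Fle)
  have intcis: "integrable \<gamma> (\<lambda>x. cis (w * (t0 + \<sigma> * x)))" for w
    by (rule integrable_gauss_bounded[of _ 1])
       (auto intro!: borel_measurable_continuous_onI continuous_intros)
  have sq: "complex_of_real ((norm (F t))\<^sup>2) = (\<Sum>i\<in>I. \<Sum>j\<in>I. (a i * cnj (a j)) * cis ((\<omega> i - \<omega> j) * t))" for t
  proof -
    have "cis ((\<omega> i - \<omega> j) * t) = cis (\<omega> i * t) * cnj (cis (\<omega> j * t))" for i j
      by (simp add: cis_cnj cis_mult algebra_simps)
    then have "(\<Sum>i\<in>I. \<Sum>j\<in>I. (a i * cnj (a j)) * cis ((\<omega> i - \<omega> j) * t)) = F t * cnj (F t)"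
      unfolding F_def cnj_sum sum_product by (intro sum.cong refl) (simp add: mult_ac)
    then show ?thesis by (simp only: complex_norm_square)
  qed
  define E where "E i j = cis ((\<omega> i - \<omega> j) * t0) * complex_of_real (exp (- ((\<omega> i - \<omega> j) * \<sigma>)\<^sup>2 / 2))" for i j
  have "complex_of_real (\<integral>x. (norm (F (t0 + \<sigma> * x)))\<^sup>2 \<partial>\<gamma>) =
      (\<integral>x. complex_of_real ((norm (F (t0 + \<sigma> * x)))\<^sup>2) \<partial>\<gamma>)"
    by (rule integral_complex_of_real[symmetric])
  also have "\<dots> = (\<Sum>i\<in>I. \<Sum>j\<in>I. (a i * cnj (a j)) * E i j)"
    unfolding sq E_def gauss_integral_cis[symmetric]
    by (simp add: intcis)
  also have "\<dots> = (\<Sum>i\<in>I. (a i * cnj (a i)) + (\<Sum>j\<in>I - {i}. (a i * cnj (a j)) * E i j))"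
    by (intro sum.cong refl) (simp add: sum.remove[OF I] E_def)
  also have "\<dots> = complex_of_real (\<Sum>i\<in>I. (norm (a i))\<^sup>2) + (\<Sum>i\<in>I. \<Sum>j\<in>I - {i}. (a i * cnj (a j)) * E i j)"
    by (simp only: sum.distrib of_real_sum complex_norm_square)
  finally have "complex_of_real ((\<integral>x. (norm (F (t0 + \<sigma> * x)))\<^sup>2 \<partial>\<gamma>) - (\<Sum>i\<in>I. (norm (a i))\<^sup>2)) =
      (\<Sum>i\<in>I. \<Sum>j\<in>I - {i}. (a i * cnj (a j)) * E i j)" by simp
  then have "\<bar>(\<integral>x. (norm (F (t0 + \<sigma> * x)))\<^sup>2 \<partial>\<gamma>) - (\<Sum>i\<in>I. (norm (a i))\<^sup>2)\<bar> =
      norm (\<Sum>i\<in>I. \<Sum>j\<in>I - {i}. (a i * cnj (a j)) * E i j)"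
    by (subst norm_of_real[where 'a = complex, symmetric, unfolded real_norm_def]) (rule arg_cong)
  also have "\<dots> \<le> (\<Sum>i\<in>I. \<Sum>j\<in>I - {i}. norm (a i) * norm (a j) * ?c)"
  proof (intro sum_norm_le)
    fix i j assume ij: "i \<in> I" "j \<in> I - {i}"
    have "(\<delta> * \<sigma>)\<^sup>2 \<le> ((\<omega> i - \<omega> j) * \<sigma>)\<^sup>2"
      using sep[of i j] ij \<delta> unfolding power_mult_distrib
      by (intro mult_right_mono) (auto simp: abs_le_square_iff[symmetric])
    then have "norm (E i j) \<le> ?c" by (simp add: E_def norm_mult)
    then show "norm (a i * cnj (a j) * E i j) \<le> norm (a i) * norm (a j) * ?c"
      by (simp add: norm_mult mult_left_mono)
  qed
  also have "\<dots> \<le> (\<Sum>i\<in>I. \<Sum>j\<in>I. norm (a i) * norm (a j) * ?c)"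
    using I by (intro sum_mono sum_mono2) auto
  also have "\<dots> = ?c * (\<Sum>i\<in>I. norm (a i))\<^sup>2"
    by (simp only: power2_eq_square[of "\<Sum>i\<in>I. norm (a i)"] sum_product sum_distrib_left sum_distrib_right mult_ac)
  also have "\<dots> \<le> ?c * (real (card I) * (\<Sum>i\<in>I. (norm (a i))\<^sup>2))"
    by (intro mult_left_mono sum_squared_le_card I) auto
  finally show "\<bar>(\<integral>x. (norm (F (t0 + \<sigma> * x)))\<^sup>2 \<partial>\<gamma>) - (\<Sum>i\<in>I. (norm (a i))\<^sup>2)\<bar>
      \<le> real (card I) * ?c * (\<Sum>i\<in>I. (norm (a i))\<^sup>2)" by (simp add: mult_ac)
qed

text \<open>Compare the Gaussian mean squares of the resonator and of its product with
  \<open>D\<close>. Where \<open>t\<close> lies in \<open>[1, T]\<close>, \<open>D\<close> is at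
  most \<open>m\<close>; elsewhere the trivial bound \<open>B\<close> is paid with the Gaussian
  tail. Both mean squares are diagonal up to the relative error \<eta>.\<close>

lemma resonance_inequality:
  fixes u :: "'a \<Rightarrow> complex" and v :: "'b \<Rightarrow> complex" and \<alpha> :: "'a \<Rightarrow> real" and \<beta> :: "'b \<Rightarrow> real"
    and D :: "real \<Rightarrow> complex"
  assumes I: "finite I" and J: "finite J"
    and sepI: "\<And>i j. i \<in> I \<Longrightarrow> j \<in> I \<Longrightarrow> i \<noteq> j \<Longrightarrow> \<bar>\<alpha> i - \<alpha> j\<bar> \<ge> \<delta>"
    and sepJ: "\<And>i j. i \<in> J \<Longrightarrow> j \<in> J \<Longrightarrow> i \<noteq> j \<Longrightarrow> \<bar>\<beta> i - \<beta> j\<bar> \<ge> \<delta>"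
    and \<delta>: "\<delta> \<ge> 0" and \<sigma>: "\<sigma> > 0" and T: "T > 2"
    and DR: "\<And>t. D t * (\<Sum>i\<in>I. u i * cis (\<alpha> i * t)) = (\<Sum>j\<in>J. v j * cis (\<beta> j * t))"
    and m: "\<And>t. 1 \<le> t \<Longrightarrow> t \<le> T \<Longrightarrow> norm (D t) \<le> m" and B: "\<And>t. norm (D t) \<le> B"
    and K: "real (card I) \<le> K" "real (card J) \<le> K"
  defines "\<eta> \<equiv> K * exp (- (\<delta> * \<sigma>)\<^sup>2 / 2)"
  shows "(1 - \<eta>) * (\<Sum>j\<in>J. (norm (v j))\<^sup>2) \<le>
    (m\<^sup>2 * (1 + \<eta>) + 2 * B\<^sup>2 * K * exp (- ((T / 2 - 1) / \<sigma>)\<^sup>2 / 4)) * (\<Sum>i\<in>I. (norm (u i))\<^sup>2)"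
proof -
  interpret real_distribution \<gamma> by (rule real_dist_normal_dist)
  define R where "R = (\<lambda>t. \<Sum>i\<in>I. u i * cis (\<alpha> i * t))"
  define F where "F = (\<lambda>t. \<Sum>j\<in>J. v j * cis (\<beta> j * t))"
  \<comment> \<open>The condition \<open>\<bar>x\<bar> \<le> a\<close> keeps
    \<open>T / 2 + \<sigma> * x\<close> between 1 and \<open>T - 1\<close>.\<close>
  define a where "a = (T / 2 - 1) / \<sigma>"
  have a: "a > 0" using \<sigma> T by (simp add: a_def)
  let ?t = "\<lambda>x. T / 2 + \<sigma> * x"
  let ?A = "{x::real. \<bar>x\<bar> > a}"
  let ?U = "\<Sum>i\<in>I. (norm (u i))\<^sup>2" and ?V = "\<Sum>j\<in>J. (norm (v j))\<^sup>2"
  have U: "?U \<ge> 0" and V: "?V \<ge> 0" by (auto intro: sum_nonneg)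
  have K0: "K \<ge> 0" using K(1) by linarith
  have intR: "integrable \<gamma> (\<lambda>x. (norm (R (?t x)))\<^sup>2)"
    unfolding R_def by (rule gauss_mean_square(1)[OF I sepI \<delta>])
  have meanR: "\<bar>(\<integral>x. (norm (R (?t x)))\<^sup>2 \<partial>\<gamma>) - ?U\<bar> \<le> real (card I) * exp (- (\<delta> * \<sigma>)\<^sup>2 / 2) * ?U"
    unfolding R_def by (rule gauss_mean_square(2)[OF I sepI \<delta>])
  have intF: "integrable \<gamma> (\<lambda>x. (norm (F (?t x)))\<^sup>2)"
    unfolding F_def by (rule gauss_mean_square(1)[OF J sepJ \<delta>])
  have meanF: "\<bar>(\<integral>x. (norm (F (?t x)))\<^sup>2 \<partial>\<gamma>) - ?V\<bar> \<le> real (card J) * exp (- (\<delta> * \<sigma>)\<^sup>2 / 2) * ?V"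
    unfolding F_def by (rule gauss_mean_square(2)[OF J sepJ \<delta>])
  have Rb: "(norm (R t))\<^sup>2 \<le> K * ?U" for t
  proof -
    have "norm (R t) \<le> (\<Sum>i\<in>I. norm (u i))"
      unfolding R_def by (rule sum_norm_le) (simp add: norm_mult)
    then have "(norm (R t))\<^sup>2 \<le> (\<Sum>i\<in>I. norm (u i))\<^sup>2" by (intro power_mono) auto
    also have "\<dots> \<le> real (card I) * ?U" by (rule sum_squared_le_card[OF I])
    also have "\<dots> \<le> K * ?U" by (intro mult_right_mono K U)
    finally show ?thesis .
  qed
  have pw: "(norm (F (?t x)))\<^sup>2 \<le> m\<^sup>2 * (norm (R (?t x)))\<^sup>2 + B\<^sup>2 * (K * ?U) * indicator ?A x" for x
  proof -
    have e: "(norm (F (?t x)))\<^sup>2 = (norm (D (?t x)))\<^sup>2 * (norm (R (?t x)))\<^sup>2"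
      unfolding F_def R_def DR[symmetric] by (simp only: norm_mult power_mult_distrib)
    show ?thesis
    proof (cases "x \<in> ?A")
      case True
      have "(norm (D (?t x)))\<^sup>2 * (norm (R (?t x)))\<^sup>2 \<le> B\<^sup>2 * (K * ?U)"
        using B Rb by (intro mult_mono power_mono) auto
      then have "(norm (D (?t x)))\<^sup>2 * (norm (R (?t x)))\<^sup>2 \<le> m\<^sup>2 * (norm (R (?t x)))\<^sup>2 + B\<^sup>2 * (K * ?U)"
        by (rule add_increasing[rotated]) simp
      then show ?thesis unfolding e using True by simp
    next
      case False
      then have "\<bar>\<sigma> * x\<bar> \<le> \<sigma> * a" using \<sigma> by (simp add: abs_mult)
      then have "\<bar>\<sigma> * x\<bar> \<le> T / 2 - 1" using \<sigma> by (simp add: a_def)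
      then have "norm (D (?t x)) \<le> m" by (intro m) (auto simp: abs_le_iff)
      then have "(norm (D (?t x)))\<^sup>2 * (norm (R (?t x)))\<^sup>2 \<le> m\<^sup>2 * (norm (R (?t x)))\<^sup>2"
        by (intro mult_right_mono power_mono) auto
      then show ?thesis unfolding e using False by simp
    qed
  qed
  have A: "?A \<in> sets borel" by measurable
  have "(1 - \<eta>) * ?V \<le> ?V - real (card J) * exp (- (\<delta> * \<sigma>)\<^sup>2 / 2) * ?V"
  proof -
    have "real (card J) * exp (- (\<delta> * \<sigma>)\<^sup>2 / 2) * ?V \<le> \<eta> * ?V"
      unfolding \<eta>_def by (intro mult_right_mono K V) auto
    then show ?thesis by (simp add: algebra_simps)
  qed
  also have "\<dots> \<le> (\<integral>x. (norm (F (?t x)))\<^sup>2 \<partial>\<gamma>)" using meanF by linarith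
  also have "\<dots> \<le> (\<integral>x. m\<^sup>2 * (norm (R (?t x)))\<^sup>2 + B\<^sup>2 * (K * ?U) * indicator ?A x \<partial>\<gamma>)"
    using A by (intro integral_mono intF pw Bochner_Integration.integrable_add integrable_mult_right intR)
       (auto intro!: integrable_real_indicator simp: emeasure_eq_measure)
  also have "\<dots> = m\<^sup>2 * (\<integral>x. (norm (R (?t x)))\<^sup>2 \<partial>\<gamma>) + B\<^sup>2 * (K * ?U) * measure \<gamma> ?A"
    using A intR by (subst Bochner_Integration.integral_add)
      (auto intro!: integrable_real_indicator simp: emeasure_eq_measure)
  also have "\<dots> \<le> m\<^sup>2 * ((1 + \<eta>) * ?U) + B\<^sup>2 * (K * ?U) * (2 * exp (- a\<^sup>2 / 4))"
  proof (intro add_mono mult_left_mono gauss_tail a)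
    have "real (card I) * exp (- (\<delta> * \<sigma>)\<^sup>2 / 2) * ?U \<le> \<eta> * ?U"
      unfolding \<eta>_def by (intro mult_right_mono K U) auto
    then show "(\<integral>x. (norm (R (?t x)))\<^sup>2 \<partial>\<gamma>) \<le> (1 + \<eta>) * ?U"
      using meanR by (simp add: algebra_simps)
  qed (use K0 U in auto)
  finally show ?thesis by (simp add: a_def algebra_simps)
qed

section \<open>The resonance inequality for twisted sums\<close>

lemma prime_dvd_Prod_iff:
  assumes "finite V" "\<And>q. q \<in> V \<Longrightarrow> prime (q::nat)" "prime p"
  shows "p dvd \<Prod>V \<longleftrightarrow> p \<in> V"
  unfolding prime_dvd_prod_iff[OF assms(1,3)] using assms(2,3) primes_dvd_imp_eq dvd_refl by metis

text \<open>\<open>V\<close> is recovered as the set of primes of \<open>P\<close> dividing the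
  product, since none of them divides the cofactor. With \<open>C = {1}\<close> this says that a
  squarefree product determines its set of primes.\<close>

lemma Prod_coprime_inj:
  assumes P: "finite P" "\<And>p. p \<in> P \<Longrightarrow> prime (p::nat)"
    and C: "\<And>c. c \<in> C \<Longrightarrow> c > 0" "\<And>c p. c \<in> C \<Longrightarrow> p \<in> P \<Longrightarrow> \<not> p dvd c"
  shows "inj_on (\<lambda>(c, V). c * \<Prod>V) (C \<times> Pow P)"
proof (rule inj_onI, clarify)
  fix c V c' V' assume *: "c \<in> C" "c' \<in> C" "V \<subseteq> P" "V' \<subseteq> P" "c * \<Prod>V = c' * \<Prod>V'"
  have mem: "p \<in> W \<longleftrightarrow> p dvd e * \<Prod>W" if "W \<subseteq> P" "p \<in> P" "e \<in> C" for W p e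
  proof -
    have "finite W" "\<And>q. q \<in> W \<Longrightarrow> prime q" "prime p" "\<not> p dvd e"
      using that P C finite_subset by auto
    then show ?thesis by (simp add: prime_dvd_mult_iff prime_dvd_Prod_iff)
  qed
  have "V = V'" using mem[of V _ c] mem[of V' _ c'] * by auto
  moreover have "\<Prod>V > 0" using * P by (intro prod_pos) (auto dest!: subsetD[of V P] prime_gt_0_nat)
  ultimately show "c = c' \<and> V = V'" using *(5) by simp
qed

lemma ln_separation:
  assumes "1 \<le> k" "1 \<le> l" "k \<noteq> l" "real k \<le> K" "real l \<le> K"
  shows "\<bar>ln (real k) - ln (real l)\<bar> \<ge> 1 / K"
proof -
  have *: "ln (real l) - ln (real k) \<ge> 1 / K" if "1 \<le> k" "k < l" "real l \<le> K" for k l :: nat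
  proof -
    have "1 / K \<le> 1 / real l" using that by (intro divide_left_mono) auto
    also have "\<dots> \<le> (real l - real k) / real l" using that by (intro divide_right_mono) auto
    also have "\<dots> = 1 - real k / real l" using that by (simp add: diff_divide_distrib)
    also have "\<dots> \<le> - ln (real k / real l)" using that ln_le_minus_one[of "real k / real l"] by simp
    also have "\<dots> = ln (real l) - ln (real k)" using that by (simp add: ln_div)
    finally show ?thesis .
  qed
  show ?thesis using *[of k l] *[of l k] assms by (cases "k < l") auto
qed

lemma of_nat_powr_imaginary:
  assumes "n \<ge> 1"
  shows "(of_nat n :: complex) powr (\<i> * complex_of_real t) = cis (ln (real n) * t)"
proof -
  have "Ln (of_nat n) = complex_of_real (ln (real n))"
    using Ln_of_real[of "real n"] assms by simp
  then show ?thesis using assms by (simp add: powr_def cis_conv_exp mult_ac)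
qed

lemma card_nat_real_le:
  assumes "x \<ge> 0"
  shows "finite {n::nat. 1 \<le> n \<and> real n \<le> x}" "real (card {n::nat. 1 \<le> n \<and> real n \<le> x}) \<le> x"
proof -
  have "{n::nat. 1 \<le> n \<and> real n \<le> x} = {1..nat \<lfloor>x\<rfloor>}" using assms by (auto simp: le_nat_floor le_floor_iff nat_le_iff) linarith
  then show "finite {n::nat. 1 \<le> n \<and> real n \<le> x}" "real (card {n::nat. 1 \<le> n \<and> real n \<le> x}) \<le> x"
    using assms by simp_all
qed

lemma norm_twisted_sum_le:
  assumes "N \<ge> 0" "\<And>n. n \<ge> 1 \<Longrightarrow> norm (f n) = 1"
  shows "norm (twisted_sum f N t) \<le> N"
proof -
  have "norm (twisted_sum f N t) \<le> (\<Sum>n | 1 \<le> n \<and> real n \<le> N. 1)"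
    unfolding twisted_sum_def
    by (rule sum_norm_le) (auto simp: norm_mult assms of_nat_powr_imaginary)
  also have "\<dots> \<le> N" using card_nat_real_le(2)[OF assms(1)] by simp
  finally show ?thesis .
qed

lemma norm_twisted_sum_le_max:
  assumes "N \<ge> 0" "\<And>n. n \<ge> 1 \<Longrightarrow> norm (f n) = 1" "1 \<le> t" "t \<le> T"
  shows "norm (twisted_sum f N t) \<le> max_twisted_sum f N T"
  unfolding max_twisted_sum_def
  by (rule cSUP_upper) (use assms norm_twisted_sum_le[OF assms(1,2)] in \<open>auto intro!: bdd_aboveI2\<close>)

lemma completely_multiplicative_mult:
  assumes "completely_multiplicative f" "m > 0" "n > 0"
  shows "f (m * n) = f m * f n"
  using assms by (simp add: completely_multiplicative_def)

text \<open>\<open>K\<close> bounds every product of some \<open>n \<le> N\<close> with a resonator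
  integer, so it bounds the number of frequencies, and \<open>1 / K\<close> separates them. The
  diagonal sum is then bounded below by the integers \<open>c * \<Prod>V\<close>, which are
  distinct, and each \<open>c\<close> contributes the same multiple of the resonator's norm.\<close>

lemma max_twisted_sum_lower:
  fixes f :: "nat \<Rightarrow> complex" and r :: "nat \<Rightarrow> real" and P C :: "nat set" and N T \<sigma> d \<Lambda> \<Xi> :: real
  assumes f: "completely_multiplicative f" "\<And>n. n \<ge> 1 \<Longrightarrow> norm (f n) = 1"
    and P: "finite P" "\<And>p. p \<in> P \<Longrightarrow> prime p" and r: "\<And>p. p \<in> P \<Longrightarrow> r p \<ge> 0"
    and C: "finite C" "C \<noteq> {}" "\<And>c. c \<in> C \<Longrightarrow> c > 0" "\<And>c p. c \<in> C \<Longrightarrow> p \<in> P \<Longrightarrow> \<not> p dvd c"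
      "\<And>c. c \<in> C \<Longrightarrow> real c * exp \<Xi> \<le> N"
    and \<Xi>: "\<Xi> \<ge> 0" and \<Lambda>: "\<Lambda> > 0" and d: "d \<le> 1" and T: "T > 2" and \<sigma>: "\<sigma> > 0" and N: "N \<ge> 1"
    and E: "(\<Sum>p\<in>P. (r p)\<^sup>2 * ln (real p)) \<le> d * \<Lambda>"
  defines "K \<equiv> N * exp \<Lambda>"
  assumes \<eta>: "K * exp (- (\<sigma> / K)\<^sup>2 / 2) \<le> 1 / 2"
    and err: "2 * N\<^sup>2 * K * exp (- ((T / 2 - 1) / \<sigma>)\<^sup>2 / 4) \<le> (1 - d)\<^sup>2 / 4"
  defines "G \<equiv> (\<Sum>U | U \<subseteq> P \<and> (\<Sum>p\<in>U. ln (real p)) \<le> \<Xi>. \<Prod>p\<in>U. r p / (1 + (r p)\<^sup>2))"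
  shows "max_twisted_sum f N T \<ge> (1 - d) * sqrt (real (card C)) * G / sqrt 6"
proof -
  define x where "x = (\<lambda>p::nat. ln (real p))"
  define I where "I = {S. S \<subseteq> P \<and> sum x S \<le> \<Lambda>}"
  define NN where "NN = {n::nat. 1 \<le> n \<and> real n \<le> N}"
  define J where "J = {n::nat. 1 \<le> n \<and> real n \<le> K}"
  \<comment> \<open>By complete multiplicativity the coefficient of \<open>k\<close> in the product
    is \<open>b k * f k\<close>. As \<open>b k\<close> is a sum of nonnegative terms, discarding
    representations of \<open>k\<close> only lowers it.\<close>
  define b where "b k = (\<Sum>(n, S) | (n, S) \<in> NN \<times> I \<and> n * \<Prod>S = k. prod r S)" for k
  define Z where "Z = (\<Sum>S\<in>I. (prod r S)\<^sup>2)"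
  define m where "m = max_twisted_sum f N T"
  have finsub: "finite V" if "V \<subseteq> P" for V using that P(1) finite_subset by auto
  have pos: "\<Prod>V > 0" if "V \<subseteq> P" for V
    using that P by (intro prod_pos) (auto dest!: subsetD prime_gt_0_nat)
  have rn: "prod r V \<ge> 0" if "V \<subseteq> P" for V using that r by (intro prod_nonneg) auto
  have x0: "x p \<ge> 0" if "p \<in> P" for p using P(2)[OF that] prime_ge_1_nat by (simp add: x_def)
  have exps: "exp (sum x V) = real (\<Prod>V)" if "V \<subseteq> P" for V
  proof -
    have "exp (sum x V) = (\<Prod>p\<in>V. exp (x p))" by (rule exp_sum[OF finsub[OF that]])
    also have "\<dots> = (\<Prod>p\<in>V. real p)"
      using that P(2) by (intro prod.cong refl) (auto simp: x_def dest!: subsetD prime_gt_0_nat)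
    finally show ?thesis by simp
  qed
  have N0: "N \<ge> 0" and K0: "K \<ge> 1" and KL: "exp \<Lambda> \<le> K"
  proof -
    show "N \<ge> 0" using N by simp
    show "exp \<Lambda> \<le> K" unfolding K_def using mult_right_mono[of 1 N "exp \<Lambda>"] N by simp
    moreover have "exp \<Lambda> \<ge> 1" using \<Lambda> by simp
    ultimately show "K \<ge> 1" by linarith
  qed
  have finI: "finite I" unfolding I_def using P(1) by (auto intro: finite_subset[of _ "Pow P"])
  have finNN: "finite NN" unfolding NN_def by (rule card_nat_real_le[OF N0])
  have finJ: "finite J" unfolding J_def by (rule card_nat_real_le) (use K0 in simp)
  have IL: "real (\<Prod>S) \<le> exp \<Lambda>" if "S \<in> I" for S
    using that exps[of S] unfolding I_def by (metis (mono_tags, lifting) exp_le_cancel_iff mem_Collect_eq)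
  have injP: "S = S'" if "S \<subseteq> P" "S' \<subseteq> P" "\<Prod>S = \<Prod>S'" for S S'
  proof -
    have "\<not> p dvd 1" if "p \<in> P" for p using prime_gt_1_nat[OF P(2)[OF that]] by simp
    then have "inj_on (\<lambda>(c, V). c * \<Prod>V) ({1} \<times> Pow P)" by (intro Prod_coprime_inj P) auto
    then show ?thesis using that by (auto simp: inj_on_def)
  qed
  have IJ: "\<Prod>S \<in> J" if "S \<in> I" for S
    using IL[OF that] KL pos[of S] that unfolding J_def I_def by (auto simp: Suc_le_eq)
  have nSJ: "n * \<Prod>S \<in> J" if "n \<in> NN" "S \<in> I" for n S
  proof -
    have "real n * real (\<Prod>S) \<le> N * exp \<Lambda>" using IL[OF that(2)] that(1) N0 unfolding NN_def by (intro mult_mono) (auto intro: prod_nonneg)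
    moreover have "n * \<Prod>S \<ge> 1" using that pos[of S] unfolding NN_def I_def by (auto simp: Suc_le_eq)
    ultimately show ?thesis unfolding J_def K_def by simp
  qed
  have bnn: "b k \<ge> 0" for k unfolding b_def I_def using rn by (intro sum_nonneg) auto
  have b0: "b k = 0" if "k \<notin> J" for k
  proof -
    have e: "{(n, S). (n, S) \<in> NN \<times> I \<and> n * \<Prod>S = k} = {}" using that nSJ by auto
    show ?thesis unfolding b_def e by simp
  qed
  have D: "twisted_sum f N t = (\<Sum>n\<in>NN. f n * cis (ln (real n) * t))" for t
    unfolding twisted_sum_def NN_def by (intro sum.cong refl) (simp add: of_nat_powr_imaginary)
  have DR: "twisted_sum f N t * (\<Sum>S\<in>I. (prod r S * f (\<Prod>S)) * cis (ln (real (\<Prod>S)) * t)) =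
      (\<Sum>k\<in>J. (b k * f k) * cis (ln (real k) * t))" for t
  proof -
    have "twisted_sum f N t * (\<Sum>S\<in>I. (prod r S * f (\<Prod>S)) * cis (ln (real (\<Prod>S)) * t)) =
        (\<Sum>(n, S)\<in>NN \<times> I. (f n * cis (ln (real n) * t)) * ((prod r S * f (\<Prod>S)) * cis (ln (real (\<Prod>S)) * t)))"
      unfolding D sum_product sum.cartesian_product ..
    also have "\<dots> = (\<Sum>z\<in>NN \<times> I. case z of (n, S) \<Rightarrow> prod r S * f (n * \<Prod>S) * cis (ln (real (n * \<Prod>S)) * t))"
    proof (intro sum.cong refl, clarify)
      fix n S assume "n \<in> NN" "S \<in> I"
      then have *: "n > 0" "\<Prod>S > 0" using pos[of S] by (auto simp: NN_def I_def)
      have "ln (real (n * \<Prod>S)) = ln (real n) + ln (real (\<Prod>S))"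
        using * unfolding of_nat_mult by (intro ln_mult_pos) (simp_all only: of_nat_0_less_iff)
      moreover have "f (n * \<Prod>S) = f n * f (\<Prod>S)" using f(1) * by (rule completely_multiplicative_mult)
      ultimately show "(f n * cis (ln (real n) * t)) * ((prod r S * f (\<Prod>S)) * cis (ln (real (\<Prod>S)) * t)) =
          prod r S * f (n * \<Prod>S) * cis (ln (real (n * \<Prod>S)) * t)"
        by (simp only: distrib_right distrib_left cis_mult[symmetric] mult_ac)
    qed
    also have "\<dots> = (\<Sum>k\<in>J. \<Sum>z\<in>{z \<in> NN \<times> I. (\<lambda>(n, S). n * \<Prod>S) z = k}. case z of (n, S) \<Rightarrow> prod r S * f (n * \<Prod>S) * cis (ln (real (n * \<Prod>S)) * t))"
      by (rule sum.group[symmetric]) (use finNN finI finJ nSJ in auto)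
    also have "\<dots> = (\<Sum>k\<in>J. (b k * f k) * cis (ln (real k) * t))"
    proof (intro sum.cong refl)
      fix k assume "k \<in> J"
      have "(\<Sum>z\<in>{z \<in> NN \<times> I. (\<lambda>(n, S). n * \<Prod>S) z = k}. case z of (n, S) \<Rightarrow> prod r S * f (n * \<Prod>S) * cis (ln (real (n * \<Prod>S)) * t)) =
        (\<Sum>z\<in>{z \<in> NN \<times> I. (\<lambda>(n, S). n * \<Prod>S) z = k}. complex_of_real (case z of (n, S) \<Rightarrow> prod r S) * (f k * cis (ln (real k) * t)))"
        by (intro sum.cong refl) (auto simp: mult_ac)
      moreover have "{z \<in> NN \<times> I. (\<lambda>(n, S). n * \<Prod>S) z = k} = {(n, S). (n, S) \<in> NN \<times> I \<and> n * \<Prod>S = k}" by auto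
      ultimately show "(\<Sum>z\<in>{z \<in> NN \<times> I. (\<lambda>(n, S). n * \<Prod>S) z = k}. case z of (n, S) \<Rightarrow> prod r S * f (n * \<Prod>S) * cis (ln (real (n * \<Prod>S)) * t)) = (b k * f k) * cis (ln (real k) * t)"
        unfolding b_def of_real_sum sum_distrib_right by (simp only: mult.assoc)
    qed
    finally show ?thesis .
  qed
  let ?\<eta> = "K * exp (- (1 / K * \<sigma>)\<^sup>2 / 2)"
  let ?e = "2 * N\<^sup>2 * K * exp (- ((T / 2 - 1) / \<sigma>)\<^sup>2 / 4)"
  have cardI: "real (card I) \<le> K"
  proof -
    have "card I \<le> card J"
      using IJ injP finJ by (intro card_inj_on_le[of Prod]) (auto simp: inj_on_def I_def)
    then show ?thesis using card_nat_real_le(2)[of K] K0 unfolding J_def by linarith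
  qed
  have main: "(1 - ?\<eta>) * (\<Sum>k\<in>J. (norm (b k * f k))\<^sup>2) \<le> (m\<^sup>2 * (1 + ?\<eta>) + ?e) * (\<Sum>S\<in>I. (norm (prod r S * f (\<Prod>S)))\<^sup>2)"
  proof (rule resonance_inequality[where D = "twisted_sum f N", OF finI finJ _ _ _ \<sigma> T DR])
    fix S S' assume SS: "S \<in> I" "S' \<in> I" "S \<noteq> S'"
    then have "\<Prod>S \<noteq> \<Prod>S'" using injP[of S S'] by (auto simp: I_def)
    with IJ[OF SS(1)] IJ[OF SS(2)] show "1 / K \<le> \<bar>ln (real (\<Prod>S)) - ln (real (\<Prod>S'))\<bar>"
      unfolding J_def by (intro ln_separation) auto
  next
    fix k l assume "k \<in> J" "l \<in> J" "k \<noteq> l"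
    then show "1 / K \<le> \<bar>ln (real k) - ln (real l)\<bar>"
      unfolding J_def by (intro ln_separation) auto
  next
    show "real (card J) \<le> K" unfolding J_def by (rule card_nat_real_le) (use K0 in simp)
  qed (use K0 N0 f(2) cardI in \<open>auto simp: m_def intro: norm_twisted_sum_le norm_twisted_sum_le_max\<close>)
  have fJ: "norm (f k) = 1" if "k \<in> J" for k using that f(2) by (auto simp: J_def)
  have 1: "(\<Sum>k\<in>J. (norm (b k * f k))\<^sup>2) = (\<Sum>k\<in>J. (b k)\<^sup>2)"
    by (intro sum.cong refl) (simp add: norm_mult fJ)
  have 2: "(\<Sum>S\<in>I. (norm (prod r S * f (\<Prod>S)))\<^sup>2) = Z"
    unfolding Z_def by (intro sum.cong refl) (simp add: norm_mult fJ IJ flip: of_real_prod)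
  have Z1: "Z \<ge> 1"
  proof -
    have "{} \<in> I" using \<Lambda> by (simp add: I_def)
    then have "(prod r {})\<^sup>2 \<le> Z" unfolding Z_def using finI by (intro member_le_sum) auto
    then show ?thesis by simp
  qed
  have bcV: "(\<Sum>S | S \<subseteq> V \<and> sum x S \<le> \<Lambda> \<and> sum x (V - S) \<le> \<Xi>. prod r S) \<le> b (c * \<Prod>V)"
    if cV: "c \<in> C" "V \<subseteq> P" for c V
  proof -
    let ?B = "{S. S \<subseteq> V \<and> sum x S \<le> \<Lambda> \<and> sum x (V - S) \<le> \<Xi>}"
    \<comment> \<open>Each admissible \<open>S\<close> yields a representation of
      \<open>c * \<Prod>V\<close>; its first factor is at most \<open>c * exp \<Xi>\<close>, hence
      at most \<open>N\<close>.\<close>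
    let ?g = "\<lambda>S. (c * \<Prod>(V - S), S)"
    have "(\<Sum>S\<in>?B. prod r S) = (\<Sum>z\<in>?g ` ?B. case z of (n, S) \<Rightarrow> prod r S)"
      by (subst sum.reindex) (auto simp: inj_on_def)
    also have "\<dots> \<le> b (c * \<Prod>V)"
      unfolding b_def
    proof (rule sum_mono2)
      show "finite {(n, S). (n, S) \<in> NN \<times> I \<and> n * \<Prod>S = c * \<Prod>V}"
        by (rule finite_subset[of _ "NN \<times> I"]) (use finNN finI in auto)
      show "?g ` ?B \<subseteq> {(n, S). (n, S) \<in> NN \<times> I \<and> n * \<Prod>S = c * \<Prod>V}"
      proof (clarify, intro conjI)
        fix S assume S: "S \<subseteq> V" "sum x S \<le> \<Lambda>" "sum x (V - S) \<le> \<Xi>"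
        have "real (c * \<Prod>(V - S)) = real c * exp (sum x (V - S))"
          using exps[OF order_trans[OF Diff_subset cV(2)], of S] by simp
        also have "\<dots> \<le> real c * exp \<Xi>" using S by (intro mult_left_mono) auto
        also have "\<dots> \<le> N" using C(5)[OF cV(1)] .
        finally have "real (c * \<Prod>(V - S)) \<le> N" .
        moreover have "c * \<Prod>(V - S) > 0" using C(3)[OF cV(1)] pos[OF order_trans[OF Diff_subset cV(2)], of S] by simp
        ultimately have "c * \<Prod>(V - S) \<in> NN" by (simp add: NN_def Suc_le_eq)
        then show "?g S \<in> NN \<times> I" using S cV by (auto simp: I_def)
        show "c * \<Prod>(V - S) * \<Prod>S = c * \<Prod>V"
          using prod.subset_diff[OF S(1) finsub[OF cV(2)], of "\<lambda>p. p"] by simp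
      qed
      show "\<And>z. z \<in> {(n, S). (n, S) \<in> NN \<times> I \<and> n * \<Prod>S = c * \<Prod>V} - ?g ` ?B \<Longrightarrow> 0 \<le> (case z of (n, S) \<Rightarrow> prod r S)"
        using rn by (auto simp: I_def)
    qed
    finally show ?thesis .
  qed
  have inj: "inj_on (\<lambda>(c, V). c * \<Prod>V) (C \<times> Pow P)" by (rule Prod_coprime_inj[OF P C(3,4)])
  have "real (card C) * ((1 - d)\<^sup>2 * G\<^sup>2 * Z) = (\<Sum>c\<in>C. (1 - d)\<^sup>2 * G\<^sup>2 * Z)" by simp
  also have "\<dots> \<le> (\<Sum>c\<in>C. \<Sum>V\<in>Pow P. (b (c * \<Prod>V))\<^sup>2)"
  proof (rule sum_mono)
    fix c assume c: "c \<in> C"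
    have "(1 - d)\<^sup>2 * G\<^sup>2 * Z \<le> (\<Sum>V\<in>Pow P. (\<Sum>S | S \<subseteq> V \<and> sum x S \<le> \<Lambda> \<and> sum x (V - S) \<le> \<Xi>. prod r S)\<^sup>2)"
      unfolding G_def Z_def I_def x_def[symmetric]
      by (rule resonance_ratio[OF P(1) r x0 _ \<Lambda> d]) (use E in \<open>auto simp: x_def\<close>)
    also have "\<dots> \<le> (\<Sum>V\<in>Pow P. (b (c * \<Prod>V))\<^sup>2)"
      using c r by (intro sum_mono power_mono bcV) (auto intro!: sum_nonneg prod_nonneg)
    finally show "(1 - d)\<^sup>2 * G\<^sup>2 * Z \<le> (\<Sum>V\<in>Pow P. (b (c * \<Prod>V))\<^sup>2)" .
  qed
  also have "\<dots> = (\<Sum>(c, V)\<in>C \<times> Pow P. (b (c * \<Prod>V))\<^sup>2)" by (rule sum.cartesian_product)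
  also have "\<dots> = (\<Sum>k\<in>(\<lambda>(c, V). c * \<Prod>V) ` (C \<times> Pow P). (b k)\<^sup>2)"
    by (subst sum.reindex[OF inj]) (auto intro!: sum.cong)
  also have "\<dots> = (\<Sum>k\<in>(\<lambda>(c, V). c * \<Prod>V) ` (C \<times> Pow P) \<inter> J. (b k)\<^sup>2)"
    using C(1) P(1) b0 by (intro sum.mono_neutral_right) auto
  also have "\<dots> \<le> (\<Sum>k\<in>J. (b k)\<^sup>2)" using finJ by (intro sum_mono2) auto
  finally have low: "real (card C) * ((1 - d)\<^sup>2 * G\<^sup>2 * Z) \<le> (\<Sum>k\<in>J. (b k)\<^sup>2)" .
  have G1: "G \<ge> 1"
  proof -
    have "(\<Prod>p\<in>{}. r p / (1 + (r p)\<^sup>2)) \<le> G"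
      unfolding G_def using P(1) r \<Xi> by (intro member_le_sum) (auto intro!: prod_nonneg)
    then show ?thesis by simp
  qed
  have C1: "real (card C) \<ge> 1" using C(1,2) by (simp add: Suc_le_eq card_gt_0_iff)
  let ?Q = "real (card C) * (1 - d)\<^sup>2 * G\<^sup>2"
  have "\<eta>' \<le> 1 / 2 \<Longrightarrow> 1 / 2 * (?Q * Z) \<le> (1 - \<eta>') * (\<Sum>k\<in>J. (b k)\<^sup>2)" for \<eta>'
    using low Z1 by (intro mult_mono) (auto simp: mult_ac)
  then have "1 / 2 * (?Q * Z) \<le> (1 - ?\<eta>) * (\<Sum>k\<in>J. (b k)\<^sup>2)" using \<eta> by simp
  also have "\<dots> \<le> (m\<^sup>2 * (1 + ?\<eta>) + ?e) * Z" using main unfolding 1 2 .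
  \<comment> \<open>With \<eta> at most \<open>1 / 2\<close> the two sides carry the factors
    \<open>1 / 2\<close> and \<open>3 / 2\<close>; the tail is allowed a quarter of
    \<open>?Q\<close>, and what is left of \<open>?Q\<close> is
    \<open>?Q / 4 \<le> 3 / 2 * m\<^sup>2\<close>.\<close>
  also have "\<dots> \<le> (m\<^sup>2 * (3 / 2) + ?Q / 4) * Z"
  proof (intro mult_right_mono add_mono mult_left_mono)
    have "1 * 1 \<le> real (card C) * G\<^sup>2" using C1 G1 by (intro mult_mono) (auto simp: one_le_power)
    then have "(1 - d)\<^sup>2 * 1 \<le> (1 - d)\<^sup>2 * (real (card C) * G\<^sup>2)" by (intro mult_left_mono) auto
    with err show "?e \<le> ?Q / 4" by (simp add: mult_ac)
  qed (use \<eta> Z1 in auto)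
  finally have "1 / 2 * ?Q * Z \<le> (m\<^sup>2 * (3 / 2) + ?Q / 4) * Z" by (simp add: mult_ac)
  then have "1 / 2 * ?Q \<le> m\<^sup>2 * (3 / 2) + ?Q / 4" using Z1 by (subst (asm) mult_le_cancel_right) auto
  moreover have "1 / 2 * q \<le> y * (3 / 2) + q / 4 \<Longrightarrow> q / 6 \<le> y" for q y :: real by simp
  ultimately have "?Q / 6 \<le> m\<^sup>2" by blast
  moreover have "((1 - d) * sqrt (real (card C)) * G / sqrt 6)\<^sup>2 = ?Q / 6"
    by (simp add: power_divide power_mult_distrib mult_ac)
  moreover have "m \<ge> 0"
    using norm_twisted_sum_le_max[where f = f and t = 1, OF N0 f(2), of T] T norm_ge_zero[of "twisted_sum f N 1"] unfolding m_def by linarith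
  ultimately have "((1 - d) * sqrt (real (card C)) * G / sqrt 6)\<^sup>2 \<le> m\<^sup>2" and "m \<ge> 0" by simp_all
  then show ?thesis unfolding m_def[symmetric] by (rule power2_le_imp_le)
qed

section \<open>Choice of the resonator\<close>

context mertens_const
begin

context
  fixes l B A \<tau> \<tau>' lam :: real
  assumes l: "l \<ge> 1" and B: "B \<ge> 1"
    and \<tau>: "((\<lambda>u. exp (- u) / u) has_integral \<tau>) {A..}"
    and \<tau>': "((\<lambda>u. exp (- u) / u\<^sup>2) has_integral \<tau>') {A..}"
    and lam: "lam > 0" "lam\<^sup>2 \<le> l * exp l"
begin

text \<open>By Cauchy's inequality, weights proportional to \<open>1 / (sqrt p * ln p)\<close> are
  extremal for the untilted sum of \<open>r p / sqrt p\<close> under a bound on the sum of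
  \<open>(r p)\<^sup>2 * ln p\<close>, the quantity that Markov's inequality needs. Since
  \<open>exp l\<close> stands for \<open>ln T\<close>, the standing bound on \<open>lam\<close> says
  \<open>lam \<le> L\<close>.\<close>

definition res_weight :: "nat \<Rightarrow> real" where
  "res_weight p = lam / (sqrt (real p) * ln (real p))"

definition tilted_weight :: "nat \<Rightarrow> real" where
  "tilted_weight p = res_weight p / (1 + (res_weight p)\<^sup>2) * exp (- (1 / 2 + A / l) * ln (real p))"

lemma A_pos: "A > 0"
  by (rule exp_over_integral_pos[OF \<tau>])

context
  fixes p :: nat
  assumes p: "p \<in> log_primes l (B * l)"
begin

abbreviation (input) "base_weight \<equiv> lam * exp (- (A / l * ln (real p))) / (real p * ln (real p))"

lemma p_large: "real p > exp l" "real p > 1" "ln (real p) > l"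
proof -
  note * = log_primesD[OF p]
  show "real p > 1" "ln (real p) > l" using * by auto
  have "exp l < exp (ln (real p))" using * by (subst exp_less_cancel_iff) simp
  then show "real p > exp l" using * by simp
qed

lemma res_weight_nonneg: "res_weight p \<ge> 0"
  unfolding res_weight_def using p_large lam l by (intro divide_nonneg_nonneg) auto

lemma res_weight_sq: "(res_weight p)\<^sup>2 = lam\<^sup>2 / (real p * (ln (real p))\<^sup>2)"
  using p_large by (simp add: res_weight_def power_divide power_mult_distrib)

text \<open>Here the lower cutoff \<open>ln p > l\<close> pays off: the weights are small on the
  whole support, so the denominators \<open>1 + (res_weight p)\<^sup>2\<close> cost only a factor
  tending to 1.\<close>

lemma res_weight_sq_le: "(res_weight p)\<^sup>2 \<le> 1 / l"
proof -
  have "lam\<^sup>2 / (real p * (ln (real p))\<^sup>2) \<le> (l * real p) / (real p * l\<^sup>2)"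
  proof (intro frac_le mult_left_mono power_mono)
    have "l * exp l \<le> l * real p" using p_large l by (intro mult_left_mono) auto
    with lam show "lam\<^sup>2 \<le> l * real p" by linarith
  qed (use p_large l in auto)
  also have "\<dots> = 1 / l" using p_large l by (simp add: power2_eq_square)
  finally show ?thesis unfolding res_weight_sq .
qed

lemma tilted_weight_eq: "tilted_weight p = base_weight / (1 + (res_weight p)\<^sup>2)"
proof -
  have "sqrt (real p) = exp (1 / 2 * ln (real p))"
    using p_large powr_half_sqrt[of "real p"] by (simp add: powr_def)
  then have *: "exp (- (1 / 2) * ln (real p)) = 1 / sqrt (real p)" by (simp add: exp_minus field_simps)
  have "exp (- (1 / 2 + A / l) * ln (real p)) = exp (- (1 / 2) * ln (real p)) * exp (- (A / l * ln (real p)))"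
    by (simp add: exp_add[symmetric] algebra_simps)
  also have "\<dots> = exp (- (A / l * ln (real p))) / sqrt (real p)" unfolding * by simp
  finally have "exp (- (1 / 2 + A / l) * ln (real p)) = exp (- (A / l * ln (real p))) / sqrt (real p)" .
  then have "res_weight p * exp (- (1 / 2 + A / l) * ln (real p)) =
      lam * exp (- (A / l * ln (real p))) / ((sqrt (real p) * sqrt (real p)) * ln (real p))"
    by (simp only: res_weight_def times_divide_times_eq mult_ac)
  then have rw: "res_weight p * exp (- (1 / 2 + A / l) * ln (real p)) = base_weight" by simp
  have t: "tilted_weight p = (res_weight p * exp (- (1 / 2 + A / l) * ln (real p))) / (1 + (res_weight p)\<^sup>2)"
    unfolding tilted_weight_def by (rule times_divide_eq_left)
  show ?thesis unfolding t rw ..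
qed

lemma base_weight_nonneg: "base_weight \<ge> 0" using lam p_large l by (intro divide_nonneg_nonneg mult_nonneg_nonneg) auto

lemma tilted_weight_nonneg: "tilted_weight p \<ge> 0"
  unfolding tilted_weight_eq by (rule divide_nonneg_nonneg[OF base_weight_nonneg]) simp

lemma tilted_weight_le: "tilted_weight p \<le> base_weight"
proof -
  have "base_weight / (1 + (res_weight p)\<^sup>2) \<le> base_weight / 1"
    using base_weight_nonneg by (intro divide_left_mono) (auto intro: add_pos_nonneg)
  then show ?thesis unfolding tilted_weight_eq by simp
qed

lemma base_weight_le: "base_weight \<le> lam / (real p * ln (real p))"
  using lam p_large l A_pos by (intro divide_right_mono) auto

lemma tilted_weight_le_inverse: "tilted_weight p \<le> 1 / l"
proof (rule power2_le_imp_le)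
  have "tilted_weight p \<le> lam / (real p * ln (real p))"
    using tilted_weight_le base_weight_le by linarith
  then have "(tilted_weight p)\<^sup>2 \<le> (lam / (real p * ln (real p)))\<^sup>2"
    using tilted_weight_nonneg by (intro power_mono)
  also have "\<dots> = (res_weight p)\<^sup>2 * (1 / real p)"
    unfolding res_weight_sq by (simp add: power_divide power_mult_distrib power2_eq_square)
  also have "\<dots> \<le> (1 / l) * (1 / l)"
  proof (intro mult_mono res_weight_sq_le divide_left_mono)
    show "l \<le> real p" using p_large exp_ge_add_one_self[of l] by linarith
  qed (use l p_large in auto)
  finally show "(tilted_weight p)\<^sup>2 \<le> (1 / l)\<^sup>2" by (simp add: power2_eq_square)
qed (use l in auto)

lemma tilted_prob_le: "tilted_weight p / (1 + tilted_weight p) \<le> base_weight"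
proof -
  have "tilted_weight p / (1 + tilted_weight p) \<le> tilted_weight p / 1"
    using tilted_weight_nonneg by (intro divide_left_mono) auto
  then show ?thesis using tilted_weight_le by simp
qed

text \<open>One factor \<open>1 - 1 / l\<close> pays for the denominator
  \<open>1 + (res_weight p)\<^sup>2\<close>, the other for \<open>1 + tilted_weight p\<close>.
  Together with the upper bound this lets \<open>base_weight\<close>, whose prime sums are known,
  replace the inclusion probability.\<close>

lemma tilted_prob_ge: "tilted_weight p / (1 + tilted_weight p) \<ge> (1 - 1 / l)\<^sup>2 * base_weight"
proof -
  have *: "1 / (1 + t) \<ge> 1 - 1 / l" if "0 \<le> t" "t \<le> 1 / l" for t
  proof -
    have "(1 - t) * (1 + t) \<le> 1" by (simp add: algebra_simps)
    then have "1 - t \<le> 1 / (1 + t)" using that by (simp add: le_divide_eq)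
    then show ?thesis using that by linarith
  qed
  have l1: "1 - 1 / l \<ge> 0" using l by simp
  have "(1 - 1 / l)\<^sup>2 * base_weight = (base_weight * (1 - 1 / l)) * (1 - 1 / l)" by (simp add: power2_eq_square)
  also have "\<dots> \<le> (base_weight * (1 / (1 + (res_weight p)\<^sup>2))) * (1 / (1 + tilted_weight p))"
  proof (rule mult_mono)
    show "base_weight * (1 - 1 / l) \<le> base_weight * (1 / (1 + (res_weight p)\<^sup>2))"
      by (rule mult_left_mono[OF *[OF zero_le_power2 res_weight_sq_le] base_weight_nonneg])
    show "1 - 1 / l \<le> 1 / (1 + tilted_weight p)"
      by (rule *[OF tilted_weight_nonneg tilted_weight_le_inverse])
    show "0 \<le> base_weight * (1 / (1 + (res_weight p)\<^sup>2))"
      by (rule mult_nonneg_nonneg[OF base_weight_nonneg]) simp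
  qed (rule l1)
  also have "base_weight * (1 / (1 + (res_weight p)\<^sup>2)) = tilted_weight p" unfolding tilted_weight_eq by simp
  finally show ?thesis by simp
qed

end

section \<open>Moments of the tilted weights and the explicit lower bound\<close>

abbreviation (input) "support \<equiv> log_primes l (B * l)"
abbreviation (input) "tilted_mean \<equiv> \<Sum>p\<in>support. tilted_weight p / (1 + tilted_weight p) * ln (real p)"

lemma sum_res_weight: "(\<Sum>p\<in>support. (res_weight p)\<^sup>2 * ln (real p)) \<le> lam\<^sup>2 * (1 / l + D / l\<^sup>2)"
proof -
  have "(\<Sum>p\<in>support. (res_weight p)\<^sup>2 * ln (real p)) = lam\<^sup>2 * (\<Sum>p\<in>support. 1 / (real p * ln (real p)))"
    unfolding sum_distrib_left
  proof (intro sum.cong refl)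
    fix p assume p: "p \<in> support"
    have "ln (real p) > 0" using p_large[OF p] l by linarith
    then show "(res_weight p)\<^sup>2 * ln (real p) = lam\<^sup>2 * (1 / (real p * ln (real p)))"
      unfolding res_weight_sq[OF p] by (simp add: power2_eq_square)
  qed
  also have "\<dots> \<le> lam\<^sup>2 * (1 / l + D / l\<^sup>2)"
    using l B by (intro mult_left_mono prime_sum_inverse_log) auto
  finally show ?thesis .
qed

lemma tilted_mean_nonneg: "tilted_mean \<ge> 0"
proof (rule sum_nonneg)
  fix p assume p: "p \<in> support"
  show "0 \<le> tilted_weight p / (1 + tilted_weight p) * ln (real p)"
    using tilted_weight_nonneg[OF p] p_large[OF p] by (intro mult_nonneg_nonneg divide_nonneg_nonneg) auto
qed

lemma tilted_mean_le: "tilted_mean \<le> lam * (\<tau> + D * exp (- A) / l)"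
proof -
  have "tilted_mean \<le> (\<Sum>p\<in>support. lam * (exp (- (A / l * ln (real p))) / real p))"
  proof (rule sum_mono)
    fix p assume p: "p \<in> support"
    have "ln (real p) > 0" using p_large[OF p] l by linarith
    then have "tilted_weight p / (1 + tilted_weight p) * ln (real p) \<le>
        lam * exp (- (A / l * ln (real p))) / (real p * ln (real p)) * ln (real p)"
      by (intro mult_right_mono tilted_prob_le[OF p]) auto
    also have "\<dots> = lam * (exp (- (A / l * ln (real p))) / real p)" using \<open>ln (real p) > 0\<close> by simp
    finally show "tilted_weight p / (1 + tilted_weight p) * ln (real p) \<le> lam * (exp (- (A / l * ln (real p))) / real p)" .
  qed
  also have "\<dots> \<le> lam * (\<tau> + D * exp (- A) / l)"
    unfolding sum_distrib_left[symmetric] using l B lam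
    by (intro mult_left_mono prime_sum_exp_over_log[OF _ _ \<tau> \<tau>']) auto
  finally show ?thesis .
qed

text \<open>The standard deviation is at most of order \<open>sqrt (lam * B * l)\<close>, far below
  the mean \<open>lam * \<tau>\<close> even for \<tau> a negative power of \<open>l\<close>.\<close>

lemma tilted_variance_le: "(\<Sum>p\<in>support. tilted_weight p * (ln (real p))\<^sup>2) \<le> lam * (B * l + D)"
proof -
  have "(\<Sum>p\<in>support. tilted_weight p * (ln (real p))\<^sup>2) \<le> (\<Sum>p\<in>support. lam * (ln (real p) / real p))"
  proof (rule sum_mono)
    fix p assume p: "p \<in> support"
    have "tilted_weight p \<le> lam / (real p * ln (real p))"
      using tilted_weight_le[OF p] base_weight_le[OF p] by linarith
    then have "tilted_weight p * (ln (real p))\<^sup>2 \<le> lam / (real p * ln (real p)) * (ln (real p))\<^sup>2"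
      by (intro mult_right_mono) auto
    moreover have "ln (real p) > 0" using p_large[OF p] l by linarith
    ultimately show "tilted_weight p * (ln (real p))\<^sup>2 \<le> lam * (ln (real p) / real p)"
      by (simp add: power2_eq_square)
  qed
  also have "\<dots> \<le> lam * (B * l + D)"
    unfolding sum_distrib_left[symmetric] using l B lam
    by (intro mult_left_mono prime_sum_log) auto
  finally show ?thesis .
qed

text \<open>As \<open>ln (1 + h) \<ge> h / (1 + h)\<close>, each prime contributes at least
  \<open>1 + A / l * ln p\<close> times its inclusion probability, which is the summand with the
  closed form.\<close>

lemma tilted_gain:
  "A / l * tilted_mean + ln (\<Prod>p\<in>support. 1 + tilted_weight p) \<ge>
    (1 - 1 / l)\<^sup>2 * (lam * (exp (- A) / l * (1 - 1 / B - D * (A + 1) / l)))"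
proof -
  have "(1 - 1 / l)\<^sup>2 * (lam * (exp (- A) / l * (1 - 1 / B - D * (A + 1) / l))) \<le>
      (1 - 1 / l)\<^sup>2 * (lam * (\<Sum>p\<in>support. (1 + A / l * ln (real p)) * exp (- (A / l * ln (real p))) / (real p * ln (real p))))"
    using lam l B A_pos by (intro mult_left_mono prime_sum_gain) auto
  also have "\<dots> = (\<Sum>p\<in>support. (1 + A / l * ln (real p)) * ((1 - 1 / l)\<^sup>2 * (lam * exp (- (A / l * ln (real p))) / (real p * ln (real p)))))"
    by (simp add: sum_distrib_left mult_ac)
  also have "\<dots> \<le> (\<Sum>p\<in>support. (1 + A / l * ln (real p)) * (tilted_weight p / (1 + tilted_weight p)))"
  proof (intro sum_mono mult_left_mono tilted_prob_ge)
    fix p assume p: "p \<in> support"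
    show "0 \<le> 1 + A / l * ln (real p)" using p_large[OF p] l A_pos by (intro add_nonneg_nonneg mult_nonneg_nonneg) auto
  qed
  also have "\<dots> = (\<Sum>p\<in>support. A / l * (tilted_weight p / (1 + tilted_weight p) * ln (real p)) + tilted_weight p / (1 + tilted_weight p))"
    by (intro sum.cong refl) (simp only: distrib_right mult_1_left mult_ac add.commute)
  also have "\<dots> = A / l * tilted_mean + (\<Sum>p\<in>support. tilted_weight p / (1 + tilted_weight p))"
    by (simp only: sum.distrib sum_distrib_left)
  also have "(\<Sum>p\<in>support. tilted_weight p / (1 + tilted_weight p)) \<le> (\<Sum>p\<in>support. ln (1 + tilted_weight p))"
    by (intro sum_mono ln_one_plus_ge tilted_weight_nonneg)
  also have "\<dots> = ln (\<Prod>p\<in>support. 1 + tilted_weight p)"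
    using tilted_weight_nonneg by (intro ln_prod[symmetric]) (auto simp: add_nonneg_eq_0_iff)
  finally show ?thesis by simp
qed

text \<open>Here \<open>n\<close> is \<open>ln N\<close>. The integers \<open>u\<close> may be as
  large as \<open>exp \<Xi>\<close>, with \<Xi> the tilted mean plus \<rho>, and cofactors up to
  \<open>exp (n - \<Xi>)\<close> fill the rest of the length. The tilt being
  \<open>1 / 2 + A / l\<close>, the gain from untilting multiplied by
  \<open>exp ((n - \<Xi>) / 2)\<close> leaves \<open>sqrt N\<close> and \<open>A / l\<close> times
  the mean.\<close>

lemma max_twisted_sum_explicit:
  fixes f :: "nat \<Rightarrow> complex" and T \<sigma> d \<Lambda> \<rho> n :: real
  assumes f: "completely_multiplicative f" "\<And>n. n \<ge> 1 \<Longrightarrow> norm (f n) = 1"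
    and \<Lambda>: "\<Lambda> > 0" "lam\<^sup>2 * (1 / l + D / l\<^sup>2) \<le> d * \<Lambda>" and d: "d \<le> 1"
    and \<rho>: "\<rho> > 0" "4 * (lam * (B * l + D)) \<le> \<rho>\<^sup>2"
    and n: "lam * (\<tau> + D * exp (- A) / l) + \<rho> \<le> n"
    and Al: "A / l \<le> 1" and T: "T > 2" and \<sigma>: "\<sigma> > 0"
    and \<eta>: "exp n * exp \<Lambda> * exp (- (\<sigma> / (exp n * exp \<Lambda>))\<^sup>2 / 2) \<le> 1 / 2"
    and err: "2 * (exp n)\<^sup>2 * (exp n * exp \<Lambda>) * exp (- ((T / 2 - 1) / \<sigma>)\<^sup>2 / 4) \<le> (1 - d)\<^sup>2 / 4"
  shows "max_twisted_sum f (exp n) T \<ge> sqrt (exp n) *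
    exp ((1 - 1 / l)\<^sup>2 * (lam * (exp (- A) / l * (1 - 1 / B - D * (A + 1) / l))) - 2 * \<rho>) *
    ((1 - d) / 4) / sqrt (exp (D + 1) * (exp (B * l) + n))"
proof -
  define s where "s = 1 / 2 + A / l"
  define m where "m = tilted_mean"
  define H where "H = (\<Prod>p\<in>support. 1 + tilted_weight p)"
  define \<Xi> where "\<Xi> = m + \<rho>"
  define G where "G = (\<Sum>U | U \<subseteq> support \<and> (\<Sum>p\<in>U. ln (real p)) \<le> \<Xi>. \<Prod>p\<in>U. res_weight p / (1 + (res_weight p)\<^sup>2))"
  have m0: "m \<ge> 0" unfolding m_def by (rule tilted_mean_nonneg)
  have s0: "s \<ge> 0" using A_pos l by (simp add: s_def)
  have \<Xi>n: "\<Xi> \<le> n" using tilted_mean_le n unfolding \<Xi>_def m_def by linarith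
  have \<Xi>0: "\<Xi> \<ge> 0" using m0 \<rho> by (simp add: \<Xi>_def)
  have Hpos: "H > 0" unfolding H_def using tilted_weight_nonneg by (intro prod_pos) (auto intro: add_pos_nonneg)
  have tw: "tilted_weight = (\<lambda>p. res_weight p / (1 + (res_weight p)\<^sup>2) * exp (- s * ln (real p)))"
    by (simp add: tilted_weight_def s_def fun_eq_iff)
  have Gge: "G \<ge> 3 / 4 * exp (s * (m - \<rho>)) * H"
    unfolding G_def H_def m_def \<Xi>_def tw
  proof (rule truncated_product_lower[OF finite_log_primes _ s0 \<rho>(1)])
    show "0 \<le> res_weight p / (1 + (res_weight p)\<^sup>2)" if "p \<in> support" for p
      using res_weight_nonneg[OF that] by (intro divide_nonneg_nonneg) auto
    show "4 * (\<Sum>p\<in>support. res_weight p / (1 + (res_weight p)\<^sup>2) * exp (- s * ln (real p)) * (ln (real p))\<^sup>2) \<le> \<rho>\<^sup>2"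
      unfolding fun_cong[OF tw, symmetric] using tilted_variance_le \<rho>(2) by linarith
  qed
  have l0: "0 \<le> l" and lB: "l \<le> B * l" using l B by auto
  have W1: "exp (n - \<Xi>) \<ge> 1" using \<Xi>n by simp
  obtain C where C: "finite C" "C \<noteq> {}" "\<And>c. c \<in> C \<Longrightarrow> c > 0"
      "\<And>c p. c \<in> C \<Longrightarrow> p \<in> support \<Longrightarrow> \<not> p dvd c" "\<And>c. c \<in> C \<Longrightarrow> real c \<le> exp (n - \<Xi>)"
      "exp (n - \<Xi>) \<le> real (card C) * (exp (D + 1) * (exp (B * l) + ln (exp (n - \<Xi>))))"
    by (rule cofactor_set[OF W1 l0 lB]) (rule that, assumption+)
  define Q where "Q = exp (D + 1) * (exp (B * l) + n)"
  have Q: "Q > 0" unfolding Q_def using \<Xi>0 \<Xi>n by (intro mult_pos_pos add_pos_nonneg) auto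
  have "real (card C) * (exp (D + 1) * (exp (B * l) + ln (exp (n - \<Xi>)))) \<le> real (card C) * Q"
    unfolding Q_def using \<Xi>0 by (intro mult_left_mono add_mono) auto
  then have cardC: "exp (n - \<Xi>) / Q \<le> real (card C)" using C(6) Q by (simp add: divide_le_eq)
  have main: "max_twisted_sum f (exp n) T \<ge> (1 - d) * sqrt (real (card C)) * G / sqrt 6"
    unfolding G_def
  proof (rule max_twisted_sum_lower[OF f finite_log_primes _ _ C(1-4) _ \<Xi>0 \<Lambda>(1) d T \<sigma> _ _ \<eta> err])
    show "prime p" if "p \<in> support" for p using log_primesD[OF that] by simp
    show "0 \<le> res_weight p" if "p \<in> support" for p by (rule res_weight_nonneg[OF that])
    show "real c * exp \<Xi> \<le> exp n" if "c \<in> C" for c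
      using C(5)[OF that] by (simp add: exp_diff le_divide_eq)
    show "1 \<le> exp n" using \<Xi>0 \<Xi>n by simp
    show "(\<Sum>p\<in>support. (res_weight p)\<^sup>2 * ln (real p)) \<le> d * \<Lambda>" using sum_res_weight \<Lambda>(2) by linarith
  qed
  let ?g = "(1 - 1 / l)\<^sup>2 * (lam * (exp (- A) / l * (1 - 1 / B - D * (A + 1) / l)))"
  have gain: "?g \<le> A / l * m + ln H" unfolding m_def H_def by (rule tilted_gain)
  have "sqrt (exp n) * exp (?g - 2 * \<rho>) / sqrt Q \<le> sqrt (exp n) * exp (A / l * m + ln H - (1 + A / l) * \<rho>) / sqrt Q"
  proof (intro divide_right_mono mult_left_mono)
    have "A / l * \<rho> \<le> 1 * \<rho>" using Al \<rho> by (intro mult_right_mono) auto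
    then have "(1 + A / l) * \<rho> \<le> 2 * \<rho>" by (simp add: algebra_simps)
    then show "exp (?g - 2 * \<rho>) \<le> exp (A / l * m + ln H - (1 + A / l) * \<rho>)"
      using gain by (subst exp_le_cancel_iff) linarith
  qed (use Q in auto)
  also have "\<dots> = sqrt (exp (n - \<Xi>) / Q) * (exp (s * (m - \<rho>)) * H)"
  proof -
    have sq: "sqrt (exp t) = exp (t / 2)" for t :: real
      using real_sqrt_unique[of "exp (t / 2)" "exp t"] by (simp add: power2_eq_square flip: exp_add)
    have "exp (n / 2) * exp (A / l * m + ln H - (1 + A / l) * \<rho>) = exp ((n - \<Xi>) / 2) * (exp (s * (m - \<rho>)) * exp (ln H))"
    proof -
      \<comment> \<open>This cancellation of \<open>m / 2\<close> is why the tilt contains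
        \<open>1 / 2\<close>; the terms in \<rho> add up to \<open>1 + A / l\<close>, at most
        2.\<close>
      have "n / 2 + (t * m + h - (1 + t) * \<rho>) = (n - (m + \<rho>)) / 2 + ((1 / 2 + t) * (m - \<rho>) + h)" for t h
        by (simp add: field_simps)
      from this[of "A / l" "ln H"] show ?thesis unfolding exp_add[symmetric] s_def \<Xi>_def by (rule arg_cong)
    qed
    then show ?thesis using Hpos by (simp add: real_sqrt_divide sq)
  qed
  also have "\<dots> \<le> sqrt (real (card C)) * (4 / 3 * G)"
  proof (rule mult_mono)
    show "exp (s * (m - \<rho>)) * H \<le> 4 / 3 * G" using Gge by simp
    show "sqrt (exp (n - \<Xi>) / Q) \<le> sqrt (real (card C))" using cardC by (rule real_sqrt_le_mono)
  qed (use Hpos in auto)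
  \<comment> \<open>The factor \<open>1 / 4\<close> is \<open>3 / 4\<close> from Chebyshev's
    inequality times \<open>1 / 3\<close>, a lower bound for \<open>1 / sqrt 6\<close>.\<close>
  finally have "(1 - d) / 4 * (sqrt (exp n) * exp (?g - 2 * \<rho>) / sqrt Q) \<le> (1 - d) / 4 * (sqrt (real (card C)) * (4 / 3 * G))"
    using d by (intro mult_left_mono) auto
  also have "\<dots> = (1 - d) * sqrt (real (card C)) * G / 3" by simp
  also have "\<dots> \<le> (1 - d) * sqrt (real (card C)) * G / sqrt 6"
  proof (rule divide_left_mono)
    have "0 \<le> 3 / 4 * exp (s * (m - \<rho>)) * H" using Hpos by simp
    then have "G \<ge> 0" using Gge by linarith
    then show "0 \<le> (1 - d) * sqrt (real (card C)) * G" using d by simp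
    show "sqrt 6 \<le> 3" by (rule real_le_lsqrt) auto
  qed auto
  also have "\<dots> \<le> max_twisted_sum f (exp n) T" by (rule main)
  finally show ?thesis unfolding Q_def by (simp add: mult_ac)
qed

end

end

section \<open>Asymptotics\<close>

context mertens_const
begin

text \<open>All requirements on the size of \<open>x = ln T\<close> are collected as hypotheses free
  of \<open>N\<close>, \<tau>, \<open>A\<close> and \<open>f\<close>, so that they can hold
  uniformly. \<open>c2\<close> is the budget for Markov's inequality, \<open>c3\<close> makes mean
  plus deviation fit into \<open>ln N\<close>, \<open>c4\<close> bounds the tilt, \<open>c6\<close>
  keeps \<open>N\<close> below a small power of \<open>T\<close>, \<open>c5\<close> and
  \<open>c7\<close> handle off-diagonal terms and Gaussian tail, and \<open>c8\<close> says that the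
  gain outweighs all losses.\<close>

lemma max_twisted_sum_ge_of_large:
  fixes C d B x \<epsilon> \<tau> \<tau>' A \<kappa> N :: real and f :: "nat \<Rightarrow> complex"
  defines "l \<equiv> ln x"
  defines "L \<equiv> sqrt (x * l)"
  defines "a \<equiv> ln 3 + C * ln l"
  defines "\<rho> \<equiv> 2 * sqrt (L * (B * l + D))"
  defines "h \<equiv> (1 - d) / 2"
  assumes d: "0 < d" "d < 1" and B: "B \<ge> 1"
    and c1: "l \<ge> 1" "exp x > 2"
    and c2: "d\<^sup>2 * (1 + D / l) \<le> 1"
    and c3: "d\<^sup>2 * (1 + 3 * D * (a + 1) / l) + \<rho> * l powr C / L \<le> 1"
    and c4: "a / l \<le> 1"
    and c5: "exp x * exp (- (exp (h * x) / x)\<^sup>2 / 2) \<le> 1 / 2"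
    and c6: "L * l powr C / x \<le> h"
    and c7: "2 * exp (4 * x) * exp (- ((exp x / 2 - 1) / (exp x / x))\<^sup>2 / 4) \<le> (1 - d)\<^sup>2 / 4"
    and c8: "(1 - 1 / l)\<^sup>2 * d\<^sup>2 * (1 - 1 / B - D * (a + 1) / l) -
        3 * l powr C / sqrt (x / l) * (2 * \<rho> + ln (exp (D + 1) * (x powr B + L * l powr C)) / 2 - ln ((1 - d) / 4)) \<ge> 1 - \<epsilon>"
    and N: "N > 0" "ln N = L * \<tau>"
    and tau: "\<tau> = l powr \<kappa>" "\<bar>\<kappa>\<bar> \<le> C"
    and int: "((\<lambda>u. exp (- u) / u) has_integral \<tau>) {A..}"
    and int': "((\<lambda>u. exp (- u) / u\<^sup>2) has_integral \<tau>') {A..}"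
    and f: "completely_multiplicative f" "\<And>n. n \<ge> 1 \<Longrightarrow> norm (f n) = 1"
  shows "max_twisted_sum f N (exp x) \<ge> sqrt N * exp ((1 - \<epsilon>) * A * (\<tau> + \<tau>') * sqrt (x / l))"
proof -
  \<comment> \<open>The mean of \<open>ln m\<close> is then about \<open>d ^ 4 * x\<close>, below
    the required \<open>d * \<Lambda> = d\<^sup>2 * x\<close>, and the mean of \<open>ln u\<close>
    is about \<open>d\<^sup>2 * ln N\<close>. The slack in both absorbs the Mertens errors and
    \<rho>.\<close>
  define lam where "lam = d\<^sup>2 * L"
  define \<Lambda> where "\<Lambda> = d * x"
  define n where "n = L * \<tau>"
  define u where "u = L * l powr C"
  define K where "K = sqrt (x / l)"
  have x: "x > 0" "x \<ge> 1"
  proof -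
    show "x > 0"
    proof (rule ccontr)
      assume "\<not> x > 0"
      then have "exp x \<le> 1" by simp
      then show False using c1(2) by linarith
    qed
    then show "x \<ge> 1" using c1(1) ln_ge_zero_iff[of x] unfolding l_def by linarith
  qed
  have expl: "exp l = x" using x by (simp add: l_def)
  have A: "A > 0" by (rule exp_over_integral_pos[OF int])
  have L: "L > 0" using x c1 by (simp add: L_def)
  have LK: "L / l = K"
  proof -
    have "L / l = (sqrt x * sqrt l) / (sqrt l * sqrt l)" using c1 by (simp add: L_def real_sqrt_mult)
    also have "\<dots> = sqrt x / sqrt l" using c1 by (simp del: real_sqrt_mult_self)
    also have "\<dots> = sqrt (x / l)" by (rule real_sqrt_divide[symmetric])
    finally show ?thesis by (simp add: K_def)
  qed
  have K: "K > 0" using x c1 by (simp add: K_def)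
  have L2: "L\<^sup>2 = x * l" using x c1 by (simp add: L_def)
  have \<rho>: "\<rho> > 0" "\<rho>\<^sup>2 = 4 * (L * (B * l + D))"
  proof -
    have "L * (B * l + D) > 0" using L B c1 D by (intro mult_pos_pos add_pos_pos) auto
    then show "\<rho> > 0" "\<rho>\<^sup>2 = 4 * (L * (B * l + D))" by (auto simp: \<rho>_def power_mult_distrib)
  qed
  have d2: "d\<^sup>2 \<le> 1" using d by (simp add: power_le_one)
  have tau_le: "\<tau> \<le> l powr C" and tau_low: "l powr (- C) \<le> \<tau>"
    using tau c1 by (auto intro!: powr_mono)
  have tau_ge1: "1 \<le> l powr C * \<tau>"
    using mult_left_mono[OF tau_low, of "l powr C"] c1 by (simp flip: powr_add)
  have t0: "\<tau> > 0" using tau c1 by simp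
  have C0: "C \<ge> 0" using tau by linarith
  \<comment> \<open>This yields both uniform bounds: a loss is at most
    \<open>3 * l powr C * exp (- A)\<close> times itself, and \<open>A\<close> is at most
    \<open>a = ln 3 + C * ln l\<close>, which is small against \<open>l\<close>.\<close>
  have eA: "exp (- A) \<ge> l powr (- C) / 3"
    by (rule exp_A_ge[OF int int' tau_low]) (use C0 c1 in \<open>simp add: powr_le_one_le powr_minus ge_one_powr_ge_zero inverse_le_1_iff\<close>)
  have eA1: "1 \<le> 3 * l powr C * exp (- A)"
    using mult_left_mono[OF eA, of "3 * l powr C"] c1 by (simp flip: powr_add)
  have Aa: "A \<le> a"
  proof -
    have "ln (l powr (- C) / 3) \<le> ln (exp (- A))" using eA c1 by (subst ln_le_cancel_iff) auto
    then show ?thesis using c1 by (simp add: ln_div ln_powr a_def)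
  qed
  have nu: "n \<le> u" "n > 0" unfolding n_def u_def using tau_le L t0 by (auto intro: mult_left_mono)
  have uh: "u \<le> h * x" using c6 x by (simp add: u_def divide_le_eq)
  have Nn: "N = exp n" using N by (metis exp_ln n_def)

  have main: "max_twisted_sum f (exp n) (exp x) \<ge> sqrt (exp n) *
    exp ((1 - 1 / l)\<^sup>2 * (lam * (exp (- A) / l * (1 - 1 / B - D * (A + 1) / l))) - 2 * \<rho>) *
    ((1 - d) / 4) / sqrt (exp (D + 1) * (exp (B * l) + n))"
  proof (rule max_twisted_sum_explicit[OF c1(1) B int int' _ _ f, where \<sigma> = "exp x / x" and \<Lambda> = \<Lambda>])
    show "lam > 0" using d L by (simp add: lam_def)
    have "lam\<^sup>2 = (d\<^sup>2)\<^sup>2 * (x * l)" unfolding lam_def power_mult_distrib L2 by simp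
    also have "\<dots> \<le> 1 * (x * l)" using d x c1 by (intro mult_right_mono power_le_one) auto
    finally show "lam\<^sup>2 \<le> l * exp l" by (simp add: expl mult.commute)
    show "\<Lambda> > 0" using d x by (simp add: \<Lambda>_def)
    have "lam\<^sup>2 * (1 / l + D / l\<^sup>2) = d\<^sup>2 * x * (d\<^sup>2 * (1 + D / l))"
      unfolding lam_def power_mult_distrib L2 using c1 by (simp add: field_simps power2_eq_square)
    also have "\<dots> \<le> d\<^sup>2 * x * 1" using c2 x by (intro mult_left_mono) auto
    finally show "lam\<^sup>2 * (1 / l + D / l\<^sup>2) \<le> d * \<Lambda>" by (simp add: \<Lambda>_def power2_eq_square mult_ac)
    show "4 * (lam * (B * l + D)) \<le> \<rho>\<^sup>2"
    proof -
      have "d\<^sup>2 * (L * (B * l + D)) \<le> 1 * (L * (B * l + D))"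
        using d2 L B c1 D by (intro mult_right_mono) auto
      then show ?thesis unfolding \<rho>(2) lam_def by (simp add: mult.assoc)
    qed
    show "lam * (\<tau> + D * exp (- A) / l) + \<rho> \<le> n"
    proof -
      have "exp (- A) \<le> 3 * (A + 1) * \<tau>" by (rule tau_ge[OF int int'])
      also have "\<dots> \<le> 3 * (a + 1) * \<tau>" using Aa t0 by (intro mult_right_mono) auto
      finally have "D * exp (- A) / l \<le> D * (3 * (a + 1) * \<tau>) / l"
        using D c1 by (intro divide_right_mono mult_left_mono) auto
      then have "lam * (\<tau> + D * exp (- A) / l) \<le> lam * (\<tau> + D * (3 * (a + 1) * \<tau>) / l)"
        using d L by (intro mult_left_mono) (auto simp: lam_def)
      also have "\<dots> = n * (d\<^sup>2 * (1 + 3 * D * (a + 1) / l))"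
        using c1 by (simp add: lam_def n_def field_simps)
      finally have 1: "lam * (\<tau> + D * exp (- A) / l) \<le> n * (d\<^sup>2 * (1 + 3 * D * (a + 1) / l))" .
      have "\<rho> * 1 \<le> \<rho> * (l powr C * \<tau>)" using \<rho> tau_ge1 by (intro mult_left_mono) auto
      also have "\<dots> = n * (\<rho> * l powr C / L)" using L by (simp add: n_def field_simps)
      finally have "lam * (\<tau> + D * exp (- A) / l) + \<rho> \<le>
          n * (d\<^sup>2 * (1 + 3 * D * (a + 1) / l) + \<rho> * l powr C / L)"
        using 1 unfolding distrib_left by linarith
      also have "\<dots> \<le> n * 1" using c3 nu by (intro mult_left_mono) auto
      finally show ?thesis by simp
    qed
    have "A / l \<le> a / l" using Aa c1 by (intro divide_right_mono) auto
    then show "A / l \<le> 1" using c4 by linarith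
    let ?K = "exp n * exp \<Lambda>"
    \<comment> \<open>As \<open>h\<close> is half of \<open>1 - d\<close>, \<open>ln N\<close> and
      \<Lambda> together leave a gap of \<open>h * x\<close> below \<open>ln T\<close>, so the
      Gaussian width \<open>exp x / x\<close> still exceeds \<open>?K\<close> by a power of
      \<open>T\<close> up to the factor \<open>x\<close>.\<close>
    have Kle: "?K \<le> exp ((1 - h) * x)"
    proof -
      have "n + \<Lambda> \<le> h * x + d * x" using nu uh by (simp add: \<Lambda>_def)
      also have "\<dots> = (1 - h) * x" by (simp add: h_def field_simps)
      finally show ?thesis by (simp flip: exp_add)
    qed
    have "h \<ge> 0" using d by (simp add: h_def)
    show "?K * exp (- (exp x / x / ?K)\<^sup>2 / 2) \<le> 1 / 2"
    proof -
      have "exp (h * x) = exp x / exp ((1 - h) * x)" by (simp add: exp_diff[symmetric] algebra_simps)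
      also have "\<dots> \<le> exp x / ?K" using Kle by (intro divide_left_mono) auto
      finally have "exp (h * x) / x \<le> exp x / x / ?K" using x by (simp add: field_simps)
      then have "(exp (h * x) / x)\<^sup>2 \<le> (exp x / x / ?K)\<^sup>2" using x by (intro power_mono) auto
      then have e: "exp (- (exp x / x / ?K)\<^sup>2 / 2) \<le> exp (- (exp (h * x) / x)\<^sup>2 / 2)"
        by (subst exp_le_cancel_iff) simp
      have "(1 - h) * x \<le> 1 * x" using \<open>h \<ge> 0\<close> x by (intro mult_right_mono) auto
      then have "exp ((1 - h) * x) \<le> exp x" by (subst exp_le_cancel_iff) simp
      then have "?K \<le> exp x" using Kle by linarith
      then have "?K * exp (- (exp x / x / ?K)\<^sup>2 / 2) \<le> exp x * exp (- (exp (h * x) / x)\<^sup>2 / 2)"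
        by (intro mult_mono e) auto
      then show ?thesis using c5 by linarith
    qed
    show "2 * (exp n)\<^sup>2 * ?K * exp (- ((exp x / 2 - 1) / (exp x / x))\<^sup>2 / 4) \<le> (1 - d)\<^sup>2 / 4"
    proof -
      have "h * x \<le> 1 * x" using d x by (intro mult_right_mono) (auto simp: h_def)
      moreover have "d * x \<le> 1 * x" using d x by (intro mult_right_mono) auto
      ultimately have "n + n + (n + \<Lambda>) \<le> 4 * x" using nu uh unfolding \<Lambda>_def by linarith
      then have "exp (n + n + (n + \<Lambda>)) \<le> exp (4 * x)" by (subst exp_le_cancel_iff)
      then have "(exp n)\<^sup>2 * ?K \<le> exp (4 * x)" unfolding power2_eq_square by (simp only: exp_add mult.assoc)
      then have "2 * ((exp n)\<^sup>2 * ?K) * exp (- ((exp x / 2 - 1) / (exp x / x))\<^sup>2 / 4) \<le>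
          2 * exp (4 * x) * exp (- ((exp x / 2 - 1) / (exp x / x))\<^sup>2 / 4)"
        by (intro mult_right_mono mult_left_mono) auto
      then show ?thesis using c7 by (simp only: mult.assoc)
    qed
  qed (use c1 x d \<rho> in auto)

  define g where "g = (1 - 1 / l)\<^sup>2 * (lam * (exp (- A) / l * (1 - 1 / B - D * (A + 1) / l)))"
  define Q where "Q = exp (D + 1) * (exp (B * l) + n)"
  define Q0 where "Q0 = exp (D + 1) * (x powr B + u)"
  define R0 where "R0 = 2 * \<rho> + ln Q0 / 2 - ln ((1 - d) / 4)"
  define e where "e = exp (- A)"
  have Q: "Q > 0" unfolding Q_def using nu by (intro mult_pos_pos add_pos_pos) auto
  have QQ0: "Q \<le> Q0"
    unfolding Q_def Q0_def using nu x by (intro mult_left_mono add_mono) (auto simp: powr_def l_def)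
  have Q01: "Q0 \<ge> 1"
  proof -
    have "x powr B \<ge> 1" using x B by (intro ge_one_powr_ge_zero) auto
    then have "1 * 1 \<le> exp (D + 1) * (x powr B + u)" using D nu by (intro mult_mono) auto
    then show ?thesis by (simp add: Q0_def)
  qed
  have lnQ: "ln Q \<le> ln Q0" using Q QQ0 by simp
  have lnd: "ln ((1 - d) / 4) \<le> 0" using d by simp
  have R0: "R0 \<ge> 0" using \<rho>(1) ln_ge_zero[OF Q01] lnd unfolding R0_def by linarith
  have "g = (1 - 1 / l)\<^sup>2 * d\<^sup>2 * (1 - 1 / B - D * (A + 1) / l) * (K * e)"
    unfolding g_def lam_def LK[symmetric] e_def by simp
  also have "\<dots> \<ge> (1 - 1 / l)\<^sup>2 * d\<^sup>2 * (1 - 1 / B - D * (a + 1) / l) * (K * e)"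
  proof -
    have "D * (A + 1) / l \<le> D * (a + 1) / l"
      using D c1 Aa by (intro divide_right_mono mult_left_mono) auto
    then show ?thesis using K by (intro mult_right_mono mult_left_mono) (auto simp: e_def)
  qed
  finally have g: "g \<ge> (1 - 1 / l)\<^sup>2 * d\<^sup>2 * (1 - 1 / B - D * (a + 1) / l) * (K * e)" .
  \<comment> \<open>All losses together, now measured in units of the gain
    \<open>K * e\<close>.\<close>
  have "R0 * 1 \<le> R0 * (3 * l powr C * e)" using eA1 R0 unfolding e_def by (intro mult_left_mono)
  then have R: "R0 \<le> 3 * l powr C / K * R0 * (K * e)" using K by (simp add: mult_ac)
  have "(1 - \<epsilon>) * (K * e) \<le> ((1 - 1 / l)\<^sup>2 * d\<^sup>2 * (1 - 1 / B - D * (a + 1) / l) - 3 * l powr C / K * R0) * (K * e)"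
    using c8 K unfolding R0_def Q0_def u_def K_def e_def by (intro mult_right_mono) auto
  also have "\<dots> \<le> g - R0" using g R by (simp only: left_diff_distrib)
  finally have key: "(1 - \<epsilon>) * (K * e) \<le> g - R0" .
  have "(1 - \<epsilon>) * A * (\<tau> + \<tau>') * sqrt (x / l) = (1 - \<epsilon>) * (K * e)"
    unfolding e_def K_def A_tau_sum[OF int int', symmetric] by (simp only: mult_ac)
  then have "(1 - \<epsilon>) * A * (\<tau> + \<tau>') * sqrt (x / l) \<le> g - R0" using key by linarith
  then have "sqrt N * exp ((1 - \<epsilon>) * A * (\<tau> + \<tau>') * sqrt (x / l)) \<le> sqrt (exp n) * exp (g - R0)"
    by (simp add: Nn)
  also have "\<dots> \<le> sqrt (exp n) * exp (g - 2 * \<rho> + ln ((1 - d) / 4) - ln Q / 2)"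
    using lnQ by (intro mult_left_mono) (auto simp: R0_def)
  also have "\<dots> = sqrt (exp n) * exp (g - 2 * \<rho>) * ((1 - d) / 4) / sqrt Q"
  proof -
    have "sqrt Q = exp (ln Q / 2)" using Q powr_half_sqrt[of Q] by (simp add: powr_def)
    moreover have "exp (ln ((1 - d) / 4)) = (1 - d) / 4" using d by simp
    ultimately show ?thesis by (simp only: exp_diff exp_add) simp
  qed
  also have "\<dots> \<le> max_twisted_sum f N (exp x)"
    using main unfolding g_def Q_def Nn .
  finally show ?thesis .
qed

end

text \<open>Every hypothesis on \<open>x\<close> is a limit relation in which only \<open>C\<close>,
  \<epsilon> and the Mertens constant occur, so one threshold serves all \<open>N\<close>, \<tau>,
  \<open>A\<close> and \<open>f\<close>.\<close>

lemma max_twisted_sum_eventually_ge: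
  fixes C \<epsilon> :: real
  assumes C: "C > 0" and \<epsilon>: "0 < \<epsilon>" "\<epsilon> < 1"
  shows "\<forall>\<^sub>F x in at_top. \<forall>(N::real) (\<tau>::real) (\<kappa>::real) (A::real) (\<tau>'::real) (f :: nat \<Rightarrow> complex).
       N > 0 \<longrightarrow> ln N = sqrt (x * ln x) * \<tau> \<longrightarrow> \<tau> = ln x powr \<kappa> \<longrightarrow> \<bar>\<kappa>\<bar> \<le> C \<longrightarrow>
       ((\<lambda>u. exp (- u) / u) has_integral \<tau>) {A..} \<longrightarrow>
       ((\<lambda>u. exp (- u) / u\<^sup>2) has_integral \<tau>') {A..} \<longrightarrow>
       completely_multiplicative f \<longrightarrow> (\<forall>n\<ge>1. norm (f n) = 1) \<longrightarrow>
       max_twisted_sum f N (exp x) \<ge> sqrt N * exp ((1 - \<epsilon>) * A * (\<tau> + \<tau>') * sqrt (x / ln x))"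
proof -
  obtain D where D: "D > 0"
    "\<And>a b. 0 \<le> a \<Longrightarrow> a \<le> b \<Longrightarrow> \<bar>(\<Sum>p\<in>log_primes a b. ln (real p) / real p) - (b - a)\<bar> \<le> D"
    using mertens_window by blast
  interpret mertens_const D by unfold_locales (use D in auto)
  \<comment> \<open>With \<open>B = 4 / \<epsilon>\<close> the limiting constant is
    \<open>d\<^sup>2 * (1 - 1 / B) = (1 - \<epsilon> / 4) ^ 3\<close>, which exceeds
    \<open>1 - \<epsilon>\<close> by Bernoulli's inequality.\<close>
  define d where "d = 1 - \<epsilon> / 4"
  define B where "B = 4 / \<epsilon>"
  define h where "h = (1 - d) / 2"
  have d: "0 < d" "d < 1" and B: "B > 1" and h: "h > 0" using \<epsilon> by (auto simp: d_def B_def h_def)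
  have d1: "d\<^sup>2 < 1" using d by (simp add: power_less_one_iff)
  have d2: "d\<^sup>2 * (1 - 1 / B) > 1 - \<epsilon>"
  proof -
    have "d\<^sup>2 * (1 - 1 / B) = (1 - \<epsilon> / 4) ^ 3"
      using \<epsilon> by (simp add: d_def B_def power3_eq_cube power2_eq_square)
    moreover have "1 + 3 * (- (\<epsilon> / 4)) \<le> (1 + (- (\<epsilon> / 4))) ^ 3"
      using Bernoulli_inequality[of "- (\<epsilon> / 4)" 3] \<epsilon> by simp
    ultimately show ?thesis using \<epsilon> by simp
  qed
  note pos = C D(1) d B h
  have "\<forall>\<^sub>F x in at_top. ln x \<ge> (1::real)" "\<forall>\<^sub>F x in at_top. exp x > (2::real)"
    by real_asymp+
  moreover have "\<forall>\<^sub>F x in at_top. d\<^sup>2 * (1 + D / ln x) < 1"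
  proof (rule order_tendstoD)
    show "((\<lambda>x. d\<^sup>2 * (1 + D / ln x)) \<longlongrightarrow> d\<^sup>2) at_top" using pos by real_asymp
  qed (rule d1)
  moreover have "\<forall>\<^sub>F x in at_top. d\<^sup>2 * (1 + 3 * D * (ln 3 + C * ln (ln x) + 1) / ln x) +
      2 * sqrt (sqrt (x * ln x) * (B * ln x + D)) * ln x powr C / sqrt (x * ln x) < 1"
  proof (rule order_tendstoD)
    have "((\<lambda>x. d\<^sup>2 * (1 + 3 * D * (ln 3 + C * ln (ln x) + 1) / ln x)) \<longlongrightarrow> d\<^sup>2) at_top"
      using pos by real_asymp
    moreover have "((\<lambda>x. 2 * sqrt (sqrt (x * ln x) * (B * ln x + D)) * ln x powr C / sqrt (x * ln x)) \<longlongrightarrow> 0) at_top"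
      using pos by real_asymp
    ultimately show "((\<lambda>x. d\<^sup>2 * (1 + 3 * D * (ln 3 + C * ln (ln x) + 1) / ln x) +
      2 * sqrt (sqrt (x * ln x) * (B * ln x + D)) * ln x powr C / sqrt (x * ln x)) \<longlongrightarrow> d\<^sup>2 + 0) at_top"
      by (rule tendsto_add)
  qed (use d1 in simp)
  moreover have "\<forall>\<^sub>F x in at_top. (ln 3 + C * ln (ln x)) / ln x < 1"
  proof (rule order_tendstoD)
    show "((\<lambda>x. (ln 3 + C * ln (ln x)) / ln x) \<longlongrightarrow> 0) at_top" using pos by real_asymp
  qed simp
  moreover have "\<forall>\<^sub>F x in at_top. exp x * exp (- (exp (h * x) / x)\<^sup>2 / 2) < 1 / 2"
  proof (rule order_tendstoD)
    show "((\<lambda>x. exp x * exp (- (exp (h * x) / x)\<^sup>2 / 2)) \<longlongrightarrow> 0) at_top" using h by real_asymp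
  qed simp
  moreover have "\<forall>\<^sub>F x in at_top. sqrt (x * ln x) * ln x powr C / x < h"
  proof (rule order_tendstoD)
    show "((\<lambda>x. sqrt (x * ln x) * ln x powr C / x) \<longlongrightarrow> 0) at_top" using pos by real_asymp
  qed (rule h)
  moreover have "\<forall>\<^sub>F x in at_top. 2 * exp (4 * x) * exp (- ((exp x / 2 - 1) / (exp x / x))\<^sup>2 / 4) < (1 - d)\<^sup>2 / 4"
  proof (rule order_tendstoD)
    show "((\<lambda>x::real. 2 * exp (4 * x) * exp (- ((exp x / 2 - 1) / (exp x / x))\<^sup>2 / 4)) \<longlongrightarrow> 0) at_top"
      by real_asymp
  qed (use d in simp)
  moreover have "\<forall>\<^sub>F x in at_top. (1 - 1 / ln x)\<^sup>2 * d\<^sup>2 * (1 - 1 / B - D * (ln 3 + C * ln (ln x) + 1) / ln x) -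
        3 * ln x powr C / sqrt (x / ln x) * (2 * (2 * sqrt (sqrt (x * ln x) * (B * ln x + D))) +
          ln (exp (D + 1) * (x powr B + sqrt (x * ln x) * ln x powr C)) / 2 - ln ((1 - d) / 4)) > 1 - \<epsilon>"
  proof (rule order_tendstoD)
    have "((\<lambda>x. (1 - 1 / ln x)\<^sup>2 * d\<^sup>2 * (1 - 1 / B - D * (ln 3 + C * ln (ln x) + 1) / ln x)) \<longlongrightarrow> d\<^sup>2 * (1 - 1 / B)) at_top"
      using pos by real_asymp
    moreover have "((\<lambda>x. 3 * ln x powr C / sqrt (x / ln x) * (2 * (2 * sqrt (sqrt (x * ln x) * (B * ln x + D))))) \<longlongrightarrow> 0) at_top"
      using pos by real_asymp
    moreover have "((\<lambda>x. 3 * ln x powr C / sqrt (x / ln x) *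
        (ln (exp (D + 1) * (x powr B + sqrt (x * ln x) * ln x powr C)) / 2)) \<longlongrightarrow> 0) at_top"
      using pos by real_asymp
    moreover have "((\<lambda>x. 3 * ln x powr C / sqrt (x / ln x) * ln ((1 - d) / 4)) \<longlongrightarrow> 0 * ln ((1 - d) / 4)) at_top"
      by (intro tendsto_mult_right) (use pos in real_asymp)
    ultimately have "((\<lambda>x. (1 - 1 / ln x)\<^sup>2 * d\<^sup>2 * (1 - 1 / B - D * (ln 3 + C * ln (ln x) + 1) / ln x) -
        (3 * ln x powr C / sqrt (x / ln x) * (2 * (2 * sqrt (sqrt (x * ln x) * (B * ln x + D)))) +
         3 * ln x powr C / sqrt (x / ln x) * (ln (exp (D + 1) * (x powr B + sqrt (x * ln x) * ln x powr C)) / 2) -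
         3 * ln x powr C / sqrt (x / ln x) * ln ((1 - d) / 4))) \<longlongrightarrow>
        d\<^sup>2 * (1 - 1 / B) - (0 + 0 - 0 * ln ((1 - d) / 4))) at_top"
      by (intro tendsto_diff tendsto_add)
    then show "((\<lambda>x. (1 - 1 / ln x)\<^sup>2 * d\<^sup>2 * (1 - 1 / B - D * (ln 3 + C * ln (ln x) + 1) / ln x) -
        3 * ln x powr C / sqrt (x / ln x) * (2 * (2 * sqrt (sqrt (x * ln x) * (B * ln x + D))) +
          ln (exp (D + 1) * (x powr B + sqrt (x * ln x) * ln x powr C)) / 2 - ln ((1 - d) / 4))) \<longlongrightarrow>
        d\<^sup>2 * (1 - 1 / B) - (0 + 0 - 0 * ln ((1 - d) / 4))) at_top"
      by (simp only: right_diff_distrib distrib_left)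
  qed (use d2 in simp)
  ultimately show ?thesis
  proof eventually_elim
    case (elim x)
    show ?case
      by (intro allI impI, rule max_twisted_sum_ge_of_large[OF d, where B = B and C = C])
         (use elim B in \<open>auto simp: h_def intro: less_imp_le\<close>)
  qed
qed

text \<open>Diagonalisation: bounds that hold eventually for each fixed \<epsilon> combine into one
  bound with an error depending on \<open>T\<close> and tending to 0, namely nearly the least
  \<epsilon> admissible at \<open>T\<close>.\<close>

lemma eventually_vanishing_error:
  fixes Q :: "real \<Rightarrow> real \<Rightarrow> bool"
  assumes ev: "\<And>\<epsilon>. 0 < \<epsilon> \<Longrightarrow> \<epsilon> < 1 \<Longrightarrow> \<forall>\<^sub>F T in at_top. Q \<epsilon> T"
    and mono: "\<And>\<epsilon> \<epsilon>' T. \<epsilon> \<le> \<epsilon>' \<Longrightarrow> Q \<epsilon> T \<Longrightarrow> Q \<epsilon>' T"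
  shows "\<exists>g. (g \<longlongrightarrow> 0) at_top \<and> (\<forall>\<^sub>F T in at_top. Q (g T) T)"
proof -
  define S where "S T = {\<epsilon>. 0 < \<epsilon> \<and> \<epsilon> < 1 \<and> Q \<epsilon> T}" for T
  \<comment> \<open>The infimum need not be admissible itself; adding \<open>1 / T\<close> leaves an
    admissible \<epsilon> strictly below \<open>g T\<close>, and monotonicity does the rest.\<close>
  define g where "g T = Inf (S T) + 1 / T" for T
  have bdd: "bdd_below (S T)" for T unfolding S_def by (intro bdd_belowI[of _ 0]) auto
  have "((\<lambda>T. Inf (S T)) \<longlongrightarrow> 0) at_top"
  proof (rule tendstoI)
    fix e :: real assume "e > 0"
    then have "\<forall>\<^sub>F T in at_top. Q (min (e / 2) (1 / 2)) T" by (intro ev) auto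
    then show "\<forall>\<^sub>F T in at_top. dist (Inf (S T)) 0 < e"
    proof eventually_elim
      case (elim T)
      then have mem: "min (e / 2) (1 / 2) \<in> S T" using \<open>e > 0\<close> by (simp add: S_def)
      have "Inf (S T) \<le> min (e / 2) (1 / 2)" by (rule cInf_lower[OF mem bdd])
      moreover have "Inf (S T) \<ge> 0" using mem by (intro cInf_greatest) (auto simp: S_def)
      ultimately show ?case using \<open>e > 0\<close> by (auto simp: min_def split: if_splits)
    qed
  qed
  moreover have "((\<lambda>T::real. 1 / T) \<longlongrightarrow> 0) at_top" by real_asymp
  ultimately have "(g \<longlongrightarrow> 0 + 0) at_top" unfolding g_def by (rule tendsto_add)
  moreover have "\<forall>\<^sub>F T in at_top. Q (g T) T"
    using ev[of "1 / 2", simplified] eventually_gt_at_top[of "0 :: real"]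
  proof eventually_elim
    case (elim T)
    then have "S T \<noteq> {}" unfolding S_def by (intro ex_in_conv[THEN iffD1] exI[of _ "1 / 2"]) auto
    moreover have "Inf (S T) < g T" using elim by (simp add: g_def)
    ultimately obtain \<epsilon> where "\<epsilon> \<in> S T" "\<epsilon> < g T" using cInf_lessD by blast
    then show ?case using mono[of \<epsilon> "g T" T] by (auto simp: S_def)
  qed
  ultimately show ?thesis by auto
qed

text \<open>The condition \<open>\<tau> = (log_2 T)^{O(1)}\<close> is expressed by an exponent
  \<kappa> with \<open>\<bar>\<kappa>\<bar> \<le> C\<close>. The error \<open>e\<close> and the
  threshold are chosen after \<open>C\<close> but before \<open>N\<close>, \<tau>, \<open>A\<close>
  and \<open>f\<close>, so the o(1) is uniform in them.\<close>

theorem theorem1p1: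
  fixes C :: real
  shows "\<exists>e :: real \<Rightarrow> real. (e \<longlongrightarrow> 0) at_top \<and>
    (\<forall>\<^sub>F T in at_top. \<forall>(N::real) (\<tau>::real) (\<kappa>::real) (A::real) (\<tau>'::real) (f :: nat \<Rightarrow> complex).
       N > 0 \<longrightarrow>
       ln N = sqrt (ln T * ln (ln T)) * \<tau> \<longrightarrow>
       \<tau> > 0 \<longrightarrow>
       \<tau> = ln (ln T) powr \<kappa> \<longrightarrow> \<bar>\<kappa>\<bar> \<le> C \<longrightarrow>
       ((\<lambda>u. exp (- u) / u) has_integral \<tau>) {A..} \<longrightarrow>
       ((\<lambda>u. exp (- u) / u\<^sup>2) has_integral \<tau>') {A..} \<longrightarrow>
       completely_multiplicative f \<longrightarrow>
       (\<forall>n\<ge>1. norm (f n) = 1) \<longrightarrow>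
       max_twisted_sum f N T
         \<ge> sqrt N * exp ((1 + e T) * A * (\<tau> + \<tau>') * sqrt (ln T / ln (ln T))))"
proof -
  \<comment> \<open>Monotonicity in \<epsilon> is wanted at every \<open>T\<close>; the first
    conjunct excludes a negative argument of \<open>sqrt\<close>, whose value would be negative and
    reverse the inequality.\<close>
  define Q where "Q \<epsilon> T \<longleftrightarrow> ln T / ln (ln T) \<ge> 0 \<and> (\<forall>(N::real) (\<tau>::real) (\<kappa>::real) (A::real) (\<tau>'::real) (f :: nat \<Rightarrow> complex).
       N > 0 \<longrightarrow> ln N = sqrt (ln T * ln (ln T)) * \<tau> \<longrightarrow> \<tau> = ln (ln T) powr \<kappa> \<longrightarrow> \<bar>\<kappa>\<bar> \<le> C \<longrightarrow>
       ((\<lambda>u. exp (- u) / u) has_integral \<tau>) {A..} \<longrightarrow>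
       ((\<lambda>u. exp (- u) / u\<^sup>2) has_integral \<tau>') {A..} \<longrightarrow>
       completely_multiplicative f \<longrightarrow> (\<forall>n\<ge>1. norm (f n) = 1) \<longrightarrow>
       max_twisted_sum f N T \<ge> sqrt N * exp ((1 - \<epsilon>) * A * (\<tau> + \<tau>') * sqrt (ln T / ln (ln T))))" for \<epsilon> T
  have "\<forall>\<^sub>F T in at_top. Q \<epsilon> T" if \<epsilon>: "0 < \<epsilon>" "\<epsilon> < 1" for \<epsilon>
  proof -
    \<comment> \<open>The asymptotic lemma asks for a positive exponent bound, and enlarging
      \<open>C\<close> preserves the bound on \<kappa>.\<close>
    have "max C 1 > 0" by simp
    from eventually_compose_filterlim[OF max_twisted_sum_eventually_ge[OF this \<epsilon>] ln_at_top] eventually_gt_at_top[of "exp 1"]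
    show ?thesis
    proof eventually_elim
      case (elim T)
      have T: "T > 0" using elim(2) exp_gt_zero[of "1 :: real"] by linarith
      then have "ln T > 1" using elim(2) by (metis exp_less_cancel_iff exp_ln)
      then have pos: "ln T / ln (ln T) \<ge> 0" by simp
      show ?case unfolding Q_def
      proof (intro conjI pos allI impI, goal_cases)
        case (1 N \<tau> \<kappa> A \<tau>' f)
        have "\<bar>\<kappa>\<bar> \<le> max C 1" using 1 by simp
        with elim(1)[rule_format, of N \<tau> \<kappa> A \<tau>' f] 1 T show ?case by simp
      qed
    qed
  qed
  moreover have "Q \<epsilon>' T" if le: "\<epsilon> \<le> \<epsilon>'" and Q: "Q \<epsilon> T" for \<epsilon> \<epsilon>' T
    unfolding Q_def
  proof (intro conjI allI impI, goal_cases)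
    case 1
    show ?case using Q by (simp add: Q_def)
  next
    case (2 N \<tau> \<kappa> A \<tau>' f)
    have pos: "ln T / ln (ln T) \<ge> 0" using Q by (simp add: Q_def)
    have "(1 - \<epsilon>') * (exp (- A) * sqrt (ln T / ln (ln T))) \<le> (1 - \<epsilon>) * (exp (- A) * sqrt (ln T / ln (ln T)))"
      using le pos by (intro mult_right_mono) auto
    then have "(1 - \<epsilon>') * A * (\<tau> + \<tau>') * sqrt (ln T / ln (ln T)) \<le> (1 - \<epsilon>) * A * (\<tau> + \<tau>') * sqrt (ln T / ln (ln T))"
      unfolding A_tau_sum[OF 2(5,6), symmetric] by (simp only: mult.assoc)
    then have "sqrt N * exp ((1 - \<epsilon>') * A * (\<tau> + \<tau>') * sqrt (ln T / ln (ln T))) \<le>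
        sqrt N * exp ((1 - \<epsilon>) * A * (\<tau> + \<tau>') * sqrt (ln T / ln (ln T)))"
      using 2(1) by (intro mult_left_mono) auto
    also have "\<dots> \<le> max_twisted_sum f N T"
      using Q[unfolded Q_def, THEN conjunct2, rule_format, OF 2(1-7)] 2(8) by blast
    finally show ?case .
  qed
  ultimately obtain g where "(g \<longlongrightarrow> 0) at_top" "\<forall>\<^sub>F T in at_top. Q (g T) T"
    using eventually_vanishing_error[of Q] by blast
  then show ?thesis
  proof (intro exI[of _ "\<lambda>T. - g T"] conjI)
    assume "(g \<longlongrightarrow> 0) at_top"
    then show "((\<lambda>T. - g T) \<longlongrightarrow> 0) at_top" using tendsto_minus by fastforce
  next
    assume "\<forall>\<^sub>F T in at_top. Q (g T) T"
    then show "\<forall>\<^sub>F T in at_top. \<forall>(N::real) (\<tau>::real) (\<kappa>::real) (A::real) (\<tau>'::real) (f :: nat \<Rightarrow> complex).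
       N > 0 \<longrightarrow>
       ln N = sqrt (ln T * ln (ln T)) * \<tau> \<longrightarrow>
       \<tau> > 0 \<longrightarrow>
       \<tau> = ln (ln T) powr \<kappa> \<longrightarrow> \<bar>\<kappa>\<bar> \<le> C \<longrightarrow>
       ((\<lambda>u. exp (- u) / u) has_integral \<tau>) {A..} \<longrightarrow>
       ((\<lambda>u. exp (- u) / u\<^sup>2) has_integral \<tau>') {A..} \<longrightarrow>
       completely_multiplicative f \<longrightarrow>
       (\<forall>n\<ge>1. norm (f n) = 1) \<longrightarrow>
       max_twisted_sum f N T
         \<ge> sqrt N * exp ((1 + - g T) * A * (\<tau> + \<tau>') * sqrt (ln T / ln (ln T)))"
    proof eventually_elim
      case (elim T)
      then show ?case unfolding Q_def add_uminus_conv_diff by blast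
    qed
  qed
qed

end
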